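(* Let $M\in\mathbb{T}^{d\times m}$ and let $P=\mathrm{tconv}(M)$. For $J\in\binom{[m]}{d+1}$ let $M_J$ be the $d\times(d+1)$ submatrix of $M$ with columns indexed by $J$, and let $\overline{M_J}\in\mathbb{T}^{(d+1)\times(d+1)}$ be obtained from $M_J$ by appending a row filled with $0$'s. Then the tropical barycentric volume of $P$ is $$\mathrm{tbvol}(P)=\max_{J\in\binom{[m]}{d+1}}\Big\{\sum_{i=1}^d\mathrm{bt}(\mathrm{tconv}(M_J))_i:\overline{M_J}\text{ non-singular}\Big\},$$ and it can be computed in time $O\big(\binom{m}{d+1}\cdot d^3\big)$.
   Context: $\mathbb{T}=\mathbb{R}\cup\{-\infty\}$ with $x\oplus y=\max(x,y)$, $x\odot y=x+y$. For $V\subseteq\mathbb{T}^d$, $\mathrm{tconv}(V)=\{\bigoplus_{j=1}^n\lambda_j\odot v_j:\lambda_j\in\mathbb{T},\ \bigoplus_j\lambda_j=0,\ v_j\in V\}$; for a matrix, $\mathrm{tconv}$ is the tropical convex hull of its columns. A tropical polytope is $\mathrm{tconv}(V)$ for a finite set $V$; its vertices are the elements of its unique minimal generating set. Covector decomposition: let $v_1,\dots,v_n$ be the vertices of $P$, $v_j=(v_{1j},\dots,v_{dj})$, and put $v_{0j}=0$, $x_0=0$. For $G\subseteq\{0,\dots,d\}\times[n]$ let $C_G=\{x\in\mathbb{T}^d: v_{kj}+x_i\le v_{ij}+x_k\text{ for all }(i,j)\in G,\ k\in\{0,\dots,d\}\}$. The closed cells of the covector decomposition of $P$ are the nonempty $C_G$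 for which every $i\in\{0,\dots,d\}$ occurs in some $(i,j)\in G$ and every $j\in[n]$ occurs in some $(i,j)\in G$ with $v_{ij}\ne-\infty$. Their union is $P$, and their images under $x\mapsto(b^{x_1},\dots,b^{x_d})$ ($b>1$, $b^{-\infty}=0$) are convex polytopes forming a polyhedral complex; the dimension of a cell is the dimension of its image. The $d$-trunk $\mathrm{Tr}_d(P)$ is the union of all closed cells of dimension $d$; it is itself a tropical polytope. $\mathrm{tbvol}(P)=\max_{x\in\mathrm{Tr}_d(P)}(x_1+\dots+x_d)$, with $\max\emptyset=-\infty$. The tropical barycenter of a nonempty tropical polytope is its componentwise maximal point (which exists and is unique). For a tropical simplex $S=\mathrm{tconv}(A)$, $A\in\mathbb{T}^{d\times(d+1)}$, $\mathrm{bt}(S)$ denotes the tropical barycenter of the $d$-trunk of $S$. A matrix $A\in\mathbb{T}^{r\times r}$ is non-singular if the value $\mathrm{tdet}(A)=\max_{\sigma\in S_r}\sum_l a_{l\sigma(l)}$ is attained by at most one permutation. Running time counts arithmetic operations (additions, subtractions) and comparisons on elements of $\mathbb{T}$. *)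

theory Defs
  imports
    "HOL-Analysis.Analysis"
    "HOL-Library.Function_Algebras"
    "HOL-Combinatorics.Permutations"
begin

section \<open>Tropical polytopes\<close>

text \<open>
  The tropical semiring is the set of all \<open>x :: ereal\<close> with \<open>x \<noteq> \<infinity>\<close>, so that tropical
  addition is the maximum (\<open>SUP\<close> over finite index sets, with value \<open>-\<infinity>\<close> on the empty set)
  and tropical multiplication is \<open>+\<close>.

  A point \<open>(x\<^sub>1, \<dots>, x\<^sub>d)\<close> is represented by a function on \<open>nat\<close> that is \<open>0\<close> outside \<open>{1..d}\<close>.
  In particular \<open>x 0 = 0\<close>, which is the homogenizing convention used by the covector
  decomposition. This representation is stable under the normalized tropical
  combinations below, since the coefficients have maximum \<open>0\<close>.
\<close>

definition tspace :: "nat \<Rightarrow> (nat \<Rightarrow> ereal) set" where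
  "tspace d = {x. (\<forall>i\<in>{1..d}. x i \<noteq> \<infinity>) \<and> (\<forall>i. i \<notin> {1..d} \<longrightarrow> x i = 0)}"

definition tconv :: "(nat \<Rightarrow> ereal) set \<Rightarrow> (nat \<Rightarrow> ereal) set" where
  "tconv V = {x. \<exists>(n::nat) (l :: nat \<Rightarrow> ereal) (v :: nat \<Rightarrow> nat \<Rightarrow> ereal).
      (\<forall>j\<in>{1..n}. l j \<noteq> \<infinity> \<and> v j \<in> V) \<and>
      (SUP j\<in>{1..n}. l j) = 0 \<and>
      x = (\<lambda>i. SUP j\<in>{1..n}. l j + v j i)}"

text \<open>
  A matrix with \<open>d\<close> rows and \<open>m\<close> columns is a function of the row index in \<open>{1..d}\<close> and the
  column index in \<open>{1..m}\<close>; values at other indices are irrelevant.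
\<close>

definition tmatrix :: "nat \<Rightarrow> nat \<Rightarrow> (nat \<Rightarrow> nat \<Rightarrow> ereal) \<Rightarrow> bool" where
  "tmatrix d m M \<longleftrightarrow> (\<forall>i\<in>{1..d}. \<forall>j\<in>{1..m}. M i j \<noteq> \<infinity>)"

definition tcolumn :: "nat \<Rightarrow> (nat \<Rightarrow> nat \<Rightarrow> ereal) \<Rightarrow> nat \<Rightarrow> (nat \<Rightarrow> ereal)" where
  "tcolumn d M j = (\<lambda>i. if i \<in> {1..d} then M i j else 0)"

definition tconv_mat :: "nat \<Rightarrow> nat \<Rightarrow> (nat \<Rightarrow> nat \<Rightarrow> ereal) \<Rightarrow> (nat \<Rightarrow> ereal) set" where
  "tconv_mat d m M = tconv (tcolumn d M ` {1..m})"

definition vertices :: "(nat \<Rightarrow> ereal) set \<Rightarrow> (nat \<Rightarrow> ereal) set" where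
  "vertices P = (THE V. tconv V = P \<and> (\<forall>W. W \<subset> V \<longrightarrow> tconv W \<noteq> P))"


section \<open>Covector decomposition and trunk\<close>

text \<open>
  The second components of the pairs in \<open>G\<close> are the vertices themselves instead of their
  numbers in an enumeration.
\<close>

definition cell :: "nat \<Rightarrow> (nat \<times> (nat \<Rightarrow> ereal)) set \<Rightarrow> (nat \<Rightarrow> ereal) set" where
  "cell d G = {x \<in> tspace d. \<forall>(i, v)\<in>G. \<forall>k\<in>{0..d}. v k + x i \<le> v i + x k}"

definition covector_cells :: "nat \<Rightarrow> (nat \<Rightarrow> ereal) set \<Rightarrow> (nat \<Rightarrow> ereal) set set" where
  "covector_cells d P = {cell d G | G.
      G \<subseteq> {0..d} \<times> vertices P \<and> cell d G \<noteq> {} \<and>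
      (\<forall>i\<in>{0..d}. \<exists>v. (i, v) \<in> G) \<and>
      (\<forall>v\<in>vertices P. \<exists>i. (i, v) \<in> G \<and> v i \<noteq> -\<infinity>)}"

definition expo :: "real \<Rightarrow> (nat \<Rightarrow> ereal) \<Rightarrow> (nat \<Rightarrow> real)" where
  "expo b x = (\<lambda>i. if x i = -\<infinity> then 0 else b powr real_of_ereal (x i))"

text \<open>
  Dimension of the affine hull of a nonempty set, i.e. of its direction space.
  (The library's \<open>aff_dim\<close> fixes the dimension of the ambient space by its type.)
  The coordinates outside \<open>{1..d}\<close> of points in \<open>expo b ` tspace d\<close> are constant and hence
  do not contribute.
\<close>

definition scale_fun :: "real \<Rightarrow> (nat \<Rightarrow> real) \<Rightarrow> (nat \<Rightarrow> real)" where
  "scale_fun c f = (\<lambda>i. c * f i)"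

lemma vector_space_scale_fun: "vector_space scale_fun"
  by unfold_locales (auto simp: scale_fun_def fun_eq_iff algebra_simps)

definition affine_dim :: "(nat \<Rightarrow> real) set \<Rightarrow> nat" where
  "affine_dim S = vector_space.dim scale_fun {x - y | x y. x \<in> S \<and> y \<in> S}"

definition trunk :: "real \<Rightarrow> nat \<Rightarrow> (nat \<Rightarrow> ereal) set \<Rightarrow> (nat \<Rightarrow> ereal) set" where
  "trunk b d P = \<Union>{C \<in> covector_cells d P. affine_dim (expo b ` C) = d}"


section \<open>Tropical barycentric volume\<close>

definition tmax :: "ereal set \<Rightarrow> ereal" where
  "tmax S = (if S = {} then -\<infinity> else (GREATEST s. s \<in> S))"

definition tbvol :: "real \<Rightarrow> nat \<Rightarrow> (nat \<Rightarrow> ereal) set \<Rightarrow> ereal" where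
  "tbvol b d P = tmax ((\<lambda>x. \<Sum>i=1..d. x i) ` trunk b d P)"

text \<open>The order on functions is componentwise.\<close>

definition barycenter :: "(nat \<Rightarrow> ereal) set \<Rightarrow> (nat \<Rightarrow> ereal)" where
  "barycenter Q = (GREATEST x. x \<in> Q)"

definition bt :: "real \<Rightarrow> nat \<Rightarrow> (nat \<Rightarrow> ereal) set \<Rightarrow> (nat \<Rightarrow> ereal)" where
  "bt b d S = barycenter (trunk b d S)"


section \<open>Non-singular matrices\<close>

definition tdet :: "nat \<Rightarrow> (nat \<Rightarrow> nat \<Rightarrow> ereal) \<Rightarrow> ereal" where
  "tdet r A = Max ((\<lambda>p. \<Sum>l=1..r. A l (p l)) ` {p. p permutes {1..r}})"

definition nonsingular :: "nat \<Rightarrow> (nat \<Rightarrow> nat \<Rightarrow> ereal) \<Rightarrow> bool" where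
  "nonsingular r A \<longleftrightarrow>
     (\<exists>\<^sub>\<le>\<^sub>1p. p permutes {1..r} \<and> (\<Sum>l=1..r. A l (p l)) = tdet r A)"

definition select_columns :: "(nat \<Rightarrow> nat \<Rightarrow> ereal) \<Rightarrow> nat set \<Rightarrow> (nat \<Rightarrow> nat \<Rightarrow> ereal)" where
  "select_columns M J = (\<lambda>i k. M i (sorted_list_of_set J ! (k - 1)))"

definition append_zero_row :: "nat \<Rightarrow> (nat \<Rightarrow> nat \<Rightarrow> ereal) \<Rightarrow> (nat \<Rightarrow> nat \<Rightarrow> ereal)" where
  "append_zero_row d A = (\<lambda>i k. if i = d + 1 then 0 else A i k)"


section \<open>Programs and their running time\<close>

text \<open>
  Uniform random access programs: one program handles all dimensions. A program works on
  two stores, one holding natural numbers (for indices and control) and one holding elements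
  of the tropical semiring. Either store consists of named two-dimensional arrays of unbounded
  size, which are addressed by arithmetic expressions in natural numbers. Tropical values are
  only accessible through the constants \<open>0\<close> and \<open>-\<infinity>\<close>, copying, addition, subtraction and
  comparison. The running time is the number of additions, subtractions and comparisons of
  tropical values; everything else is free.
\<close>

type_synonym 'v store = "string \<times> nat \<times> nat \<Rightarrow> 'v"

type_synonym state = "nat store \<times> ereal store"

datatype nexp =
    NConst nat
  | NGet "string \<times> nexp \<times> nexp"
  | NPlus nexp nexp
  | NMinus nexp nexp
  | NTimes nexp nexp

type_synonym ref = "string \<times> nexp \<times> nexp"

fun neval :: "nat store \<Rightarrow> nexp \<Rightarrow> nat" where
  "neval N (NConst n) = n"
| "neval N (NGet (a, e, f)) = N (a, neval N e, neval N f)"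
| "neval N (NPlus e f) = neval N e + neval N f"
| "neval N (NMinus e f) = neval N e - neval N f"
| "neval N (NTimes e f) = neval N e * neval N f"

fun addr :: "nat store \<Rightarrow> ref \<Rightarrow> string \<times> nat \<times> nat" where
  "addr N (a, e, f) = (a, neval N e, neval N f)"

datatype cond = NLess nexp nexp | NEq nexp nexp | TLe ref ref

fun holds :: "cond \<Rightarrow> state \<Rightarrow> bool" where
  "holds (NLess e f) (N, T) \<longleftrightarrow> neval N e < neval N f"
| "holds (NEq e f) (N, T) \<longleftrightarrow> neval N e = neval N f"
| "holds (TLe p q) (N, T) \<longleftrightarrow> T (addr N p) \<le> T (addr N q)"

fun cond_cost :: "cond \<Rightarrow> nat" where
  "cond_cost (NLess e f) = 0"
| "cond_cost (NEq e f) = 0"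
| "cond_cost (TLe p q) = 1"

datatype com =
    Skip
  | NSet ref nexp
  | TZero ref
  | TNegInf ref
  | TCopy ref ref
  | TAdd ref ref ref
  | TSub ref ref ref
  | Seq com com
  | Ite cond com com
  | While cond com

text \<open>
  \<open>exec c s t s'\<close>: started in state \<open>s\<close>, the program \<open>c\<close> terminates in state \<open>s'\<close> after time \<open>t\<close>.
  There is no rule for the subtraction of \<open>-\<infinity>\<close>, which is undefined in the tropical semiring.
\<close>

inductive exec :: "com \<Rightarrow> state \<Rightarrow> nat \<Rightarrow> state \<Rightarrow> bool" where
  Skip: "exec Skip s 0 s"
| NSet: "exec (NSet r e) (N, T) 0 (N(addr N r := neval N e), T)"
| TZero: "exec (TZero r) (N, T) 0 (N, T(addr N r := 0))"
| TNegInf: "exec (TNegInf r) (N, T) 0 (N, T(addr N r := -\<infinity>))"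
| TCopy: "exec (TCopy r p) (N, T) 0 (N, T(addr N r := T (addr N p)))"
| TAdd: "exec (TAdd r p q) (N, T) 1 (N, T(addr N r := T (addr N p) + T (addr N q)))"
| TSub: "T (addr N q) \<noteq> -\<infinity> \<Longrightarrow>
    exec (TSub r p q) (N, T) 1 (N, T(addr N r := T (addr N p) - T (addr N q)))"
| Seq: "exec c s t s' \<Longrightarrow> exec c' s' t' s'' \<Longrightarrow> exec (Seq c c') s (t + t') s''"
| IteTrue: "holds g s \<Longrightarrow> exec c s t s' \<Longrightarrow> exec (Ite g c c') s (cond_cost g + t) s'"
| IteFalse: "\<not> holds g s \<Longrightarrow> exec c' s t s' \<Longrightarrow> exec (Ite g c c') s (cond_cost g + t) s'"
| WhileFalse: "\<not> holds g s \<Longrightarrow> exec (While g c) s (cond_cost g) s"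
| WhileTrue: "holds g s \<Longrightarrow> exec c s t s' \<Longrightarrow> exec (While g c) s' t' s'' \<Longrightarrow>
    exec (While g c) s (cond_cost g + t + t') s''"

definition input_state :: "nat \<Rightarrow> nat \<Rightarrow> (nat \<Rightarrow> nat \<Rightarrow> ereal) \<Rightarrow> state" where
  "input_state d m M =
    ((\<lambda>_. 0)((''d'', 0, 0) := d, (''m'', 0, 0) := m),
     (\<lambda>(a, i, j). if a = ''M'' \<and> i \<in> {1..d} \<and> j \<in> {1..m} then M i j else -\<infinity>))"

definition output_value :: "state \<Rightarrow> ereal" where
  "output_value s = snd s (''out'', 0, 0)"

end

(* A cell of full dimension contains a real point at which every vertex is attached to exactly one
   coordinate. Choosing one vertex for every coordinate yields a simplex tconv(M_J) and a permutation
   that beats all others strictly, so each d-cell of P lies in the single d-cell of a simplex with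
   non-singular matrix. Conversely, the greatest point of that cell of a simplex lies in the trunk of
   P: moving from it into the cell along a direction with pairwise distinct coordinates reaches points
   at which all vertices of P are attached to unique coordinates.

   Points of the cell are the optimal dual solutions of the assignment problem of the matrix. So the
   program runs, for every J, the Hungarian algorithm with row-wise augmentation, then Bellman-Ford to
   reach the greatest dual solution, and finally tests by repeated removal of sinks whether the graph
   of tight inequalities is acyclic, which means that the optimal permutation is unique. All of this
   takes O(d^3) tropical operations; the enumeration of the sets J is free. *)

theory Submission
  imports Defs "HOL-Library.Nat_Bijection"
begin

section \<open>Weakest preconditions with a cost clock\<close>

text \<open>Let \<open>B\<close> be the matrix of a simplex with the zero row as row 0, and let
  \<open>\<sigma>\<close> match its rows to columns. The inequalities of the cell that attaches
  column \<open>\<sigma> i\<close> to coordinate \<open>i\<close> are dual feasibility plus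
  complementary slackness, with the column potential \<open>B i (\<sigma> i) - X i\<close>
  eliminated; so one system, \<open>potential\<close>, serves the geometry and the program. Two
  obstacles shape the proof. Entries may be \<open>-\<infinity>\<close>, whose subtraction has no
  execution rule, so potentials are kept real and infeasibility shows up as a violation of Hall's
  condition. Points of a cell may also have coordinates \<open>-\<infinity>\<close>, so full
  dimension is expressed by a real point with strict inequalities. The Hungarian method stays cubic
  because a search keeps the best reduced cost of every column and compares only the newest tree
  row. The existence of an optimal dual solution, on which the formula rests as well, is read off
  from the correctness of the program. For \<open>d = 0\<close> the time bound is zero, which forces
  a branch without tropical arithmetic.\<close>

definition wp :: "com \<Rightarrow> (nat store \<Rightarrow> ereal store \<Rightarrow> nat \<Rightarrow> bool) \<Rightarrow> nat store \<Rightarrow> ereal store \<Rightarrow> nat \<Rightarrow> bool" where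
  "wp c Q N T k \<longleftrightarrow> (\<exists>t N' T'. exec c (N, T) t (N', T') \<and> Q N' T' (k + t))"

inductive_simps exec_simps:
  "exec Skip (N, T) t s'"
  "exec (NSet r e) (N, T) t s'"
  "exec (TZero r) (N, T) t s'"
  "exec (TNegInf r) (N, T) t s'"
  "exec (TCopy r p) (N, T) t s'"
  "exec (TAdd r p q) (N, T) t s'"
  "exec (TSub r p q) (N, T) t s'"
  "exec (Seq c c') (N, T) t s'"
  "exec (Ite g c c') (N, T) t s'"

lemma wp_simps [simp]:
  "wp Skip Q N T k \<longleftrightarrow> Q N T k"
  "wp (NSet r e) Q N T k \<longleftrightarrow> Q (N(addr N r := neval N e)) T k"
  "wp (TZero r) Q N T k \<longleftrightarrow> Q N (T(addr N r := 0)) k"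
  "wp (TNegInf r) Q N T k \<longleftrightarrow> Q N (T(addr N r := -\<infinity>)) k"
  "wp (TCopy r p) Q N T k \<longleftrightarrow> Q N (T(addr N r := T (addr N p))) k"
  "wp (TAdd r p q) Q N T k \<longleftrightarrow> Q N (T(addr N r := T (addr N p) + T (addr N q))) (Suc k)"
  "wp (TSub r p q) Q N T k \<longleftrightarrow>
    T (addr N q) \<noteq> -\<infinity> \<and> Q N (T(addr N r := T (addr N p) - T (addr N q))) (Suc k)"
  by (simp_all add: wp_def exec_simps)

lemma wp_Seq [simp]: "wp (Seq c c') Q = wp c (wp c' Q)"
proof (intro ext iffI)
  fix N T k
  assume "wp (Seq c c') Q N T k"
  then obtain t1 t2 N' T' N'' T'' where
    "exec c (N, T) t1 (N', T')" "exec c' (N', T') t2 (N'', T'')" "Q N'' T'' (k + (t1 + t2))"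
    unfolding wp_def by (auto simp: exec_simps)
  then show "wp c (wp c' Q) N T k"
    unfolding wp_def add.assoc[symmetric] by blast
next
  fix N T k
  assume "wp c (wp c' Q) N T k"
  then obtain t1 t2 N' T' N'' T'' where
    "exec c (N, T) t1 (N', T')" "exec c' (N', T') t2 (N'', T'')" "Q N'' T'' (k + t1 + t2)"
    unfolding wp_def by blast
  then show "wp (Seq c c') Q N T k"
    unfolding wp_def add.assoc by (blast intro: exec.Seq)
qed

lemma wp_Ite [simp]: "wp (Ite g c c') Q N T k \<longleftrightarrow>
    wp (if holds g (N, T) then c else c') Q N T (k + cond_cost g)"
proof -
  have "exec (Ite g c c') (N, T) t s' \<longleftrightarrow>
      (\<exists>t'. t = cond_cost g + t' \<and> exec (if holds g (N, T) then c else c') (N, T) t' s')" for t s'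
    by (auto simp: exec_simps)
  then show ?thesis unfolding wp_def by (simp add: add.assoc) blast
qed

lemma wp_mono: "wp c Q N T k \<Longrightarrow> (\<And>N' T' k'. Q N' T' k' \<Longrightarrow> Q' N' T' k') \<Longrightarrow> wp c Q' N T k"
  unfolding wp_def by blast

text \<open>Running time is additive, so a block can be specified with the clock at 0 and then used
  at an arbitrary clock value.\<close>

lemma wp_shift: "wp c (\<lambda>N T k'. Q N T (k + k')) N T 0 \<longleftrightarrow> wp c Q N T k"
  unfolding wp_def by simp

lemma wp_WhileFalse: "\<not> holds g (N, T) \<Longrightarrow> Q N T (k + cond_cost g) \<Longrightarrow> wp (While g c) Q N T k"
  unfolding wp_def by (metis exec.WhileFalse)

lemma wp_WhileTrue:
  assumes "holds g (N, T)" "wp c (wp (While g c) Q) N T (k + cond_cost g)"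
  shows "wp (While g c) Q N T k"
proof -
  from assms(2) obtain t N' T' t' N'' T'' where
    "exec c (N, T) t (N', T')" "exec (While g c) (N', T') t' (N'', T'')"
    "Q N'' T'' (k + cond_cost g + t + t')"
    unfolding wp_def by blast
  moreover have "k + cond_cost g + t + t' = k + (cond_cost g + t + t')"
    by simp
  ultimately show ?thesis
    using exec.WhileTrue[OF assms(1)] unfolding wp_def by metis
qed

section \<open>Frame conditions from the arrays that a program writes\<close>

fun nmods :: "com \<Rightarrow> string set" where
  "nmods (NSet r e) = {fst r}"
| "nmods (Seq c c') = nmods c \<union> nmods c'"
| "nmods (Ite g c c') = nmods c \<union> nmods c'"
| "nmods (While g c) = nmods c"
| "nmods _ = {}"

fun tmods :: "com \<Rightarrow> string set" where
  "tmods (TZero r) = {fst r}"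
| "tmods (TNegInf r) = {fst r}"
| "tmods (TCopy r p) = {fst r}"
| "tmods (TAdd r p q) = {fst r}"
| "tmods (TSub r p q) = {fst r}"
| "tmods (Seq c c') = tmods c \<union> tmods c'"
| "tmods (Ite g c c') = tmods c \<union> tmods c'"
| "tmods (While g c) = tmods c"
| "tmods _ = {}"

definition same :: "string set \<Rightarrow> 'v store \<Rightarrow> 'v store \<Rightarrow> bool" where
  "same X f g \<longleftrightarrow> (\<forall>a i j. a \<notin> X \<longrightarrow> g (a, i, j) = f (a, i, j))"

lemma sameD: "same X f g \<Longrightarrow> a \<notin> X \<Longrightarrow> g (a, i, j) = f (a, i, j)"
  unfolding same_def by blast

lemma same_refl [simp]: "same X f f"
  unfolding same_def by simp

lemma same_trans: "same X f g \<Longrightarrow> same Y g h \<Longrightarrow> same (X \<union> Y) f h"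
  unfolding same_def by simp

lemma exec_same:
  "exec c s t s' \<Longrightarrow> same (nmods c) (fst s) (fst s') \<and> same (tmods c) (snd s) (snd s')"
proof (induction rule: exec.induct)
  case (Seq c s t s' c' t' s'')
  then show ?case by (auto intro: same_trans)
next
  case (WhileTrue g s c t s' t' s'')
  then show ?case by (auto simp: same_def)
qed (auto simp: same_def split: prod.splits elim!: addr.elims)

lemma wp_frame:
  assumes "wp c Q N T k"
  shows "wp c (\<lambda>N' T' k'. Q N' T' k' \<and> same (nmods c) N N' \<and> same (tmods c) T T') N T k"
  using assms unfolding wp_def by (fastforce dest: exec_same)

text \<open>The rule by which specified blocks are composed: a specification mentions only what
  changes, and the \<open>same\<close> facts supply the rest, at the granularity of whole
  arrays.\<close>

lemma wp_use:
  assumes "wp c Q N T 0"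
    and "\<And>N' T' k'. Q N' T' k' \<Longrightarrow> same (nmods c) N N' \<Longrightarrow> same (tmods c) T T' \<Longrightarrow> Q' N' T' (k + k')"
  shows "wp c Q' N T k"
  using wp_mono[OF wp_frame[OF assms(1)], of "\<lambda>N' T' k'. Q' N' T' (k + k')"] assms(2)
  by (simp add: wp_shift)

section \<open>Counting loops\<close>

abbreviation sc :: "string \<Rightarrow> ref" where
  "sc a \<equiv> (a, NConst 0, NConst 0)"

abbreviation ve :: "string \<Rightarrow> nexp \<Rightarrow> ref" where
  "ve a e \<equiv> (a, e, NConst 0)"

abbreviation vr :: "string \<Rightarrow> nexp" where
  "vr a \<equiv> NGet (sc a)"

text \<open>The bound \<open>e\<close> is evaluated anew before every iteration, hence the constancy
  premise in the loop rules. Loop control uses natural numbers only and is free.\<close>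

definition For :: "string \<Rightarrow> nexp \<Rightarrow> com \<Rightarrow> com" where
  "For v e c = Seq (NSet (sc v) (NConst 0))
     (While (NLess (vr v) e) (Seq c (NSet (sc v) (NPlus (vr v) (NConst 1)))))"

lemma nmods_For [simp]: "nmods (For v e c) = insert v (nmods c)"
  unfolding For_def by auto

lemma tmods_For [simp]: "tmods (For v e c) = tmods c"
  unfolding For_def by auto

text \<open>Iterations may have different costs \<open>f j\<close>. The enumeration of all
  \<open>2 ^ m\<close> subsets depends on this, because only those of size \<open>d + 1\<close> may
  be charged. The invariant for \<open>Suc j\<close> is imposed on the store whose counter has
  already been advanced.\<close>

lemma wp_For_sum:
  fixes f :: "nat \<Rightarrow> nat"
  assumes fresh: "v \<notin> nmods c"
    and bound: "\<And>N. same (insert v (nmods c)) N0 N \<Longrightarrow> neval N e = b"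
    and init: "I 0 (N0((v, 0, 0) := 0)) T0"
    and step: "\<And>j N T. \<lbrakk>j < b; N (v, 0, 0) = j; I j N T; same (insert v (nmods c)) N0 N; same (tmods c) T0 T\<rbrakk>
      \<Longrightarrow> wp c (\<lambda>N' T' k'. I (Suc j) (N'((v, 0, 0) := Suc j)) T' \<and> k' \<le> f j) N T 0"
    and post: "\<And>N T k. \<lbrakk>I b N T; same (insert v (nmods c)) N0 N; same (tmods c) T0 T; k \<le> k0 + sum f {..<b}\<rbrakk> \<Longrightarrow> Q N T k"
  shows "wp (For v e c) Q N0 T0 k0"
proof -
  let ?w = "While (NLess (vr v) e) (Seq c (NSet (sc v) (NPlus (vr v) (NConst 1))))"
  have loop: "wp ?w Q N T k"
    if "j \<le> b" "N (v, 0, 0) = j" "I j N T" "same (insert v (nmods c)) N0 N" "same (tmods c) T0 T"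
      "k \<le> k0 + sum f {..<j}" for j N T k
    using that
  proof (induction "b - j" arbitrary: j N T k)
    case 0
    then have "j = b" by simp
    with 0 show ?case by (intro wp_WhileFalse) (auto simp: bound intro: post)
  next
    case (Suc x)
    then have "j < b" by simp
    have *: "wp ?w Q (N'((v, 0, 0) := Suc j)) T' (k + k')"
      if "I (Suc j) (N'((v, 0, 0) := Suc j)) T'" "k' \<le> f j" "same (nmods c) N N'" "same (tmods c) T T'"
      for N' T' k'
    proof (rule Suc.hyps(1))
      show "same (insert v (nmods c)) N0 (N'((v, 0, 0) := Suc j))"
        using that(3) Suc.prems(4) by (auto simp: same_def)
      show "same (tmods c) T0 T'"
        using that(4) Suc.prems(5) by (auto simp: same_def)
    qed (use that Suc \<open>j < b\<close> in \<open>auto\<close>)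
    show ?case
    proof (rule wp_WhileTrue)
      show "holds (NLess (vr v) e) (N, T)"
        using Suc.prems \<open>j < b\<close> by (simp add: bound)
      have "wp c (wp (NSet (sc v) (NPlus (vr v) (NConst 1))) (wp ?w Q)) N T k"
      proof (rule wp_use[OF step])
        fix N' T' k'
        assume a: "I (Suc j) (N'((v, 0, 0) := Suc j)) T' \<and> k' \<le> f j" "same (nmods c) N N'" "same (tmods c) T T'"
        have "N' (v, 0, 0) = j" using a(2) fresh Suc.prems(2) by (simp add: sameD)
        with * a show "wp (NSet (sc v) (NPlus (vr v) (NConst 1))) (wp ?w Q) N' T' (k + k')"
          by simp
      qed (use Suc.prems \<open>j < b\<close> in auto)
      then show "wp (Seq c (NSet (sc v) (NPlus (vr v) (NConst 1)))) (wp ?w Q) N T (k + cond_cost (NLess (vr v) e))"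
        by simp
    qed
  qed
  have "wp ?w Q (N0((v, 0, 0) := 0)) T0 k0"
    by (rule loop[of 0]) (use init in \<open>auto simp: same_def\<close>)
  then show ?thesis by (simp add: For_def)
qed

lemma wp_For:
  assumes "v \<notin> nmods c"
    and "\<And>N. same (insert v (nmods c)) N0 N \<Longrightarrow> neval N e = b"
    and "I 0 (N0((v, 0, 0) := 0)) T0"
    and "\<And>j N T. \<lbrakk>j < b; N (v, 0, 0) = j; I j N T; same (insert v (nmods c)) N0 N; same (tmods c) T0 T\<rbrakk>
      \<Longrightarrow> wp c (\<lambda>N' T' k'. I (Suc j) (N'((v, 0, 0) := Suc j)) T' \<and> k' \<le> t) N T 0"
    and "\<And>N T k. \<lbrakk>I b N T; same (insert v (nmods c)) N0 N; same (tmods c) T0 T; k \<le> k0 + b * t\<rbrakk> \<Longrightarrow> Q N T k"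
  shows "wp (For v e c) Q N0 T0 k0"
  by (rule wp_For_sum[where f = "\<lambda>_. t" and I = I, OF assms(1-4)])
    (use assms(5) in \<open>simp_all add: mult.commute\<close>)

section \<open>Alternating search for an optimal assignment\<close>

definition feasible :: "nat \<Rightarrow> (nat \<Rightarrow> nat \<Rightarrow> ereal) \<Rightarrow> (nat \<Rightarrow> real) \<Rightarrow> (nat \<Rightarrow> real) \<Rightarrow> bool" where
  "feasible n B X W \<longleftrightarrow> (\<forall>i<n. \<forall>q<n. B i q \<le> ereal (X i + W q))"

definition tight :: "(nat \<Rightarrow> nat \<Rightarrow> ereal) \<Rightarrow> (nat \<Rightarrow> real) \<Rightarrow> (nat \<Rightarrow> real) \<Rightarrow> nat \<Rightarrow> nat \<Rightarrow> bool" where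
  "tight B X W i q \<longleftrightarrow> B i q = ereal (X i + W q)"

definition tight_matching ::
  "nat \<Rightarrow> (nat \<Rightarrow> nat \<Rightarrow> ereal) \<Rightarrow> (nat \<Rightarrow> real) \<Rightarrow> (nat \<Rightarrow> real) \<Rightarrow> nat \<Rightarrow> (nat \<Rightarrow> nat) \<Rightarrow> bool" where
  "tight_matching n B X W r \<sigma> \<longleftrightarrow>
     inj_on \<sigma> {..<r} \<and> \<sigma> ` {..<r} \<subseteq> {..<n} \<and> (\<forall>l<r. tight B X W l (\<sigma> l))"

text \<open>An alternating tree rooted at the unmatched row \<open>r\<close>: every other tree row
  is the partner of a tree column. The matching \<open>\<mu> i\<close> plays the role of
  \<open>\<sigma>\<close> flipped along the tree path from \<open>r\<close> to \<open>i\<close>,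
  which frees row \<open>i\<close> instead of row \<open>r\<close>.\<close>

definition search_tree ::
  "(nat \<Rightarrow> nat \<Rightarrow> ereal) \<Rightarrow> (nat \<Rightarrow> real) \<Rightarrow> (nat \<Rightarrow> real) \<Rightarrow> nat \<Rightarrow> (nat \<Rightarrow> nat) \<Rightarrow>
    nat set \<Rightarrow> nat set \<Rightarrow> (nat \<Rightarrow> nat \<Rightarrow> nat) \<Rightarrow> bool" where
  "search_tree B X W r \<sigma> S U \<mu> \<longleftrightarrow>
     r \<in> S \<and> S \<subseteq> {..r} \<and> U = \<sigma> ` (S - {r}) \<and>
     (\<forall>i\<in>S. inj_on (\<mu> i) ({..r} - {i}) \<and> (\<forall>l\<in>S - {i}. \<mu> i l \<in> U) \<and>
       (\<forall>l\<le>r. l \<notin> S \<longrightarrow> \<mu> i l = \<sigma> l) \<and> (\<forall>l\<le>r. l \<noteq> i \<longrightarrow> tight B X W l (\<mu> i l)))"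

text \<open>\<open>g q\<close> is the maximum over the rows of \<open>S\<close> of the reduced cost
  \<open>B i q - X i - W q\<close>. It is stated through sums so that entries
  \<open>-\<infinity>\<close> are never subtracted; for \<open>g q = -\<infinity>\<close> no
  attaining row is required.\<close>

definition slacks ::
  "nat \<Rightarrow> (nat \<Rightarrow> nat \<Rightarrow> ereal) \<Rightarrow> (nat \<Rightarrow> real) \<Rightarrow> (nat \<Rightarrow> real) \<Rightarrow>
    nat set \<Rightarrow> nat set \<Rightarrow> (nat \<Rightarrow> ereal) \<Rightarrow> (nat \<Rightarrow> nat) \<Rightarrow> bool" where
  "slacks n B X W S U g way \<longleftrightarrow> (\<forall>q<n. q \<notin> U \<longrightarrow>
     g q \<noteq> \<infinity> \<and> (\<forall>i\<in>S. B i q \<le> g q + ereal (X i + W q)) \<and>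
     (g q = -\<infinity> \<or> way q \<in> S \<and> g q + ereal (X (way q) + W q) = B (way q) q))"

lemma search_tree_init:
  assumes "tight_matching n B X W r \<sigma>" "\<And>l. l < r \<Longrightarrow> \<mu> r l = \<sigma> l"
  shows "search_tree B X W r \<sigma> {r} {} \<mu>"
proof -
  have "{..r} - {r} = {..<r}" by auto
  then have "inj_on (\<mu> r) ({..r} - {r})"
    using assms by (simp add: inj_on_def tight_matching_def)
  moreover have "tight B X W l (\<mu> r l)" if "l \<le> r" "l \<noteq> r" for l
    using assms that by (simp add: tight_matching_def)
  ultimately show ?thesis
    using assms(2) by (simp add: search_tree_def)
qed

context
  fixes n r :: nat and B :: "nat \<Rightarrow> nat \<Rightarrow> ereal" and X W :: "nat \<Rightarrow> real"
    and \<sigma> :: "nat \<Rightarrow> nat" and S U :: "nat set" and \<mu> :: "nat \<Rightarrow> nat \<Rightarrow> nat"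
    and g :: "nat \<Rightarrow> ereal" and way :: "nat \<Rightarrow> nat"
  assumes r: "r < n"
    and feas: "feasible n B X W"
    and match: "tight_matching n B X W r \<sigma>"
    and tree: "search_tree B X W r \<sigma> S U \<mu>"
begin

lemma tree_facts:
  "r \<in> S" "S \<subseteq> {..r}" "U = \<sigma> ` (S - {r})" "S - {r} \<subseteq> {..<r}"
proof -
  show *: "r \<in> S" "S \<subseteq> {..r}" "U = \<sigma> ` (S - {r})"
    using tree by (simp_all add: search_tree_def)
  from *(2) show "S - {r} \<subseteq> {..<r}" by force
qed

lemma branch_facts:
  assumes "i \<in> S"
  shows "inj_on (\<mu> i) ({..r} - {i})"
    "l \<in> S \<Longrightarrow> l \<noteq> i \<Longrightarrow> \<mu> i l \<in> U"
    "l \<le> r \<Longrightarrow> l \<notin> S \<Longrightarrow> \<mu> i l = \<sigma> l"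
    "l \<le> r \<Longrightarrow> l \<noteq> i \<Longrightarrow> tight B X W l (\<mu> i l)"
  using tree assms unfolding search_tree_def by blast+

lemma matching_facts: "inj_on \<sigma> {..<r}" "l < r \<Longrightarrow> \<sigma> l < n" "l < r \<Longrightarrow> tight B X W l (\<sigma> l)"
  using match by (auto simp: tight_matching_def)

text \<open>A matched pair has both ends inside the tree or both outside, so shifting the potentials
  of the tree keeps it tight.\<close>

lemma tree_column_iff: "l \<le> r \<Longrightarrow> l \<noteq> r \<Longrightarrow> \<sigma> l \<in> U \<longleftrightarrow> l \<in> S"
  using inj_on_image_mem_iff[of \<sigma> "{..<r}" l "S - {r}"] tree_facts matching_facts(1) by simp

text \<open>The root has no partner. The surplus row is what violates Hall's condition when no
  further column can be reached.\<close>

lemma card_tree_columns: "Suc (card U) = card S"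
proof -
  have "inj_on \<sigma> (S - {r})"
    using inj_on_subset[OF matching_facts(1) tree_facts(4)] .
  moreover have "card S = Suc (card (S - {r}))"
    using tree_facts(1,2) finite_subset by (blast intro: card.remove)
  ultimately show ?thesis
    using tree_facts(3) card_image by metis
qed

lemma tree_columns_subset: "U \<subseteq> {..<n}"
  using tree_facts(3,4) matching_facts(2) by blast

text \<open>Since \<open>\<delta> \<le> 0\<close>, tree rows go down and tree columns go up by the
  same amount. The sum \<open>X i + W q\<close> is constant when both ends are in the tree or both
  outside, does not decrease for a tree column with a non-tree row, and can decrease only for a tree
  row with a non-tree column; there \<open>g q \<le> \<delta>\<close> prevents a violation.\<close>

lemma shift_potentials:
  assumes slack: "slacks n B X W S U g way"
    and dl: "\<And>q. q < n \<Longrightarrow> q \<notin> U \<Longrightarrow> g q \<le> ereal \<delta>" and \<delta>: "\<delta> \<le> 0"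
    and X': "\<And>i. i < n \<Longrightarrow> X' i = (if i \<in> S then X i + \<delta> else X i)"
    and W': "\<And>q. q < n \<Longrightarrow> W' q = (if q \<in> U then W q - \<delta> else W q)"
    and g': "\<And>q. q < n \<Longrightarrow> q \<notin> U \<Longrightarrow> g' q = g q - ereal \<delta>"
  shows "feasible n B X' W'" "tight_matching n B X' W' r \<sigma>" "search_tree B X' W' r \<sigma> S U \<mu>"
    "slacks n B X' W' S U g' way"
proof -
  note S = tree_facts(2,1)
  show "feasible n B X' W'"
    unfolding feasible_def
  proof (intro allI impI)
    fix i q assume iq: "i < n" "q < n"
    have b: "B i q \<le> ereal (X i + W q)" using feas iq by (simp add: feasible_def)
    show "B i q \<le> ereal (X' i + W' q)"
    proof (cases "i \<in> S \<and> q \<notin> U")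
      case True
      then have "B i q \<le> g q + ereal (X i + W q)" "g q \<le> ereal \<delta>"
        using slack dl iq by (auto simp: slacks_def)
      then have "B i q \<le> ereal (\<delta> + (X i + W q))"
        by (metis add_right_mono order_trans plus_ereal.simps(1))
      then show ?thesis using True X' W' iq by (simp add: algebra_simps)
    next
      case False
      then have "X i + W q \<le> X' i + W' q" using X' W' iq \<delta> by auto
      with b show ?thesis by (meson ereal_less_eq(3) order_trans)
    qed
  qed
  have tight': "tight B X' W' l q" if "tight B X W l q" "l < n" "q < n" "l \<in> S \<longleftrightarrow> q \<in> U" for l q
    using that X' W' by (auto simp: tight_def)
  note \<sigma>n = matching_facts(2)
  have "tight B X' W' l (\<sigma> l)" if "l < r" for l
    using that r tree_column_iff[of l] matching_facts(2,3)[OF that] by (intro tight') auto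
  then show "tight_matching n B X' W' r \<sigma>"
    using match by (simp add: tight_matching_def)
  show "search_tree B X' W' r \<sigma> S U \<mu>"
    unfolding search_tree_def
  proof (intro conjI ballI allI impI)
    fix i l assume *: "i \<in> S" "l \<le> r" "l \<noteq> i"
    have "\<mu> i l < n \<and> (l \<in> S \<longleftrightarrow> \<mu> i l \<in> U)"
    proof (cases "l \<in> S")
      case True
      then have "\<mu> i l \<in> U" using * branch_facts(2) by blast
      then show ?thesis using tree_columns_subset True by auto
    next
      case False
      then have "\<mu> i l = \<sigma> l" "l < r" using * S branch_facts(3) by (auto simp: le_less)
      then show ?thesis using tree_column_iff[of l] \<sigma>n[of l] False by simp
    qed
    moreover have "tight B X W l (\<mu> i l)" using * branch_facts(4) by blast
    ultimately show "tight B X' W' l (\<mu> i l)" using * r by (intro tight') auto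
  qed (use tree_facts branch_facts in simp_all)
  show "slacks n B X' W' S U g' way"
    unfolding slacks_def
  proof (intro allI impI)
    fix q assume q: "q < n" "q \<notin> U"
    have gq: "g q \<noteq> \<infinity>" using slack q by (auto simp: slacks_def)
    have *: "g' q + ereal (X' i + W' q) = g q + ereal (X i + W q)" if "i \<in> S" for i
    proof -
      have "i < n" using that S r by auto
      then show ?thesis
        using that q X' W' g' gq by (cases "g q") auto
    qed
    have "g' q = -\<infinity> \<longleftrightarrow> g q = -\<infinity>" "g' q \<noteq> \<infinity>"
      using g' q gq by (cases "g q"; simp)+
    then show "g' q \<noteq> \<infinity> \<and> (\<forall>i\<in>S. B i q \<le> g' q + ereal (X' i + W' q)) \<and>
        (g' q = -\<infinity> \<or> way q \<in> S \<and> g' q + ereal (X' (way q) + W' q) = B (way q) q)"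
      using slack q * by (auto simp: slacks_def)
  qed
qed

text \<open>\<open>\<mu> i\<close> leaves only row \<open>i\<close> free and uses only columns
  already matched by \<open>\<sigma>\<close>, so a free column \<open>j\<close> can be given to row
  \<open>i\<close> without a collision.\<close>

lemma augment:
  assumes i: "i \<in> S" and j: "j < n" "j \<notin> \<sigma> ` {..<r}" and t: "tight B X W i j"
    and \<sigma>': "\<And>l. l \<le> r \<Longrightarrow> \<sigma>' l = (if l = i then j else \<mu> i l)"
  shows "tight_matching n B X W (Suc r) \<sigma>'"
proof -
  have *: "\<mu> i l \<in> \<sigma> ` {..<r}" if "l \<le> r" "l \<noteq> i" for l
  proof (cases "l \<in> S")
    case True
    then show ?thesis using branch_facts(2)[OF i] that tree_facts(3,4) by blast
  next
    case False
    then have "\<mu> i l = \<sigma> l" "l < r" using branch_facts(3)[OF i] that tree_facts(1) by (auto simp: le_less)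
    then show ?thesis by simp
  qed
  note inj = branch_facts(1)[OF i]
  have "inj_on \<sigma>' {..r}"
  proof (rule inj_onI)
    fix a b assume ab: "a \<in> {..r}" "b \<in> {..r}" "\<sigma>' a = \<sigma>' b"
    then show "a = b"
      using \<sigma>'[of a] \<sigma>'[of b] *[of a] *[of b] j(2) inj_onD[OF inj, of a b]
      by (auto split: if_splits)
  qed
  moreover have "\<sigma>' ` {..r} \<subseteq> {..<n}"
  proof safe
    fix l assume l: "l \<le> r"
    show "\<sigma>' l < n"
    proof (cases "l = i")
      case False
      then show ?thesis using \<sigma>'[OF l] *[OF l] matching_facts(2) by auto
    qed (use \<sigma>'[OF l] j in simp)
  qed
  moreover have "tight B X W l (\<sigma>' l)" if "l \<le> r" for l
    using \<sigma>'[OF that] t branch_facts(4)[OF i that] by simp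
  ultimately show ?thesis
    by (simp add: tight_matching_def lessThan_Suc_atMost less_Suc_eq_le)
qed

text \<open>Giving the column \<open>j\<close> of row \<open>k\<close> to row \<open>i\<close> in
  the matching \<open>\<mu> i\<close> frees row \<open>k\<close>, which yields the matching for
  \<open>k\<close>; the matchings of the old tree rows stay as they are. Row \<open>k\<close> is new
  because its column is not in the tree.\<close>

lemma grow:
  assumes i: "i \<in> S" and j: "j \<notin> U" and k: "k < r" "\<sigma> k = j" and t: "tight B X W i j"
    and \<mu>': "\<And>i' l. i' \<in> S \<Longrightarrow> l \<le> r \<Longrightarrow> \<mu>' i' l = \<mu> i' l"
    and \<mu>'k: "\<And>l. l \<le> r \<Longrightarrow> \<mu>' k l = (if l = i then j else \<mu> i l)"
  shows "search_tree B X W r \<sigma> (insert k S) (insert j U) \<mu>'" "k \<notin> S"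
proof -
  show kS: "k \<notin> S" using tree_column_iff[of k] k j by auto
  note S = tree_facts(2,1) and inj\<sigma> = matching_facts(1)
  note inj = branch_facts(1) and in_S = branch_facts(2) and notin_S = branch_facts(3) and ti = branch_facts(4)
  have ne_j: "\<mu> i l \<noteq> j" if "l \<le> r" "l \<noteq> i" "l \<noteq> k" for l
  proof (cases "l \<in> S")
    case True then show ?thesis using in_S[OF i True] that j by auto
  next
    case False
    then have "l < r" using S that by (metis le_neq_implies_less)
    then show ?thesis
      using notin_S[OF i, of l] False that k inj_onD[OF inj\<sigma>, of l k] by auto
  qed
  have inj_k: "inj_on (\<mu>' k) ({..r} - {k})"
  proof (rule inj_onI)
    fix a b assume ab: "a \<in> {..r} - {k}" "b \<in> {..r} - {k}" "\<mu>' k a = \<mu>' k b"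
    then show "a = b"
      using \<mu>'k[of a] \<mu>'k[of b] ne_j[of a] ne_j[of b] inj_onD[OF inj[OF i], of a b]
      by (auto split: if_splits)
  qed
  show "search_tree B X W r \<sigma> (insert k S) (insert j U) \<mu>'"
    unfolding search_tree_def
  proof (intro conjI ballI)
    show "insert j U = \<sigma> ` (insert k S - {r})"
      using tree_facts(3) k by auto
    fix i' assume i': "i' \<in> insert k S"
    show "inj_on (\<mu>' i') ({..r} - {i'})"
    proof (cases "i' = k")
      case False
      then have "i' \<in> S" using i' by simp
      then show ?thesis using inj[OF \<open>i' \<in> S\<close>] \<mu>' by (simp add: inj_on_def)
    qed (use inj_k in simp)
    fix l assume l: "l \<in> insert k S - {i'}"
    then have "l \<le> r" using S k by auto
    show "\<mu>' i' l \<in> insert j U"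
      using i' l \<open>l \<le> r\<close> kS k by (auto simp: \<mu>' \<mu>'k in_S notin_S i)
  next
    fix i' assume i': "i' \<in> insert k S"
    show "\<forall>l\<le>r. l \<notin> insert k S \<longrightarrow> \<mu>' i' l = \<sigma> l"
      using i' i kS by (auto simp: \<mu>' \<mu>'k notin_S)
    show "\<forall>l\<le>r. l \<noteq> i' \<longrightarrow> tight B X W l (\<mu>' i' l)"
      using i' i t kS by (auto simp: \<mu>' \<mu>'k ti)
  qed (use S k in auto)
qed

text \<open>Hall's condition fails: the rows in \<open>S\<close> have finite entries only in the columns \<open>U\<close>.\<close>

lemma no_finite_permutation:
  assumes slack: "slacks n B X W S U g way" and "\<And>q. q < n \<Longrightarrow> q \<notin> U \<Longrightarrow> g q = -\<infinity>"
    and p: "p permutes {..<n}"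
  shows "\<exists>i<n. B i (p i) = -\<infinity>"
proof (rule ccontr)
  assume *: "\<not> ?thesis"
  have S: "S \<subseteq> {..<n}" using tree_facts(2) r by auto
  have "p ` S \<subseteq> U"
  proof safe
    fix i assume i: "i \<in> S"
    have "p i < n" using permutes_in_image[OF p] i S by (auto simp: subset_iff)
    then show "p i \<in> U"
      using slack assms(2)[of "p i"] i * S by (force simp: slacks_def)
  qed
  moreover have "finite U" using tree_columns_subset finite_subset by blast
  ultimately have "card (p ` S) \<le> card U" by (simp add: card_mono)
  moreover have "card (p ` S) = card S"
    using p by (intro card_image) (metis permutes_inj inj_on_subset subset_UNIV)
  ultimately show False using card_tree_columns by simp
qed

end

section \<open>The Hungarian algorithm as a program\<close>

text \<open>
  The natural-number arrays \<open>s\<close> and \<open>mt\<close> store the current matching of the rows below \<open>r\<close> and, for every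
  tree row \<open>i\<close>, a matching of the rows up to \<open>r\<close> that leaves out exactly \<open>i\<close>; keeping all of these
  makes it unnecessary to follow an augmenting path back to its root. The arrays \<open>S\<close> and \<open>U\<close> flag
  the tree rows and tree columns. The tropical arrays \<open>x\<close> and \<open>w\<close> hold the potentials of rows and
  columns; \<open>g\<close> is the largest (nonpositive) reduced cost of a column over the tree rows, attained
  in row \<open>way\<close>.
\<close>

definition holds_reals :: "ereal store \<Rightarrow> string \<Rightarrow> nat \<Rightarrow> (nat \<Rightarrow> real) \<Rightarrow> bool" where
  "holds_reals T a n X \<longleftrightarrow> (\<forall>i<n. T (a, i, 0) = ereal (X i))"

text \<open>Each row potential starts as the maximum of 0 and the entries of its row; the 0 keeps it
  real when all of them are \<open>-\<infinity>\<close>.\<close>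

definition init_potentials :: com where
  "init_potentials =
    Seq (For ''i'' (vr ''n'') (Seq (TZero (ve ''x'' (vr ''i'')))
      (For ''q'' (vr ''n'') (Ite (TLe (ve ''x'' (vr ''i'')) (''B'', vr ''i'', vr ''q''))
        (TCopy (ve ''x'' (vr ''i'')) (''B'', vr ''i'', vr ''q'')) Skip))))
    (For ''q'' (vr ''n'') (TZero (ve ''w'' (vr ''q''))))"

text \<open>Only the newest tree row \<open>cur\<close> is compared, since \<open>g\<close> already
  accounts for the others. This keeps a search step linear.\<close>

definition relax :: com where
  "relax = For ''q'' (vr ''n'') (Ite (NEq (NGet (ve ''U'' (vr ''q''))) (NConst 0))
     (Seq (TSub (sc ''t'') (''B'', vr ''cur'', vr ''q'') (ve ''x'' (vr ''cur'')))
     (Seq (TSub (sc ''t'') (sc ''t'') (ve ''w'' (vr ''q'')))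
       (Ite (TLe (ve ''g'' (vr ''q'')) (sc ''t''))
         (Seq (TCopy (ve ''g'' (vr ''q'')) (sc ''t'')) (NSet (ve ''way'' (vr ''q'')) (vr ''cur'')))
         Skip)))
     Skip)"

text \<open>The comparison is not strict, so \<open>j\<close> is set even if all slacks are
  \<open>-\<infinity>\<close>.\<close>

definition choose_column :: com where
  "choose_column = Seq (TNegInf (sc ''dl''))
     (For ''q'' (vr ''n'') (Ite (NEq (NGet (ve ''U'' (vr ''q''))) (NConst 0))
       (Ite (TLe (sc ''dl'') (ve ''g'' (vr ''q'')))
         (Seq (TCopy (sc ''dl'') (ve ''g'' (vr ''q''))) (NSet (sc ''j'') (vr ''q'')))
         Skip)
       Skip))"

definition shift :: com where
  "shift = Seq (For ''i'' (vr ''n'') (Ite (NEq (NGet (ve ''S'' (vr ''i''))) (NConst 0)) Skip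
       (TAdd (ve ''x'' (vr ''i'')) (ve ''x'' (vr ''i'')) (sc ''dl''))))
     (For ''q'' (vr ''n'') (Ite (NEq (NGet (ve ''U'' (vr ''q''))) (NConst 0))
       (TSub (ve ''g'' (vr ''q'')) (ve ''g'' (vr ''q'')) (sc ''dl''))
       (TSub (ve ''w'' (vr ''q'')) (ve ''w'' (vr ''q'')) (sc ''dl''))))"

text \<open>The value \<open>n\<close> in \<open>k\<close> encodes that column \<open>j\<close> is
  still free.\<close>

definition find_owner :: com where
  "find_owner = Seq (NSet (sc ''v'') (NGet (ve ''way'' (vr ''j'')))) (Seq (NSet (sc ''k'') (vr ''n''))
     (For ''l'' (vr ''r'') (Ite (NEq (NGet (ve ''s'' (vr ''l''))) (vr ''j''))
       (NSet (sc ''k'') (vr ''l'')) Skip)))"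

definition augment_matching :: com where
  "augment_matching = Seq (For ''l'' (NPlus (vr ''r'') (NConst 1))
     (NSet (ve ''s'' (vr ''l'')) (NGet (''mt'', vr ''v'', vr ''l''))))
     (Seq (NSet (ve ''s'' (vr ''v'')) (vr ''j'')) (NSet (sc ''done'') (NConst 1)))"

definition grow_tree :: com where
  "grow_tree = Seq (For ''l'' (NPlus (vr ''r'') (NConst 1))
     (NSet (''mt'', vr ''k'', vr ''l'') (NGet (''mt'', vr ''v'', vr ''l''))))
     (Seq (NSet (''mt'', vr ''k'', vr ''v'') (vr ''j''))
     (Seq (NSet (ve ''S'' (vr ''k'')) (NConst 1))
     (Seq (NSet (ve ''U'' (vr ''j'')) (NConst 1)) (NSet (sc ''cur'') (vr ''k'')))))"

text \<open>After success or failure the remaining iterations of the loop are idle. The register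
  \<open>ninf\<close> exists because the language compares only stored tropical values with each
  other.\<close>

definition search_step :: com where
  "search_step = Ite (NEq (vr ''done'') (NConst 0))
     (Seq relax (Seq choose_column (Ite (TLe (sc ''dl'') (sc ''ninf''))
       (Seq (NSet (sc ''ok'') (NConst 0)) (NSet (sc ''done'') (NConst 1)))
       (Seq shift (Seq find_owner (Ite (NEq (vr ''k'') (vr ''n'')) augment_matching grow_tree))))))
     Skip"

definition init_search :: com where
  "init_search =
     Seq (For ''i'' (vr ''n'') (NSet (ve ''S'' (vr ''i'')) (NConst 0)))
     (Seq (NSet (ve ''S'' (vr ''r'')) (NConst 1))
     (Seq (For ''q'' (vr ''n'') (Seq (NSet (ve ''U'' (vr ''q'')) (NConst 0)) (TNegInf (ve ''g'' (vr ''q'')))))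
     (Seq (For ''l'' (vr ''r'') (NSet (''mt'', vr ''r'', vr ''l'') (NGet (ve ''s'' (vr ''l'')))))
     (Seq (NSet (sc ''done'') (NConst 0)) (NSet (sc ''cur'') (vr ''r''))))))"

definition hungarian :: com where
  "hungarian = Seq (TNegInf (sc ''ninf'')) (Seq (NSet (sc ''ok'') (NConst 1)) (Seq init_potentials
     (For ''r'' (vr ''n'') (Ite (NEq (vr ''ok'') (NConst 1))
       (Seq init_search (For ''it'' (vr ''n'') search_step)) Skip))))"

lemma mods_search [simp]:
  "nmods init_potentials = {''i'', ''q''}" "tmods init_potentials = {''x'', ''w''}"
  "nmods relax = {''q'', ''way''}" "tmods relax = {''t'', ''g''}"
  "nmods choose_column = {''q'', ''j''}" "tmods choose_column = {''dl''}"
  "nmods shift = {''i'', ''q''}" "tmods shift = {''x'', ''w'', ''g''}"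
  "nmods find_owner = {''l'', ''v'', ''k''}" "tmods find_owner = {}"
  "nmods augment_matching = {''l'', ''s'', ''done''}" "tmods augment_matching = {}"
  "nmods grow_tree = {''l'', ''mt'', ''S'', ''U'', ''cur''}" "tmods grow_tree = {}"
  "nmods init_search = {''i'', ''S'', ''q'', ''U'', ''l'', ''mt'', ''done'', ''cur''}" "tmods init_search = {''g''}"
  by (auto simp: init_potentials_def relax_def choose_column_def shift_def find_owner_def
      augment_matching_def grow_tree_def init_search_def)

section \<open>Specifications of the blocks of the search\<close>

lemma wp_relax:
  assumes "N (''n'', 0, 0) = n" "N (''cur'', 0, 0) = c" "T (''x'', c, 0) \<noteq> -\<infinity>"
    and "\<And>q. q < n \<Longrightarrow> T (''w'', q, 0) \<noteq> -\<infinity>"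
  defines "v \<equiv> \<lambda>q. T (''B'', c, q) - T (''x'', c, 0) - T (''w'', q, 0)"
  defines "P \<equiv> \<lambda>q. N (''U'', q, 0) = 0 \<and> T (''g'', q, 0) \<le> v q"
  shows "wp relax (\<lambda>N' T' k'.
    (\<forall>q. T' (''g'', q, 0) = (if q < n \<and> P q then v q else T (''g'', q, 0))) \<and>
    (\<forall>q. N' (''way'', q, 0) = (if q < n \<and> P q then c else N (''way'', q, 0))) \<and> k' \<le> 3 * n) N T 0"
  unfolding relax_def
proof (rule wp_For[where t = 3 and b = n and I = "\<lambda>j N' T'.
    (\<forall>q. T' (''g'', q, 0) = (if q < j \<and> P q then v q else T (''g'', q, 0))) \<and>
    (\<forall>q. N' (''way'', q, 0) = (if q < j \<and> P q then c else N (''way'', q, 0)))"], goal_cases)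
  case (4 j N' T')
  then show ?case
    using assms by (auto simp: sameD[OF 4(4)] sameD[OF 4(5)] P_def v_def less_Suc_eq)
qed (use assms in \<open>auto simp: sameD\<close>)

lemma wp_choose_column:
  assumes n: "N (''n'', 0, 0) = n" and q0: "q0 < n" "N (''U'', q0, 0) = 0"
  shows "wp choose_column (\<lambda>N' T' k'. N' (''j'', 0, 0) < n \<and> N (''U'', N' (''j'', 0, 0), 0) = 0 \<and>
    T' (''dl'', 0, 0) = T (''g'', N' (''j'', 0, 0), 0) \<and>
    (\<forall>q<n. N (''U'', q, 0) = 0 \<longrightarrow> T (''g'', q, 0) \<le> T' (''dl'', 0, 0)) \<and> k' \<le> n) N T 0"
  unfolding choose_column_def wp_Seq wp_simps
proof (rule wp_For[where t = 1 and b = n and I = "\<lambda>m N' T'.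
    (\<forall>q<m. N (''U'', q, 0) = 0 \<longrightarrow> T (''g'', q, 0) \<le> T' (''dl'', 0, 0)) \<and>
    (T' (''dl'', 0, 0) = -\<infinity> \<and> (\<forall>q<m. N (''U'', q, 0) \<noteq> 0) \<or>
     N' (''j'', 0, 0) < m \<and> N (''U'', N' (''j'', 0, 0), 0) = 0 \<and>
     T' (''dl'', 0, 0) = T (''g'', N' (''j'', 0, 0), 0))"], goal_cases)
  case (2 N')
  then show ?case using n by (simp add: sameD[OF 2])
next
  case (4 m N' T')
  note [simp] = sameD[OF 4(4)] sameD[OF 4(5)]
  show ?case
  proof (cases "N (''U'', m, 0) = 0 \<and> T' (''dl'', 0, 0) \<le> T (''g'', m, 0)")
    case True
    then have "\<forall>q<m. N (''U'', q, 0) = 0 \<longrightarrow> T (''g'', q, 0) \<le> T (''g'', m, 0)"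
      using 4(3) order_trans by blast
    then show ?thesis using True 4(2) by (simp add: less_Suc_eq)
  next
    case False
    then show ?thesis using 4(2,3) by (auto simp: less_Suc_eq)
  qed
next
  case (5 N' T' k')
  then show ?case using q0 by auto
qed simp_all

lemma wp_shift_potentials:
  assumes "N (''n'', 0, 0) = n" "T (''dl'', 0, 0) \<noteq> -\<infinity>"
  defines "\<delta> \<equiv> T (''dl'', 0, 0)"
  shows "wp shift (\<lambda>N' T' k'.
    (\<forall>i<n. T' (''x'', i, 0) = (if N (''S'', i, 0) = 0 then T (''x'', i, 0) else T (''x'', i, 0) + \<delta>)) \<and>
    (\<forall>q<n. T' (''w'', q, 0) = (if N (''U'', q, 0) = 0 then T (''w'', q, 0) else T (''w'', q, 0) - \<delta>)) \<and>
    (\<forall>q<n. T' (''g'', q, 0) = (if N (''U'', q, 0) = 0 then T (''g'', q, 0) - \<delta> else T (''g'', q, 0))) \<and>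
    k' \<le> 2 * n) N T 0"
  unfolding shift_def wp_Seq
proof (rule wp_For[where t = 1 and b = n and I = "\<lambda>m N' T'.
    (\<forall>i. T' (''x'', i, 0) = (if i < m \<and> N (''S'', i, 0) \<noteq> 0 then T (''x'', i, 0) + \<delta> else T (''x'', i, 0)))"], goal_cases)
  case (4 m N' T')
  then show ?case
    using assms by (auto simp: sameD[OF 4(4)] sameD[OF 4(5)] less_Suc_eq)
next
  case (5 N1 T1 k1)
  note [simp] = sameD[OF 5(2)] sameD[OF 5(3)]
  show ?case
  proof (rule wp_For[where t = 1 and b = n and I = "\<lambda>m N' T'.
    (\<forall>q. T' (''w'', q, 0) = (if q < m \<and> N (''U'', q, 0) \<noteq> 0 then T (''w'', q, 0) - \<delta> else T (''w'', q, 0))) \<and>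
    (\<forall>q. T' (''g'', q, 0) = (if q < m \<and> N (''U'', q, 0) = 0 then T (''g'', q, 0) - \<delta> else T (''g'', q, 0)))"], goal_cases)
    case (4 m N' T')
    then show ?case
      using assms 5 by (auto simp: sameD[OF 4(4)] sameD[OF 4(5)] less_Suc_eq)
  qed (use assms 5 in \<open>auto simp: sameD\<close>)
qed (use assms in \<open>auto simp: sameD\<close>)

lemma wp_find_owner:
  assumes "N (''n'', 0, 0) = n" "N (''r'', 0, 0) = r" "N (''j'', 0, 0) = j" "r < n"
  shows "wp find_owner (\<lambda>N' T' k'. N' (''v'', 0, 0) = N (''way'', j, 0) \<and>
    (if N' (''k'', 0, 0) = n then \<forall>l<r. N (''s'', l, 0) \<noteq> j
     else N' (''k'', 0, 0) < r \<and> N (''s'', N' (''k'', 0, 0), 0) = j) \<and> k' = 0) N T 0"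
  unfolding find_owner_def wp_Seq wp_simps
proof (rule wp_For[where t = 0 and b = r and I = "\<lambda>m N' T'. N' (''v'', 0, 0) = N (''way'', j, 0) \<and>
    (if N' (''k'', 0, 0) = n then \<forall>l<m. N (''s'', l, 0) \<noteq> j
     else N' (''k'', 0, 0) < m \<and> N (''s'', N' (''k'', 0, 0), 0) = j)"], goal_cases)
  case (4 m N' T')
  then show ?case
    using assms by (auto simp: sameD[OF 4(4)] sameD[OF 4(5)] less_Suc_eq split: if_splits)
qed (use assms in \<open>auto simp: sameD split: if_splits\<close>)

lemma wp_augment_matching:
  assumes "N (''r'', 0, 0) = r" "N (''v'', 0, 0) = i" "N (''j'', 0, 0) = j"
  shows "wp augment_matching (\<lambda>N' T' k'. N' (''done'', 0, 0) = 1 \<and>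
    (\<forall>l\<le>r. N' (''s'', l, 0) = (if l = i then j else N (''mt'', i, l))) \<and> k' = 0) N T 0"
  unfolding augment_matching_def wp_Seq
proof (rule wp_For[where t = 0 and b = "Suc r" and I = "\<lambda>m N' T'.
    \<forall>l<m. N' (''s'', l, 0) = N (''mt'', i, l)"], goal_cases)
  case (4 m N' T')
  then show ?case
    using assms by (auto simp: sameD[OF 4(4)] sameD[OF 4(5)] less_Suc_eq)
qed (use assms in \<open>auto simp: sameD\<close>)

lemma wp_grow_tree:
  assumes "N (''r'', 0, 0) = r" "N (''v'', 0, 0) = i" "N (''j'', 0, 0) = j" "N (''k'', 0, 0) = k" "k \<noteq> i"
  shows "wp grow_tree (\<lambda>N' T' k'. N' (''cur'', 0, 0) = k \<and>
    (\<forall>l\<le>r. N' (''mt'', k, l) = (if l = i then j else N (''mt'', i, l))) \<and>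
    (\<forall>i' l. i' \<noteq> k \<longrightarrow> N' (''mt'', i', l) = N (''mt'', i', l)) \<and>
    (\<forall>l. N' (''S'', l, 0) = (if l = k then 1 else N (''S'', l, 0))) \<and>
    (\<forall>l. N' (''U'', l, 0) = (if l = j then 1 else N (''U'', l, 0))) \<and> k' = 0) N T 0"
  unfolding grow_tree_def wp_Seq
proof (rule wp_For[where t = 0 and b = "Suc r" and I = "\<lambda>m N' T'.
    (\<forall>l<m. N' (''mt'', k, l) = N (''mt'', i, l)) \<and>
    (\<forall>i' l. i' \<noteq> k \<longrightarrow> N' (''mt'', i', l) = N (''mt'', i', l))"], goal_cases)
  case (4 m N' T')
  then show ?case
    using assms by (auto simp: sameD[OF 4(4)] sameD[OF 4(5)] less_Suc_eq)
qed (use assms in \<open>auto simp: sameD\<close>)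

lemma wp_init_search:
  assumes "N (''n'', 0, 0) = n" "N (''r'', 0, 0) = r" "r < n"
  shows "wp init_search (\<lambda>N' T' k'. N' (''cur'', 0, 0) = r \<and> N' (''done'', 0, 0) = 0 \<and>
    (\<forall>l<r. N' (''mt'', r, l) = N (''s'', l, 0)) \<and>
    (\<forall>l<n. N' (''S'', l, 0) = (if l = r then 1 else 0)) \<and>
    (\<forall>l<n. N' (''U'', l, 0) = 0) \<and> (\<forall>l<n. T' (''g'', l, 0) = -\<infinity>) \<and> k' = 0) N T 0"
  unfolding init_search_def wp_Seq
proof (rule wp_For[where t = 0 and b = n and I = "\<lambda>m N' T'. \<forall>l<m. N' (''S'', l, 0) = 0"], goal_cases)
  case (4 m N' T')
  then show ?case
    using assms by (auto simp: sameD[OF 4(4)] sameD[OF 4(5)] less_Suc_eq)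
next
  case (5 N1 T1 k1)
  note [simp] = sameD[OF 5(2)] sameD[OF 5(3)]
  show ?case
    unfolding wp_simps
  proof (rule wp_For[where t = 0 and b = n and I = "\<lambda>m N' T'.
      \<forall>l<m. N' (''U'', l, 0) = 0 \<and> T' (''g'', l, 0) = -\<infinity>"], goal_cases)
    case (4 m N' T')
    then show ?case by (auto simp: sameD[OF 4(4)] sameD[OF 4(5)] less_Suc_eq)
  next
    case (5 N2 T2 k2)
    note [simp] = sameD[OF 5(2)] sameD[OF 5(3)]
    show ?case
      by (rule wp_For[where t = 0 and b = r and I = "\<lambda>m N' T'.
          \<forall>l<m. N' (''mt'', r, l) = N (''s'', l, 0)"])
        (use assms 5 \<open>same _ N N1\<close> \<open>\<forall>l<n. N1 _ = 0\<close> \<open>k1 \<le> _\<close> in \<open>auto simp: sameD less_Suc_eq\<close>)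
  qed (use assms 5 in \<open>auto simp: sameD\<close>)
qed (use assms in \<open>auto simp: sameD\<close>)

text \<open>Row \<open>c\<close> has just joined the tree, so \<open>g\<close> is valid for
  \<open>S - {c}\<close> only; taking the maximum with the reduced cost of row \<open>c\<close>
  makes it valid for \<open>S\<close>.\<close>

lemma slacks_relax:
  assumes "slacks n B X W (S - {c}) U g way" "c \<in> S" "\<And>q. q < n \<Longrightarrow> B c q \<noteq> \<infinity>"
    and g': "\<And>q. q < n \<Longrightarrow> q \<notin> U \<Longrightarrow> g' q = (if g q \<le> B c q - ereal (X c) - ereal (W q)
      then B c q - ereal (X c) - ereal (W q) else g q)"
    and way': "\<And>q. q < n \<Longrightarrow> q \<notin> U \<Longrightarrow> way' q = (if g q \<le> B c q - ereal (X c) - ereal (W q)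
      then c else way q)"
  shows "slacks n B X W S U g' way'"
  unfolding slacks_def
proof (intro allI impI)
  fix q assume q: "q < n" "q \<notin> U"
  let ?v = "B c q - ereal (X c) - ereal (W q)"
  have v: "?v \<noteq> \<infinity>" "?v + ereal (X c + W q) = B c q"
    using assms(3)[OF q(1)] by (cases "B c q"; simp)+
  have old: "g q \<noteq> \<infinity>" "\<And>i. i \<in> S \<Longrightarrow> i \<noteq> c \<Longrightarrow> B i q \<le> g q + ereal (X i + W q)"
    "g q = -\<infinity> \<or> way q \<in> S \<and> g q + ereal (X (way q) + W q) = B (way q) q"
    using assms(1) q by (auto simp: slacks_def)
  have "g q \<le> g' q" "?v \<le> g' q" using g'[OF q] by auto
  moreover have "B i q \<le> h + ereal (X i + W q)" if "B i q \<le> f + ereal (X i + W q)" "f \<le> h" for i f h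
    using that add_right_mono order_trans by blast
  ultimately have "\<forall>i\<in>S. B i q \<le> g' q + ereal (X i + W q)"
    using old(2) v(2) by (metis order_refl)
  then show "g' q \<noteq> \<infinity> \<and> (\<forall>i\<in>S. B i q \<le> g' q + ereal (X i + W q)) \<and>
      (g' q = -\<infinity> \<or> way' q \<in> S \<and> g' q + ereal (X (way' q) + W q) = B (way' q) q)"
    using g'[OF q] way'[OF q] v old(1,3) assms(2) by simp
qed

definition flags :: "nat store \<Rightarrow> string \<Rightarrow> nat \<Rightarrow> nat set" where
  "flags N a n = {i. i < n \<and> N (a, i, 0) \<noteq> 0}"

definition no_finite_perm :: "nat \<Rightarrow> (nat \<Rightarrow> nat \<Rightarrow> ereal) \<Rightarrow> bool" where
  "no_finite_perm n B \<longleftrightarrow> (\<forall>p. p permutes {..<n} \<longrightarrow> (\<exists>i<n. B i (p i) = -\<infinity>))"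

text \<open>Three phases: failed, augmented, still searching. While searching, the slacks do not yet
  account for row \<open>cur\<close>, and the tree has \<open>Suc m\<close> rows after
  \<open>m\<close> steps, which forces the search to end within \<open>n\<close> steps.\<close>

definition search_inv :: "nat \<Rightarrow> (nat \<Rightarrow> nat \<Rightarrow> ereal) \<Rightarrow> nat \<Rightarrow> nat \<Rightarrow> nat store \<Rightarrow> ereal store \<Rightarrow> bool" where
  "search_inv n B r m N T \<longleftrightarrow> (\<exists>X W. holds_reals T ''x'' n X \<and> holds_reals T ''w'' n W \<and> feasible n B X W \<and>
    (if N (''ok'', 0, 0) \<noteq> 1 then N (''done'', 0, 0) \<noteq> 0 \<and> no_finite_perm n B
     else if N (''done'', 0, 0) \<noteq> 0 then tight_matching n B X W (Suc r) (\<lambda>l. N (''s'', l, 0))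
     else tight_matching n B X W r (\<lambda>l. N (''s'', l, 0)) \<and>
       search_tree B X W r (\<lambda>l. N (''s'', l, 0)) (flags N ''S'' n) (flags N ''U'' n) (\<lambda>i l. N (''mt'', i, l)) \<and>
       slacks n B X W (flags N ''S'' n - {N (''cur'', 0, 0)}) (flags N ''U'' n)
         (\<lambda>q. T (''g'', q, 0)) (\<lambda>q. N (''way'', q, 0)) \<and>
       N (''cur'', 0, 0) \<in> flags N ''S'' n \<and> card (flags N ''S'' n) = Suc m))"

text \<open>The bound adds \<open>3 * n\<close> for \<open>relax\<close>, \<open>n\<close> for
  \<open>choose_column\<close>, one comparison, and \<open>2 * n\<close> for \<open>shift\<close>;
  the single comparison is absorbed by another \<open>n\<close>.\<close>

lemma wp_search_step:
  assumes n: "N (''n'', 0, 0) = n" and Nr: "N (''r'', 0, 0) = r" and r: "r < n" and m: "m < n"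
    and ninf: "T (''ninf'', 0, 0) = -\<infinity>"
    and B: "\<And>i q. i < n \<Longrightarrow> q < n \<Longrightarrow> T (''B'', i, q) = B i q"
    and Binf: "\<And>i q. i < n \<Longrightarrow> q < n \<Longrightarrow> B i q \<noteq> \<infinity>"
    and inv: "search_inv n B r m N T"
  shows "wp search_step (\<lambda>N' T' k'. search_inv n B r (Suc m) N' T' \<and> k' \<le> 7 * n) N T 0"
proof (cases "N (''done'', 0, 0) = 0")
  case False
  then have "search_inv n B r (Suc m) N T" using inv unfolding search_inv_def by (simp cong: if_cong)
  with False show ?thesis by (simp add: search_step_def)
next
  case True
  obtain X W where XW: "holds_reals T ''x'' n X" "holds_reals T ''w'' n W" and feas: "feasible n B X W"
    and ok: "N (''ok'', 0, 0) = 1"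
    and match: "tight_matching n B X W r (\<lambda>l. N (''s'', l, 0))"
    and tree: "search_tree B X W r (\<lambda>l. N (''s'', l, 0)) (flags N ''S'' n) (flags N ''U'' n) (\<lambda>i l. N (''mt'', i, l))"
    and sl: "slacks n B X W (flags N ''S'' n - {N (''cur'', 0, 0)}) (flags N ''U'' n)
         (\<lambda>q. T (''g'', q, 0)) (\<lambda>q. N (''way'', q, 0))"
    and cur: "N (''cur'', 0, 0) \<in> flags N ''S'' n" and card: "card (flags N ''S'' n) = Suc m"
    using inv True unfolding search_inv_def by (auto split: if_splits)
  define c where "c = N (''cur'', 0, 0)"
  define S where "S = flags N ''S'' n"
  define U where "U = flags N ''U'' n"
  have c: "c < n" "c \<in> S" using cur by (auto simp: c_def S_def flags_def)
  have U: "q \<in> U \<longleftrightarrow> N (''U'', q, 0) \<noteq> 0" if "q < n" for q using that by (simp add: U_def flags_def)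
  have S: "i \<in> S \<longleftrightarrow> N (''S'', i, 0) \<noteq> 0" if "i < n" for i using that by (simp add: S_def flags_def)
  note tree = tree[folded S_def U_def] and card = card[folded S_def]
  note sl = sl[folded S_def U_def c_def]
  note st = r feas match tree
  have "card U = m" using card_tree_columns[OF st] card by simp
  moreover have "U \<subseteq> {..<n}" by (auto simp: U_def flags_def)
  \<comment> \<open>The tree has only \<open>m < n\<close> columns, so some column lies outside it
    and \<open>choose_column\<close> has a candidate.\<close>
  ultimately have "{..<n} - U \<noteq> {}" using m
    by (metis card_lessThan card_mono Diff_eq_empty_iff finite_subset finite_lessThan not_le)
  then obtain q0 where q0: "q0 < n" "N (''U'', q0, 0) = 0" using U by auto
  have x: "T (''x'', i, 0) = ereal (X i)" and w: "T (''w'', i, 0) = ereal (W i)" if "i < n" for i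
    using XW that by (auto simp: holds_reals_def)
  have final: "wp (Ite (TLe (sc ''dl'') (sc ''ninf''))
       (Seq (NSet (sc ''ok'') (NConst 0)) (NSet (sc ''done'') (NConst 1)))
       (Seq shift (Seq find_owner (Ite (NEq (vr ''k'') (vr ''n'')) augment_matching grow_tree))))
     (\<lambda>N' T' k'. search_inv n B r (Suc m) N' T' \<and> k' \<le> 7 * n) N2 T2 k"
    if sN: "same {''q'', ''way'', ''j''} N N2" and sT: "same {''t'', ''g'', ''dl''} T T2"
      and k: "k \<le> 4 * n"
      and slack: "slacks n B X W S U (\<lambda>q. T2 (''g'', q, 0)) (\<lambda>q. N2 (''way'', q, 0))"
      and j: "N2 (''j'', 0, 0) < n" "N2 (''j'', 0, 0) \<notin> U"
        "T2 (''dl'', 0, 0) = T2 (''g'', N2 (''j'', 0, 0), 0)"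
        "\<And>q. q < n \<Longrightarrow> q \<notin> U \<Longrightarrow> T2 (''g'', q, 0) \<le> T2 (''dl'', 0, 0)"
    for N2 T2 k
  proof (cases "T2 (''dl'', 0, 0) = -\<infinity>")
    case True
    have "no_finite_perm n B"
      unfolding no_finite_perm_def
      using no_finite_permutation[OF st slack] j(4) True by simp
    moreover have "holds_reals T2 ''x'' n X" "holds_reals T2 ''w'' n W"
      using XW by (simp_all add: holds_reals_def sameD[OF sT])
    ultimately show ?thesis
      using True feas k r by (auto simp: search_inv_def sameD[OF sT] ninf holds_reals_def)
  next
    case False
    define j where "j = N2 (''j'', 0, 0)"
    have j_n: "j < n" "j \<notin> U" using that by (auto simp: j_def)
    have "T2 (''dl'', 0, 0) \<noteq> \<infinity>"
      using slack j by (auto simp: slacks_def)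
    then obtain \<delta> where \<delta>: "T2 (''dl'', 0, 0) = ereal \<delta>"
      using False by (cases "T2 (''dl'', 0, 0)") auto
    define i where "i = N2 (''way'', j, 0)"
    have gj: "T2 (''g'', j, 0) = ereal \<delta>" using j(3) \<delta> by (simp add: j_def)
    then have i: "i \<in> S" "ereal \<delta> + ereal (X i + W j) = B i j"
      using slack j_n unfolding slacks_def i_def by force+
    have i_n: "i < n" using i by (simp add: S_def flags_def)
    \<comment> \<open>Feasibility at the attaining pair \<open>(i, j)\<close> bounds its reduced
      cost \<open>\<delta>\<close> by 0.\<close>
    have "ereal (\<delta> + (X i + W j)) \<le> ereal (X i + W j)"
      using feas i(2) i_n j_n unfolding feasible_def by simp
    then have \<delta>0: "\<delta> \<le> 0" by simp
    define X' where "X' = (\<lambda>i. if i \<in> S then X i + \<delta> else X i)"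
    define W' where "W' = (\<lambda>q. if q \<in> U then W q - \<delta> else W q)"
    define g' where "g' = (\<lambda>q. T2 (''g'', q, 0) - ereal \<delta>)"
    have sh: "feasible n B X' W'" "tight_matching n B X' W' r (\<lambda>l. N (''s'', l, 0))"
      "search_tree B X' W' r (\<lambda>l. N (''s'', l, 0)) S U (\<lambda>i l. N (''mt'', i, l))"
      "slacks n B X' W' S U g' (\<lambda>q. N2 (''way'', q, 0))"
      using shift_potentials[OF st slack _ \<delta>0, of X' W' g'] j(4) \<delta>
      by (simp_all add: X'_def W'_def g'_def)
    have ti: "tight B X' W' i j"
      using i j_n by (simp add: tight_def X'_def W'_def algebra_simps)
    note st' = r sh(1,2,3)
    have "wp shift (wp find_owner (wp (Ite (NEq (vr ''k'') (vr ''n'')) augment_matching grow_tree)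
      (\<lambda>N' T' k'. search_inv n B r (Suc m) N' T' \<and> k' \<le> 7 * n))) N2 T2 (k + 1)"
    proof (rule wp_use[OF wp_shift_potentials[of N2 n T2, OF _ False]], goal_cases)
      case (2 N3 T3 k3)
      note N2 [simp] = sameD[OF sN] and T2 [simp] = sameD[OF sT]
      note N3 [simp] = sameD[OF 2(2), simplified] and T3 [simp] = sameD[OF 2(3), simplified]
      have "holds_reals T3 ''x'' n X'" "holds_reals T3 ''w'' n W'"
        using 2(1) n x w S U \<delta> by (auto simp: holds_reals_def X'_def W'_def)
      note XW' = this
      have g3: "T3 (''g'', q, 0) = g' q" if "q < n" "q \<notin> U" for q
        using 2(1) that U n \<delta> by (simp add: g'_def)
      have slack3: "slacks n B X' W' S U (\<lambda>q. T3 (''g'', q, 0)) (\<lambda>q. N3 (''way'', q, 0))"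
        using sh(4) by (simp add: slacks_def g3)
      show ?case
      proof (rule wp_use[OF wp_find_owner[of _ n r j]], goal_cases)
        case (5 N4 T4 k4)
        note N4 [simp] = sameD[OF 5(2), simplified] and T4 [simp] = sameD[OF 5(3), simplified]
        have v: "N4 (''v'', 0, 0) = i" using 5(1) by (simp add: i_def)
        have XW4: "holds_reals T4 ''x'' n X'" "holds_reals T4 ''w'' n W'"
          using XW' by (simp_all add: holds_reals_def)
        have kk: "k + 1 + k3 + k4 \<le> 7 * n"
          using k 2(1) 5(1) r by simp
        show ?case
        proof (cases "N4 (''k'', 0, 0) = n")
          case True
          have "wp augment_matching (\<lambda>N' T' k'. search_inv n B r (Suc m) N' T' \<and> k' \<le> 7 * n) N4 T4 (k + 1 + k3 + k4)"
          proof (rule wp_use[OF wp_augment_matching[of _ r i j]], goal_cases)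
            case (4 N5 T5 k5)
            note N5 [simp] = sameD[OF 4(2), simplified] and T5 [simp] = sameD[OF 4(3), simplified]
            have "j \<notin> (\<lambda>l. N (''s'', l, 0)) ` {..<r}" using 5(1) True by auto
            then have "tight_matching n B X' W' (Suc r) (\<lambda>l. N5 (''s'', l, 0))"
              using augment[OF st' i(1) j_n(1) _ ti] 4(1) by simp
            moreover have "holds_reals T5 ''x'' n X'" "holds_reals T5 ''w'' n W'"
              using XW4 by (simp_all add: holds_reals_def)
            ultimately show ?case
              using sh(1) 4(1) kk ok unfolding search_inv_def by auto
          qed (use v Nr in \<open>simp_all add: j_def\<close>)
          then show ?thesis using True n by simp
        next
          case False
          define k0 where "k0 = N4 (''k'', 0, 0)"
          have k0: "k0 < r" "N (''s'', k0, 0) = j" using 5(1) False by (auto simp: k0_def)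
          have k0S: "k0 \<notin> S" using tree_column_iff[OF st', of k0] k0 j_n by simp
          have "wp grow_tree (\<lambda>N' T' k'. search_inv n B r (Suc m) N' T' \<and> k' \<le> 7 * n) N4 T4 (k + 1 + k3 + k4)"
          proof (rule wp_use[OF wp_grow_tree[of _ r i j k0]], goal_cases)
            case (6 N5 T5 k5)
            note N5 [simp] = sameD[OF 6(2), simplified] and T5 [simp] = sameD[OF 6(3), simplified]
            have fl: "flags N5 ''S'' n = insert k0 S" "flags N5 ''U'' n = insert j U"
              using 6(1) k0 r j_n by (auto simp: flags_def S_def U_def)
            have tr: "search_tree B X' W' r (\<lambda>l. N (''s'', l, 0)) (insert k0 S) (insert j U) (\<lambda>i l. N5 (''mt'', i, l))"
            proof (rule grow(1)[OF st' i(1) j_n(2) k0 ti])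
              fix i' l assume "i' \<in> S" "l \<le> r"
              then have "i' \<noteq> k0" using k0S by blast
              then show "N5 (''mt'', i', l) = N (''mt'', i', l)" using 6(1) by simp
            qed (use 6(1) in simp)
            have "finite S" by (simp add: S_def flags_def)
            then have "card (insert k0 S) = Suc (Suc m)" using k0S card by simp
            moreover have "slacks n B X' W' (insert k0 S - {k0}) (insert j U) (\<lambda>q. T5 (''g'', q, 0)) (\<lambda>q. N5 (''way'', q, 0))"
              using slack3 k0S by (simp add: slacks_def)
            moreover have "holds_reals T5 ''x'' n X'" "holds_reals T5 ''w'' n W'"
              using XW4 by (simp_all add: holds_reals_def)
            ultimately show ?case
              using sh(1,2) tr 6(1) kk ok True k0 unfolding search_inv_def by (auto simp: fl)
          qed (use v Nr k0S i k0_def in \<open>auto simp: j_def\<close>)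
          then show ?thesis using False n by simp
        qed
      qed (use n Nr r in \<open>simp_all add: j_def\<close>)
    qed (use n in \<open>simp add: sameD[OF sN]\<close>)
    then show ?thesis
      using False by (simp add: sameD[OF sT] ninf)
  qed
  have "wp relax (wp choose_column (wp (Ite (TLe (sc ''dl'') (sc ''ninf''))
       (Seq (NSet (sc ''ok'') (NConst 0)) (NSet (sc ''done'') (NConst 1)))
       (Seq shift (Seq find_owner (Ite (NEq (vr ''k'') (vr ''n'')) augment_matching grow_tree))))
     (\<lambda>N' T' k'. search_inv n B r (Suc m) N' T' \<and> k' \<le> 7 * n))) N T 0"
  proof (rule wp_use[OF wp_relax[of N n c T]], goal_cases)
    case (5 N1 T1 k1)
    note N1 [simp] = sameD[OF 5(2), simplified] and T1 [simp] = sameD[OF 5(3), simplified]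
    have slack: "slacks n B X W S U (\<lambda>q. T1 (''g'', q, 0)) (\<lambda>q. N1 (''way'', q, 0))"
      by (rule slacks_relax[OF sl c(2) Binf[OF c(1)]])
        (use 5(1) c B x w U in \<open>auto\<close>)
    show ?case
    proof (rule wp_use[OF wp_choose_column[of N1 n q0]], goal_cases)
      case (4 N2 T2 k2)
      note N2 [simp] = sameD[OF 4(2), simplified] and T2 [simp] = sameD[OF 4(3), simplified]
      show ?case
      proof (rule final)
        show "same {''q'', ''way'', ''j''} N N2"
          using 5(2) 4(2) by (auto simp: same_def)
        show "same {''t'', ''g'', ''dl''} T T2"
          using 5(3) 4(3) by (auto simp: same_def)
        show "slacks n B X W S U (\<lambda>q. T2 (''g'', q, 0)) (\<lambda>q. N2 (''way'', q, 0))"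
          using slack by simp
      qed (use 4(1) 5(1) U in auto)
    qed (use n q0 in simp_all)
  qed (use n x w c in \<open>simp_all add: c_def\<close>)
  then show ?thesis
    using True by (simp add: search_step_def)
qed

lemma wp_init_potentials:
  assumes n: "N (''n'', 0, 0) = n"
    and Binf: "\<And>i q. i < n \<Longrightarrow> q < n \<Longrightarrow> T (''B'', i, q) \<noteq> \<infinity>"
  shows "wp init_potentials (\<lambda>N' T' k'. (\<exists>X. holds_reals T' ''x'' n X \<and> feasible n (\<lambda>i q. T (''B'', i, q)) X (\<lambda>_. 0)) \<and>
    holds_reals T' ''w'' n (\<lambda>_. 0) \<and> k' \<le> n * n) N T 0"
  unfolding init_potentials_def wp_Seq
proof (rule wp_For[where t = n and b = n and I = "\<lambda>m N' T'. \<forall>i<m. \<exists>\<xi>. T' (''x'', i, 0) = ereal \<xi> \<and>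
    (\<forall>q<n. T (''B'', i, q) \<le> ereal \<xi>)"], goal_cases)
  case (4 m N1 T1)
  note [simp] = sameD[OF 4(4), simplified] sameD[OF 4(5), simplified]
  show ?case
    unfolding wp_Seq wp_simps
  proof (rule wp_For[where t = 1 and b = n and I = "\<lambda>p N' T'. (\<forall>i<m. T' (''x'', i, 0) = T1 (''x'', i, 0)) \<and>
      (\<exists>\<xi>. T' (''x'', m, 0) = ereal \<xi> \<and> (\<forall>q<p. T (''B'', m, q) \<le> ereal \<xi>))"], goal_cases)
    case (4 p N2 T2)
    note s [simp] = sameD[OF 4(4), simplified] sameD[OF 4(5), simplified]
    obtain \<xi> where \<xi>: "T2 (''x'', m, 0) = ereal \<xi>" "\<forall>q<p. T (''B'', m, q) \<le> ereal \<xi>"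
      using 4(3) by blast
    show ?case
    proof (cases "ereal \<xi> \<le> T (''B'', m, p)")
      case True
      then obtain \<beta> where \<beta>: "T (''B'', m, p) = ereal \<beta>"
        using Binf[OF \<open>m < n\<close> \<open>p < n\<close>] by (cases "T (''B'', m, p)") auto
      have "\<forall>q<Suc p. T (''B'', m, q) \<le> ereal \<beta>"
        using True \<xi>(2) unfolding \<beta> by (metis \<beta> less_Suc_eq order_refl order_trans)
      then show ?thesis
        using True \<xi>(1) \<beta> 4(2,3) \<open>N1 (''i'', 0, 0) = m\<close> by auto
    next
      case False
      then show ?thesis
        using \<xi> 4(2,3) \<open>N1 (''i'', 0, 0) = m\<close> by (auto simp: less_Suc_eq)
    qed
  next
    case 3
    then show ?case using \<open>N1 (''i'', 0, 0) = m\<close> by (auto simp: zero_ereal_def)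
  next
    case (5 N2 T2 k2)
    then show ?case using 4(3) by (auto simp: less_Suc_eq)
  qed (use n in \<open>auto simp: sameD\<close>)
next
  case (5 N1 T1 k1)
  note [simp] = sameD[OF 5(2), simplified] sameD[OF 5(3), simplified]
  define X where "X = (\<lambda>i. real_of_ereal (T1 (''x'', i, 0)))"
  have X: "holds_reals T1 ''x'' n X" "feasible n (\<lambda>i q. T (''B'', i, q)) X (\<lambda>_. 0)"
    using 5(1) by (force simp: holds_reals_def X_def feasible_def)+
  show ?case
  proof (rule wp_For[where t = 0 and b = n and I = "\<lambda>m N' T'. holds_reals T' ''w'' m (\<lambda>_. 0)"], goal_cases)
    case (4 m N' T')
    then show ?case by (auto simp: holds_reals_def zero_ereal_def less_Suc_eq)
  next
    case (5 N2 T2 k2)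
    have "holds_reals T2 ''x'' n X" using X(1) by (simp add: holds_reals_def sameD[OF 5(3)])
    then show ?case using X(2) 5 \<open>k1 \<le> _\<close> by auto
  qed (use n in \<open>auto simp: sameD holds_reals_def\<close>)
qed (use n in \<open>auto simp: sameD\<close>)

definition matching_inv :: "nat \<Rightarrow> (nat \<Rightarrow> nat \<Rightarrow> ereal) \<Rightarrow> nat \<Rightarrow> nat store \<Rightarrow> ereal store \<Rightarrow> bool" where
  "matching_inv n B r N T \<longleftrightarrow> (\<exists>X W. holds_reals T ''x'' n X \<and> holds_reals T ''w'' n W \<and> feasible n B X W \<and>
    (if N (''ok'', 0, 0) \<noteq> 1 then no_finite_perm n B
     else tight_matching n B X W r (\<lambda>l. N (''s'', l, 0))))"

lemma search_inv_upd [simp]: "search_inv n B r m (N((''it'', 0, 0) := y)) T = search_inv n B r m N T"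
  by (simp add: search_inv_def flags_def)

lemma matching_inv_upd [simp]: "matching_inv n B r (N((''r'', 0, 0) := y)) T = matching_inv n B r N T"
  by (simp add: matching_inv_def)

lemma mods_search_step [simp]:
  "nmods search_step = {''q'', ''way'', ''j'', ''ok'', ''done'', ''i'', ''l'', ''v'', ''k'', ''s'', ''mt'', ''S'', ''U'', ''cur''}"
  "tmods search_step = {''t'', ''g'', ''dl'', ''x'', ''w''}"
  by (auto simp: search_step_def)

lemma wp_search:
  assumes n: "N (''n'', 0, 0) = n" and Nr: "N (''r'', 0, 0) = r" and r: "r < n"
    and ok: "N (''ok'', 0, 0) = 1"
    and ninf: "T (''ninf'', 0, 0) = -\<infinity>"
    and B: "\<And>i q. i < n \<Longrightarrow> q < n \<Longrightarrow> T (''B'', i, q) = B i q"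
    and Binf: "\<And>i q. i < n \<Longrightarrow> q < n \<Longrightarrow> B i q \<noteq> \<infinity>"
    and inv: "matching_inv n B r N T"
  shows "wp (Seq init_search (For ''it'' (vr ''n'') search_step))
    (\<lambda>N' T' k'. matching_inv n B (Suc r) N' T' \<and> k' \<le> 7 * n * n) N T 0"
  unfolding wp_Seq
proof (rule wp_use[OF wp_init_search[OF n Nr r]], goal_cases)
  case (1 N1 T1 k1)
  note [simp] = sameD[OF 1(2), simplified] sameD[OF 1(3), simplified]
  obtain X W where XW: "holds_reals T ''x'' n X" "holds_reals T ''w'' n W" "feasible n B X W"
    and match: "tight_matching n B X W r (\<lambda>l. N (''s'', l, 0))"
    using inv ok unfolding matching_inv_def by auto
  have fl: "flags N1 ''S'' n = {r}" "flags N1 ''U'' n = {}"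
    using 1(1) r by (auto simp: flags_def split: if_splits)
  have tree: "search_tree B X W r (\<lambda>l. N (''s'', l, 0)) {r} {} (\<lambda>i l. N1 (''mt'', i, l))"
    using search_tree_init[OF match] 1(1) by simp
  have slack: "slacks n B X W ({r} - {r}) {} (\<lambda>q. T1 (''g'', q, 0)) (\<lambda>q. N1 (''way'', q, 0))"
    using 1(1) by (simp add: slacks_def)
  have init: "search_inv n B r 0 N1 T1"
    unfolding search_inv_def
    by (rule exI[of _ X], rule exI[of _ W]) (use XW match tree slack 1(1) ok in \<open>simp add: fl holds_reals_def\<close>)
  show ?case
  proof (rule wp_For[where t = "7 * n" and b = n and I = "\<lambda>m N' T'. search_inv n B r m N' T'"], goal_cases)
    case 3
    show ?case using init by simp
  next
    case (4 m N2 T2)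
    note [simp] = sameD[OF 4(4), simplified] sameD[OF 4(5), simplified]
    show ?case
      by (rule wp_mono[OF wp_search_step[of N2 n r m T2 B]])
        (use 4 n Nr r ninf B Binf in simp_all)
  next
    case (5 N2 T2 k2)
    \<comment> \<open>A search still open after \<open>n\<close> steps would have
      \<open>n + 1\<close> tree rows among only \<open>n\<close> rows.\<close>
    have "finite (flags N2 ''S'' n)" "flags N2 ''S'' n \<subseteq> {..<n}" by (auto simp: flags_def)
    then have "card (flags N2 ''S'' n) \<noteq> Suc n"
      by (metis card_lessThan card_mono finite_lessThan not_less_eq_eq order_refl)
    then have "matching_inv n B (Suc r) N2 T2"
      using 5(1) unfolding search_inv_def matching_inv_def by (auto split: if_splits)
    then show ?case using 5(4) 1(1) by (simp add: algebra_simps)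
  qed (use n in \<open>simp_all add: sameD\<close>)
qed

text \<open>Initialization takes \<open>n ^ 2\<close> comparisons, and each of \<open>n\<close>
  searches makes \<open>n\<close> steps of cost \<open>7 * n\<close>.\<close>

lemma wp_hungarian:
  assumes n: "N (''n'', 0, 0) = n"
    and Binf: "\<And>i q. i < n \<Longrightarrow> q < n \<Longrightarrow> T (''B'', i, q) \<noteq> \<infinity>"
  shows "wp hungarian (\<lambda>N' T' k'. matching_inv n (\<lambda>i q. T (''B'', i, q)) n N' T' \<and> k' \<le> 8 * n ^ 3) N T 0"
  unfolding hungarian_def wp_Seq wp_simps
proof (rule wp_use[OF wp_init_potentials[of _ n]], goal_cases)
  case (3 N1 T1 k1)
  note s1 [simp] = sameD[OF 3(2), simplified] sameD[OF 3(3), simplified]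
  show ?case
  proof (rule wp_For[where t = "7 * n * n" and b = n and I = "matching_inv n (\<lambda>i q. T (''B'', i, q))"], goal_cases)
    case 3
    obtain X where "holds_reals T1 ''x'' n X" "feasible n (\<lambda>i q. T (''B'', i, q)) X (\<lambda>_. 0)" "holds_reals T1 ''w'' n (\<lambda>_. 0)"
      using \<open>_ \<and> holds_reals T1 _ _ _ \<and> _\<close> by auto
    then show ?case
      unfolding matching_inv_def
      by (intro exI[of _ X] exI[of _ "\<lambda>_. 0"]) (auto simp: tight_matching_def)
  next
    case (4 r N2 T2)
    note s2 [simp] = sameD[OF 4(4), simplified] sameD[OF 4(5), simplified]
    show ?case
    proof (cases "N2 (''ok'', 0, 0) = 1")
      case True
      have "wp (Seq init_search (For ''it'' (vr ''n'') search_step))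
        (\<lambda>N' T' k'. matching_inv n (\<lambda>i q. T (''B'', i, q)) (Suc r) (N'((''r'', 0, 0) := Suc r)) T' \<and> k' \<le> 7 * n * n) N2 T2 0"
        by (rule wp_mono[OF wp_search[of N2 n r T2 "\<lambda>i q. T (''B'', i, q)"]])
          (use 4 True n Binf in simp_all)
      then show ?thesis using True by simp
    next
      case False
      then show ?thesis using 4(3) by (simp add: matching_inv_def cong: if_cong)
    qed
  next
    case (5 N2 T2 k2)
    have "n ^ 2 \<le> n ^ 3" by (cases n) (simp_all add: power_increasing)
    then have "n * n + n * (7 * n * n) \<le> 8 * n ^ 3"
      by (simp add: power2_eq_square power3_eq_cube)
    then show ?case using 5(1,4) 3(1) by simp
  qed (use n in \<open>simp_all add: sameD\<close>)
qed (use n Binf in simp_all)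

section \<open>Potentials and unique optimal permutations\<close>

definition potential :: "nat \<Rightarrow> (nat \<Rightarrow> nat \<Rightarrow> ereal) \<Rightarrow> (nat \<Rightarrow> nat) \<Rightarrow> (nat \<Rightarrow> real) \<Rightarrow> bool" where
  "potential n B \<sigma> X \<longleftrightarrow> (\<forall>i<n. \<bar>B i (\<sigma> i)\<bar> \<noteq> \<infinity>) \<and>
     (\<forall>i<n. \<forall>k<n. B k (\<sigma> i) + ereal (X i) \<le> B i (\<sigma> i) + ereal (X k))"

definition strict_edge :: "(nat \<Rightarrow> nat \<Rightarrow> ereal) \<Rightarrow> (nat \<Rightarrow> nat) \<Rightarrow> (nat \<Rightarrow> real) \<Rightarrow> nat \<Rightarrow> nat \<Rightarrow> bool" where
  "strict_edge B \<sigma> X i k \<longleftrightarrow> B k (\<sigma> i) + ereal (X i) < B i (\<sigma> i) + ereal (X k)"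

text \<open>Read a failing \<open>strict_edge\<close> from \<open>i\<close> to \<open>k\<close> as
  an arc. That every nonempty set of rows has a sink is acyclicity of this finite graph, in the form
  that repeated removal of sinks uses.\<close>

definition acyclic_potential :: "nat \<Rightarrow> (nat \<Rightarrow> nat \<Rightarrow> ereal) \<Rightarrow> (nat \<Rightarrow> nat) \<Rightarrow> (nat \<Rightarrow> real) \<Rightarrow> bool" where
  "acyclic_potential n B \<sigma> X \<longleftrightarrow>
     (\<forall>V\<subseteq>{..<n}. V \<noteq> {} \<longrightarrow> (\<exists>i\<in>V. \<forall>k\<in>V. k \<noteq> i \<longrightarrow> strict_edge B \<sigma> X i k))"

definition perm_weight :: "nat \<Rightarrow> (nat \<Rightarrow> nat \<Rightarrow> ereal) \<Rightarrow> (nat \<Rightarrow> nat) \<Rightarrow> ereal" where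
  "perm_weight n B p = (\<Sum>i<n. B i (p i))"

lemma sum_ereal_real:
  assumes "\<And>i. i \<in> I \<Longrightarrow> \<bar>f i\<bar> \<noteq> \<infinity>"
  shows "sum f I = ereal (\<Sum>i\<in>I. real_of_ereal (f i))"
  using assms by (simp add: sum_ereal[symmetric] ereal_real' del: sum_ereal)

lemma perm_weight_finite_iff:
  assumes "\<And>i q. i < n \<Longrightarrow> q < n \<Longrightarrow> B i q \<noteq> \<infinity>" "p permutes {..<n}"
  shows "perm_weight n B p \<noteq> -\<infinity> \<longleftrightarrow> (\<forall>i<n. \<bar>B i (p i)\<bar> \<noteq> \<infinity>)"
proof -
  have *: "B i (p i) \<noteq> \<infinity>" if "i < n" for i
    using assms that permutes_in_image[OF assms(2), of i] by simp
  show ?thesis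
  proof
    assume w: "perm_weight n B p \<noteq> -\<infinity>"
    show "\<forall>i<n. \<bar>B i (p i)\<bar> \<noteq> \<infinity>"
    proof (intro allI impI)
      fix i assume i: "i < n"
      have "perm_weight n B p = B i (p i) + (\<Sum>k\<in>{..<n} - {i}. B k (p k))"
        unfolding perm_weight_def using i by (subst sum.remove[of _ i]) auto
      moreover have "(\<Sum>k\<in>{..<n} - {i}. B k (p k)) \<noteq> \<infinity>"
        using * by (simp add: sum_Pinfty)
      ultimately show "\<bar>B i (p i)\<bar> \<noteq> \<infinity>"
        using w *[OF i] by (cases "B i (p i)"; cases "\<Sum>k\<in>{..<n} - {i}. B k (p k)") auto
    qed
  next
    assume "\<forall>i<n. \<bar>B i (p i)\<bar> \<noteq> \<infinity>"
    then show "perm_weight n B p \<noteq> -\<infinity>"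
      unfolding perm_weight_def by (subst sum_ereal_real) auto
  qed
qed

context
  fixes n :: nat and B :: "nat \<Rightarrow> nat \<Rightarrow> ereal" and \<sigma> :: "nat \<Rightarrow> nat" and X :: "nat \<Rightarrow> real"
  assumes Binf: "\<And>i q. i < n \<Longrightarrow> q < n \<Longrightarrow> B i q \<noteq> \<infinity>"
    and \<sigma>: "\<sigma> permutes {..<n}" and pot: "potential n B \<sigma> X"
begin

text \<open>
  The permutation \<open>\<tau>\<close> sends a row to the row to which \<open>p\<close> assigns its column. Summing the
  inequalities of the potential over the pairs \<open>(i, \<tau> i)\<close> compares the weights of \<open>p\<close> and \<open>\<sigma>\<close>.
\<close>

lemma weight_comparison:
  assumes p: "p permutes {..<n}" and fin: "\<forall>i<n. \<bar>B i (p i)\<bar> \<noteq> \<infinity>"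
  defines "\<tau> \<equiv> inv p \<circ> \<sigma>"
  defines "gap \<equiv> \<lambda>i. real_of_ereal (B i (\<sigma> i)) + X (\<tau> i) - real_of_ereal (B (\<tau> i) (\<sigma> i)) - X i"
  shows "\<tau> permutes {..<n}"
    "\<And>i. i < n \<Longrightarrow> 0 \<le> gap i" "\<And>i. i < n \<Longrightarrow> strict_edge B \<sigma> X i (\<tau> i) \<longleftrightarrow> 0 < gap i"
    "perm_weight n B \<sigma> = perm_weight n B p + ereal (\<Sum>i<n. gap i)"
proof -
  show \<tau>: "\<tau> permutes {..<n}"
    unfolding \<tau>_def using permutes_compose[OF \<sigma> permutes_inv[OF p]] .
  have p\<tau>: "p (\<tau> i) = \<sigma> i" for i
    by (simp add: \<tau>_def permutes_inverses[OF p])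
  have \<tau>n: "\<tau> i < n" if "i < n" for i using permutes_in_image[OF \<tau>, of i] that by simp
  have f: "\<bar>B (\<tau> i) (\<sigma> i)\<bar> \<noteq> \<infinity>" "\<bar>B i (\<sigma> i)\<bar> \<noteq> \<infinity>" if "i < n" for i
    using fin \<tau>n[OF that] p\<tau>[of i] pot that by (auto simp: potential_def)
  have ineq: "B (\<tau> i) (\<sigma> i) + ereal (X i) \<le> B i (\<sigma> i) + ereal (X (\<tau> i))" if "i < n" for i
    using pot that \<tau>n[OF that] by (simp add: potential_def)
  show "0 \<le> gap i" "strict_edge B \<sigma> X i (\<tau> i) \<longleftrightarrow> 0 < gap i" if "i < n" for i
    using f[OF that] ineq[OF that] unfolding gap_def strict_edge_def
    by (cases "B i (\<sigma> i)"; cases "B (\<tau> i) (\<sigma> i)"; auto)+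
  have "(\<Sum>i<n. gap i) = (\<Sum>i<n. real_of_ereal (B i (\<sigma> i))) - (\<Sum>i<n. real_of_ereal (B (\<tau> i) (\<sigma> i)))
     + ((\<Sum>i<n. X (\<tau> i)) - (\<Sum>i<n. X i))"
    by (simp add: gap_def sum.distrib sum_subtractf)
  also have "(\<Sum>i<n. X (\<tau> i)) = (\<Sum>i<n. X i)"
    using sum.permute[OF \<tau>, of X] by (simp add: comp_def)
  also have "(\<Sum>i<n. real_of_ereal (B (\<tau> i) (\<sigma> i))) = (\<Sum>i<n. real_of_ereal (B i (p i)))"
    using sum.permute[OF \<tau>, of "\<lambda>i. real_of_ereal (B i (p i))"] by (simp add: comp_def p\<tau>)
  finally have "(\<Sum>i<n. gap i) = (\<Sum>i<n. real_of_ereal (B i (\<sigma> i))) - (\<Sum>i<n. real_of_ereal (B i (p i)))"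
    by simp
  moreover have "perm_weight n B \<sigma> = ereal (\<Sum>i<n. real_of_ereal (B i (\<sigma> i)))"
    "perm_weight n B p = ereal (\<Sum>i<n. real_of_ereal (B i (p i)))"
    unfolding perm_weight_def by (rule sum_ereal_real, use fin f(2) in simp)+
  ultimately show "perm_weight n B \<sigma> = perm_weight n B p + ereal (\<Sum>i<n. gap i)"
    by simp
qed

text \<open>Weak duality: the weight of \<open>\<sigma>\<close> exceeds that of a finite
  \<open>p\<close> by a sum of nonnegative gaps.\<close>

lemma perm_weight_le:
  assumes p: "p permutes {..<n}"
  shows "perm_weight n B p \<le> perm_weight n B \<sigma>"
proof (cases "\<forall>i<n. \<bar>B i (p i)\<bar> \<noteq> \<infinity>")
  case True
  note c = weight_comparison[OF p True]
  have "0 \<le> (\<Sum>i<n. real_of_ereal (B i (\<sigma> i)) + X ((inv p \<circ> \<sigma>) i)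
      - real_of_ereal (B ((inv p \<circ> \<sigma>) i) (\<sigma> i)) - X i)"
    using c(2) by (intro sum_nonneg) auto
  then show ?thesis
    unfolding c(4) by (simp add: ereal_le_add_self)
next
  case False
  then have "perm_weight n B p = -\<infinity>" using perm_weight_finite_iff[of n B, OF Binf p] by metis
  then show ?thesis by simp
qed

text \<open>Equal weights make all gaps vanish, so the permutation that compares \<open>p\<close>
  with \<open>\<sigma>\<close> moves rows along tight arcs only. The rows that it moves cannot
  contain a sink, since the image of a moved row is moved too.\<close>

lemma unique_if_acyclic:
  assumes ac: "acyclic_potential n B \<sigma> X" and p: "p permutes {..<n}"
    and eq: "perm_weight n B p = perm_weight n B \<sigma>"
  shows "p = \<sigma>"
proof -
  have fin_\<sigma>: "\<forall>i<n. \<bar>B i (\<sigma> i)\<bar> \<noteq> \<infinity>" using pot by (simp add: potential_def)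
  then have fw: "perm_weight n B p \<noteq> -\<infinity>"
    using perm_weight_finite_iff[of n B, OF Binf \<sigma>] eq by simp
  then have fin: "\<forall>i<n. \<bar>B i (p i)\<bar> \<noteq> \<infinity>"
    using perm_weight_finite_iff[of n B, OF Binf p] by simp
  define \<tau> where "\<tau> = inv p \<circ> \<sigma>"
  note c = weight_comparison[OF p fin, folded \<tau>_def]
  let ?gap = "\<lambda>i. real_of_ereal (B i (\<sigma> i)) + X (\<tau> i) - real_of_ereal (B (\<tau> i) (\<sigma> i)) - X i"
  have fw': "\<bar>perm_weight n B p\<bar> \<noteq> \<infinity>"
    unfolding perm_weight_def by (subst sum_ereal_real) (use fin in auto)
  have zero: "g = 0" if "\<bar>w\<bar> \<noteq> \<infinity>" "w = w + ereal g" for w g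
    using that by (cases w) auto
  have "(\<Sum>i<n. ?gap i) = 0"
    by (rule zero[OF fw']) (use c(4) eq in simp)
  then have gap: "?gap i = 0" if "i < n" for i
    using c(2) that sum_nonneg_eq_0_iff[of "{..<n}" ?gap] by auto
  define V where "V = {i. i < n \<and> \<tau> i \<noteq> i}"
  have "V = {}"
  proof (rule ccontr)
    assume "V \<noteq> {}"
    moreover have "V \<subseteq> {..<n}" by (auto simp: V_def)
    ultimately have "\<exists>i\<in>V. \<forall>k\<in>V. k \<noteq> i \<longrightarrow> strict_edge B \<sigma> X i k"
      using ac[unfolded acyclic_potential_def, rule_format, of V] by metis
    then obtain i where i: "i \<in> V" "\<And>k. k \<in> V \<Longrightarrow> k \<noteq> i \<Longrightarrow> strict_edge B \<sigma> X i k"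
      by blast
    have i': "i < n" "\<tau> i \<noteq> i" using i(1) by (simp_all add: V_def)
    have "\<tau> i < n" using permutes_in_image[OF c(1), of i] i'(1) by simp
    moreover have "\<tau> (\<tau> i) \<noteq> \<tau> i"
      using i'(2) permutes_inj[OF c(1)] injD by metis
    ultimately have "\<tau> i \<in> V" by (simp add: V_def)
    then have "0 < ?gap i" using i(2) i' c(3) by blast
    then show False using gap[OF i'(1)] by simp
  qed
  then have "\<tau> i = i" for i
    using permutes_not_in[OF c(1), of i] by (cases "i < n") (simp_all add: V_def)
  then have "p i = \<sigma> i" for i
    using permutes_inverses(1)[OF p, of "\<sigma> i"] by (simp add: \<tau>_def)
  then show ?thesis by auto
qed

text \<open>Without a sink in \<open>V\<close>, following arcs gives a self-map \<open>f\<close> of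
  \<open>V\<close> without fixed points. Exchanging the columns of \<open>\<sigma>\<close> along
  cycles of \<open>f\<close> loses nothing and produces a second optimum.\<close>

lemma acyclic_if_unique:
  assumes unique: "\<And>p. p permutes {..<n} \<Longrightarrow> perm_weight n B p = perm_weight n B \<sigma> \<Longrightarrow> p = \<sigma>"
  shows "acyclic_potential n B \<sigma> X"
  unfolding acyclic_potential_def
proof (intro allI impI, rule ccontr)
  fix V assume V: "V \<subseteq> {..<n}" "V \<noteq> {}" and "\<not> (\<exists>i\<in>V. \<forall>k\<in>V. k \<noteq> i \<longrightarrow> strict_edge B \<sigma> X i k)"
  then obtain f where f: "\<And>i. i \<in> V \<Longrightarrow> f i \<in> V \<and> f i \<noteq> i \<and> \<not> strict_edge B \<sigma> X i (f i)"
    by metis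
  \<comment> \<open>A stable set of least cardinality is mapped onto itself and hence permuted by
    \<open>f\<close>; this replaces tracing a cycle explicitly.\<close>
  define stable where "stable W \<longleftrightarrow> W \<subseteq> V \<and> W \<noteq> {} \<and> f ` W \<subseteq> W" for W
  have "stable V" using V f by (auto simp: stable_def)
  from ex_has_least_nat[of stable V card, OF this]
  obtain W where "stable W \<and> (\<forall>W'. stable W' \<longrightarrow> card W \<le> card W')" ..
  then have W: "stable W" and min: "\<forall>W'. stable W' \<longrightarrow> card W \<le> card W'" by simp_all
  have W': "W \<subseteq> V" "W \<noteq> {}" "f ` W \<subseteq> W" using W by (simp_all add: stable_def)
  have Wn: "W \<subseteq> {..<n}" using W'(1) V(1) by (rule subset_trans)
  have finW: "finite W" using finite_subset[OF Wn] by simp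
  have "stable (f ` W)"
    unfolding stable_def
  proof (intro conjI)
    show "f ` W \<subseteq> V" using W'(3,1) by (rule subset_trans)
    show "f ` W \<noteq> {}" using W'(2) by simp
    show "f ` f ` W \<subseteq> f ` W" using W'(3) by (rule image_mono)
  qed
  then have "card W \<le> card (f ` W)" using min by simp
  then have fW: "f ` W = W" using card_seteq[OF finW W'(3)] by simp
  have injf: "inj_on f W" using fW finW by (simp add: finite_surj_inj)
  define \<tau> where "\<tau> i = (if i \<in> W then f i else i)" for i
  have "bij_betw \<tau> W W"
    using bij_betw_cong[of W \<tau> f W] fW injf by (simp add: bij_betw_def \<tau>_def)
  then have "\<tau> permutes W"
    by (rule bij_imp_permutes) (simp add: \<tau>_def)
  then have \<tau>: "\<tau> permutes {..<n}" using Wn permutes_subset by blast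
  define p where "p = \<sigma> \<circ> inv \<tau>"
  have p: "p permutes {..<n}"
    unfolding p_def using permutes_compose[OF permutes_inv[OF \<tau>] \<sigma>] .
  have p\<tau>: "p (\<tau> i) = \<sigma> i" for i by (simp add: p_def permutes_inverses[OF \<tau>])
  have \<tau>n: "\<tau> i < n" if "i < n" for i using permutes_in_image[OF \<tau>, of i] that by simp
  have eq: "B (\<tau> i) (\<sigma> i) + ereal (X i) = B i (\<sigma> i) + ereal (X (\<tau> i))" if "i < n" for i
  proof (cases "i \<in> W")
    case True
    then have "\<not> strict_edge B \<sigma> X i (\<tau> i)" using f[of i] W'(1) by (auto simp: \<tau>_def)
    then show ?thesis
      using pot that \<tau>n[OF that] unfolding strict_edge_def potential_def by (meson antisym not_le)
  qed (simp add: \<tau>_def)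
  have fin_\<sigma>: "\<bar>B i (\<sigma> i)\<bar> \<noteq> \<infinity>" if "i < n" for i using pot that by (simp add: potential_def)
  have fin_p': "\<bar>B (\<tau> i) (\<sigma> i)\<bar> \<noteq> \<infinity>" if "i < n" for i
    using eq[OF that] fin_\<sigma>[OF that] by (cases "B i (\<sigma> i)"; cases "B (\<tau> i) (\<sigma> i)") auto
  have fin_p: "\<forall>i<n. \<bar>B i (p i)\<bar> \<noteq> \<infinity>"
  proof (intro allI impI)
    fix i assume "i < n"
    then have "inv \<tau> i < n" using permutes_in_image[OF permutes_inv[OF \<tau>], of i] by simp
    then show "\<bar>B i (p i)\<bar> \<noteq> \<infinity>"
      using fin_p'[of "inv \<tau> i"] by (simp add: p_def permutes_inverses[OF \<tau>])
  qed
  have inv: "inv p \<circ> \<sigma> = \<tau>"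
  proof
    fix i
    show "(inv p \<circ> \<sigma>) i = \<tau> i"
      using p\<tau>[of i] permutes_inverses(2)[OF p, of "\<tau> i"] by simp
  qed
  have "perm_weight n B \<sigma> = perm_weight n B p"
  proof -
    have "(\<Sum>i<n. real_of_ereal (B i (\<sigma> i)) + X (\<tau> i) - real_of_ereal (B (\<tau> i) (\<sigma> i)) - X i) = 0"
    proof (intro sum.neutral ballI)
      fix i assume "i \<in> {..<n}"
      then have i: "i < n" by simp
      show "real_of_ereal (B i (\<sigma> i)) + X (\<tau> i) - real_of_ereal (B (\<tau> i) (\<sigma> i)) - X i = 0"
        using eq[OF i] fin_\<sigma>[OF i] fin_p'[OF i]
        by (cases "B i (\<sigma> i)"; cases "B (\<tau> i) (\<sigma> i)") auto
    qed
    then show ?thesis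
      using weight_comparison(4)[OF p fin_p] by (simp add: inv)
  qed
  then have "p = \<sigma>" using unique[OF p] by simp
  obtain i where "i \<in> W" using W'(2) by auto
  then have "\<tau> i \<noteq> i" using f[of i] W'(1) by (auto simp: \<tau>_def)
  moreover have "\<sigma> (\<tau> i) = \<sigma> i" using p\<tau>[of i] \<open>p = \<sigma>\<close> by simp
  ultimately show False using permutes_inj[OF \<sigma>] by (auto simp: inj_def)
qed

end

lemma acyclic_potentialD:
  assumes "acyclic_potential n B \<sigma> X" "V \<subseteq> {..<n}" "V \<noteq> {}"
  obtains i where "i \<in> V" "\<And>k. k \<in> V \<Longrightarrow> k \<noteq> i \<Longrightarrow> strict_edge B \<sigma> X i k"
  using assms unfolding acyclic_potential_def by meson

text \<open>A topological order with real values: a sink of \<open>V\<close> is placed above all the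
  rest. Moving along \<open>h\<close> makes every tight inequality between different rows strict,
  and injectivity later decides between several coordinates to which a vertex could be
  attached.\<close>

lemma heights_if_acyclic:
  assumes "acyclic_potential n B \<sigma> X"
  shows "\<exists>h. inj_on h {..<n} \<and>
    (\<forall>i<n. \<forall>k<n. i \<noteq> k \<longrightarrow> \<not> strict_edge B \<sigma> X i k \<longrightarrow> h i < (h k :: real))"
proof -
  have "\<exists>h. inj_on h V \<and> (\<forall>i\<in>V. \<forall>k\<in>V. i \<noteq> k \<longrightarrow> \<not> strict_edge B \<sigma> X i k \<longrightarrow> h i < (h k :: real))"
    if "V \<subseteq> {..<n}" for V
    using that
  proof (induction "card V" arbitrary: V)
    case 0
    then have "V = {}" using finite_subset[OF 0(2)] by simp
    then show ?case by simp
  next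
    case (Suc m)
    have fin: "finite V" using finite_subset[OF Suc.prems] by simp
    have "V \<noteq> {}" using Suc.hyps(2) by auto
    obtain i where i: "i \<in> V" "\<And>k. k \<in> V \<Longrightarrow> k \<noteq> i \<Longrightarrow> strict_edge B \<sigma> X i k"
      using acyclic_potentialD[OF assms Suc.prems \<open>V \<noteq> {}\<close>] by metis
    have "m = card (V - {i})" using Suc.hyps(2) i fin by simp
    moreover have "V - {i} \<subseteq> {..<n}" using Suc.prems by auto
    ultimately obtain h :: "nat \<Rightarrow> real" where h: "inj_on h (V - {i})"
      "\<forall>j\<in>V - {i}. \<forall>k\<in>V - {i}. j \<noteq> k \<longrightarrow> \<not> strict_edge B \<sigma> X j k \<longrightarrow> h j < h k"
      using Suc.hyps(1) by blast
    define b where "b = 1 + (\<Sum>k\<in>V. \<bar>h k\<bar>)"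
    have b: "h k < b" if "k \<in> V" for k
    proof -
      have "\<bar>h k\<bar> \<le> (\<Sum>k\<in>V. \<bar>h k\<bar>)" using that fin by (intro member_le_sum) auto
      then show ?thesis by (simp add: b_def)
    qed
    define h' where "h' = h(i := b)"
    have "inj_on h' V"
    proof (rule inj_onI)
      fix x y assume xy: "x \<in> V" "y \<in> V" "h' x = h' y"
      then show "x = y"
        using b[of x] b[of y] inj_onD[OF h(1), of x y] by (auto simp: h'_def split: if_splits)
    qed
    moreover have "\<forall>j\<in>V. \<forall>k\<in>V. j \<noteq> k \<longrightarrow> \<not> strict_edge B \<sigma> X j k \<longrightarrow> h' j < h' k"
      using h(2) i b by (auto simp: h'_def)
    ultimately show ?case by blast
  qed
  from this[of "{..<n}"] show ?thesis by (simp add: Ball_def)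
qed

text \<open>For small \<open>t > 0\<close> the comparison is lexicographic. The filter
  \<open>at_right 0\<close> lets finitely many such conditions hold at a common \<open>t\<close>
  without explicit bounds.\<close>

lemma eventually_affine_less:
  fixes a b u v :: real
  assumes "a < b \<or> a = b \<and> u < v"
  shows "\<forall>\<^sub>F t in at_right 0. a + t * u < b + t * v"
  using assms
proof
  assume "a < b"
  have "((\<lambda>t. b + t * v - (a + t * u)) \<longlongrightarrow> b + 0 * v - (a + 0 * u)) (at_right 0)"
    by (intro tendsto_intros)
  from order_tendstoD(1)[OF this, of 0] \<open>a < b\<close> show ?thesis by simp
next
  assume "a = b \<and> u < v"
  then show ?thesis
    by (auto simp: eventually_at_right_field intro: exI[of _ 1])
qed

lemma eventually_strict_edge:
  assumes "potential n B \<sigma> X" "i < n" "k < n" "B k (\<sigma> i) \<noteq> \<infinity>"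
    and "strict_edge B \<sigma> X i k \<or> h i < h k"
  shows "\<forall>\<^sub>F t in at_right 0. strict_edge B \<sigma> (\<lambda>l. X l + t * h l) i k"
proof -
  obtain \<beta> where \<beta>: "B i (\<sigma> i) = ereal \<beta>"
    using assms(1,2) by (cases "B i (\<sigma> i)") (auto simp: potential_def)
  have le: "B k (\<sigma> i) + ereal (X i) \<le> B i (\<sigma> i) + ereal (X k)"
    using assms(1-3) by (simp add: potential_def)
  show ?thesis
  proof (cases "B k (\<sigma> i)")
    case (real \<gamma>)
    have "\<forall>\<^sub>F t in at_right 0. (\<gamma> + X i) + t * h i < (\<beta> + X k) + t * h k"
      by (rule eventually_affine_less) (use assms(5) le real \<beta> in \<open>auto simp: strict_edge_def\<close>)
    then show ?thesis by (simp add: strict_edge_def real \<beta> add.assoc)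
  qed (use \<beta> assms(4) in \<open>auto simp: strict_edge_def\<close>)
qed

text \<open>
  Maximality forces a tight edge into every set containing row \<open>0\<close>: otherwise all potentials
  outside the set could be raised.
\<close>

lemma tight_edge_if_greatest:
  assumes Binf: "\<And>i q. i < n \<Longrightarrow> q < n \<Longrightarrow> B i q \<noteq> \<infinity>" and \<sigma>: "\<sigma> permutes {..<n}"
    and pot: "potential n B \<sigma> X"
    and greatest: "\<And>Y i. potential n B \<sigma> Y \<Longrightarrow> Y 0 = X 0 \<Longrightarrow> i < n \<Longrightarrow> Y i \<le> X i"
    and F: "0 \<in> F" "F \<subset> {..<n}"
  shows "\<exists>i<n. i \<notin> F \<and> (\<exists>k\<in>F. B k (\<sigma> i) + ereal (X i) = B i (\<sigma> i) + ereal (X k))"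
proof (rule ccontr)
  assume no: "\<not> ?thesis"
  define h where "h i = (if i \<in> F then 0 else 1 :: real)" for i
  have \<sigma>n: "\<sigma> i < n" if "i < n" for i using permutes_in_image[OF \<sigma>, of i] that by simp
  have "\<forall>\<^sub>F t in at_right 0. B k (\<sigma> i) + ereal (X i + t * h i) \<le> B i (\<sigma> i) + ereal (X k + t * h k)"
    if ik: "i < n" "k < n" for i k
  proof -
    have le: "B k (\<sigma> i) + ereal (X i) \<le> B i (\<sigma> i) + ereal (X k)"
      using pot ik by (simp add: potential_def)
    show ?thesis
    proof (cases "i \<notin> F \<and> k \<in> F")
      case True
      then have "strict_edge B \<sigma> X i k"
        using no le ik unfolding strict_edge_def by (metis le_less)
      then have "\<forall>\<^sub>F t in at_right 0. strict_edge B \<sigma> (\<lambda>l. X l + t * h l) i k"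
        using eventually_strict_edge[OF pot ik] Binf[OF ik(2) \<sigma>n[OF ik(1)]] by blast
      then show ?thesis
        by eventually_elim (simp add: strict_edge_def)
    next
      case False
      have "B k (\<sigma> i) + ereal (X i + t * h i) \<le> B i (\<sigma> i) + ereal (X k + t * h k)" if "t > 0" for t
        using False le that unfolding h_def
        by (cases "B k (\<sigma> i)"; cases "B i (\<sigma> i)") auto
      then show ?thesis
        using eventually_at_right_less[of "0::real"] by (auto elim: eventually_mono)
    qed
  qed
  then have "\<forall>\<^sub>F t in at_right 0. \<forall>i\<in>{..<n}. \<forall>k\<in>{..<n}.
      B k (\<sigma> i) + ereal (X i + t * h i) \<le> B i (\<sigma> i) + ereal (X k + t * h k)"
    by (intro eventually_ball_finite ballI) auto
  then have "\<forall>\<^sub>F t in at_right 0. (\<forall>i\<in>{..<n}. \<forall>k\<in>{..<n}.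
      B k (\<sigma> i) + ereal (X i + t * h i) \<le> B i (\<sigma> i) + ereal (X k + t * h k)) \<and> 0 < t"
    using eventually_at_right_less[of "0::real"] by (rule eventually_conj)
  then obtain t :: real where t: "t > 0" "\<forall>i\<in>{..<n}. \<forall>k\<in>{..<n}.
      B k (\<sigma> i) + ereal (X i + t * h i) \<le> B i (\<sigma> i) + ereal (X k + t * h k)"
    using eventually_happens'[OF trivial_limit_at_right_real] by blast
  obtain i where i: "i < n" "i \<notin> F" using F by blast
  have "potential n B \<sigma> (\<lambda>l. X l + t * h l)"
    using t(2) pot by (auto simp: potential_def)
  from greatest[OF this _ i(1)] show False using i t(1) F(1) by (simp add: h_def)
qed

text \<open>Nothing is known about \<open>s\<close> from index \<open>n\<close> on; the identity
  completes it to a permutation.\<close>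

lemma potential_if_tight_matching:
  assumes "feasible n B X W" "tight_matching n B X W n s"
  shows "(\<lambda>i. if i < n then s i else i) permutes {..<n} \<and> potential n B s X \<and>
    potential n B (\<lambda>i. if i < n then s i else i) X"
proof (intro conjI)
  have "inj_on s {..<n}" "s ` {..<n} \<subseteq> {..<n}"
    using assms(2) by (simp_all add: tight_matching_def)
  then have "bij_betw s {..<n} {..<n}"
    by (simp add: bij_betw_def endo_inj_surj)
  then have "bij_betw (\<lambda>i. if i < n then s i else i) {..<n} {..<n}"
    using bij_betw_cong[of "{..<n}" "\<lambda>i. if i < n then s i else i" s "{..<n}"] by simp
  then show "(\<lambda>i. if i < n then s i else i) permutes {..<n}"
    by (rule bij_imp_permutes) simp
  have "B k (s i) + ereal (X i) \<le> B i (s i) + ereal (X k)" "\<bar>B i (s i)\<bar> \<noteq> \<infinity>" if "i < n" "k < n" for i k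
  proof -
    have "s i < n" "B i (s i) = ereal (X i + W (s i))"
      using assms(2) that by (auto simp: tight_matching_def tight_def)
    moreover from this have "B k (s i) \<le> ereal (X k + W (s i))"
      using assms(1) that by (simp add: feasible_def)
    ultimately show "B k (s i) + ereal (X i) \<le> B i (s i) + ereal (X k)" "\<bar>B i (s i)\<bar> \<noteq> \<infinity>"
      by (cases "B k (s i)"; simp)+
  qed
  then show "potential n B s X" "potential n B (\<lambda>i. if i < n then s i else i) X"
    by (simp_all add: potential_def)
qed

text \<open>Strong duality for the assignment problem, obtained by running the verified program on a
  store containing \<open>B\<close>: total correctness supplies a final state with either tight
  potentials or the guarantee that every permutation meets an entry
  \<open>-\<infinity>\<close>.\<close>

lemma potential_exists:
  assumes "\<And>i q. i < n \<Longrightarrow> q < n \<Longrightarrow> B i q \<noteq> \<infinity>"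
  shows "no_finite_perm n B \<or> (\<exists>\<sigma> X. \<sigma> permutes {..<n} \<and> potential n B \<sigma> X)"
proof -
  define T :: "ereal store" where "T = (\<lambda>(a, i, q). B i q)"
  have "wp hungarian (\<lambda>N' T' k'. matching_inv n (\<lambda>i q. T (''B'', i, q)) n N' T' \<and> k' \<le> 8 * n ^ 3) (\<lambda>_. n) T 0"
    by (rule wp_hungarian) (use assms in \<open>auto simp: T_def\<close>)
  then obtain N' T' where "matching_inv n B n N' T'"
    unfolding wp_def by (auto simp: T_def)
  then consider "no_finite_perm n B" | X W s where "feasible n B X W" "tight_matching n B X W n s"
    unfolding matching_inv_def by (auto split: if_splits)
  then show ?thesis
  proof cases
    case 2
    show ?thesis using potential_if_tight_matching[OF 2] by blast
  qed simp
qed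

section \<open>Greatest potentials\<close>

definition greatest_potential :: "nat \<Rightarrow> (nat \<Rightarrow> nat \<Rightarrow> ereal) \<Rightarrow> (nat \<Rightarrow> nat) \<Rightarrow> (nat \<Rightarrow> real) \<Rightarrow> bool" where
  "greatest_potential n B \<sigma> X \<longleftrightarrow> potential n B \<sigma> X \<and> X 0 = 0 \<and>
     (\<forall>Y. potential n B \<sigma> Y \<and> Y 0 = 0 \<longrightarrow> (\<forall>i<n. Y i \<le> X i))"

lemma potentialD:
  "potential n B \<sigma> X \<Longrightarrow> i < n \<Longrightarrow> k < n \<Longrightarrow> B k (\<sigma> i) + ereal (X i) \<le> B i (\<sigma> i) + ereal (X k)"
  by (simp add: potential_def)

text \<open>The inequalities bound differences of coordinates, so solutions are closed under
  componentwise suprema. The zero row gives \<open>Y i \<le> B i (\<sigma> i)\<close> for every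
  normalized solution, hence the suprema are real.\<close>

lemma greatest_potential_exists:
  assumes n: "0 < n" and \<sigma>: "\<sigma> permutes {..<n}" and B0: "\<And>q. q < n \<Longrightarrow> B 0 q = 0"
    and pot: "potential n B \<sigma> Z"
  shows "\<exists>X. greatest_potential n B \<sigma> X"
proof -
  define A where "A = {Y. potential n B \<sigma> Y \<and> Y 0 = 0}"
  define X where "X i = (SUP Y\<in>A. Y i)" for i
  have \<sigma>n: "\<sigma> i < n" if "i < n" for i using permutes_in_image[OF \<sigma>, of i] that by simp
  define b where "b i = real_of_ereal (B i (\<sigma> i))" for i
  have b: "B i (\<sigma> i) = ereal (b i)" if "i < n" for i
    using pot that by (simp add: potential_def b_def ereal_real')
  have ub: "Y i \<le> b i" if "Y \<in> A" "i < n" for Y i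
  proof -
    have "B 0 (\<sigma> i) + ereal (Y i) \<le> B i (\<sigma> i) + ereal (Y 0)"
      using that n potentialD[of n B \<sigma> Y i 0] by (simp add: A_def)
    then show ?thesis using b[OF that(2)] B0[OF \<sigma>n[OF that(2)]] that(1) by (simp add: A_def)
  qed
  have bdd: "bdd_above ((\<lambda>Y. Y i) ` A)" if "i < n" for i
    using ub[OF _ that] by (auto intro!: bdd_aboveI[of _ "b i"])
  \<comment> \<open>Adding a constant to all coordinates preserves the inequalities, so
    \<open>Z\<close> can be normalized.\<close>
  have "(\<lambda>i. Z i - Z 0) \<in> A"
  proof -
    have "B k (\<sigma> i) + ereal (Z i - Z 0) \<le> B i (\<sigma> i) + ereal (Z k - Z 0)" if "i < n" "k < n" for i k
    proof -
      have "B k (\<sigma> i) + ereal (Z i) \<le> B i (\<sigma> i) + ereal (Z k)"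
        using pot that by (simp add: potential_def)
      then show ?thesis using b[OF that(1)] by (cases "B k (\<sigma> i)") auto
    qed
    then show ?thesis using pot by (simp add: A_def potential_def)
  qed
  then have ne: "A \<noteq> {}" by blast
  have le: "Y i \<le> X i" if "Y \<in> A" "i < n" for Y i
    unfolding X_def using that bdd by (intro cSUP_upper) auto
  have "B k (\<sigma> i) + ereal (X i) \<le> B i (\<sigma> i) + ereal (X k)" if ik: "i < n" "k < n" for i k
  proof (cases "B k (\<sigma> i)")
    case (real c)
    have "Y i \<le> b i + X k - c" if "Y \<in> A" for Y
    proof -
      have "B k (\<sigma> i) + ereal (Y i) \<le> B i (\<sigma> i) + ereal (Y k)"
        using that ik by (simp add: A_def potential_def)
      then show ?thesis using le[OF that ik(2)] b[OF ik(1)] real by simp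
    qed
    then have "X i \<le> b i + X k - c"
      unfolding X_def[of i] by (rule cSUP_least[OF ne])
    then show ?thesis using b[OF ik(1)] real by simp
  next
    case PInf
    have "B k (\<sigma> i) + ereal (Z i) \<le> B i (\<sigma> i) + ereal (Z k)"
      using pot ik by (simp add: potential_def)
    then show ?thesis using PInf b[OF ik(1)] by simp
  qed simp
  moreover have "X 0 = 0"
    unfolding X_def using ne by (simp add: A_def)
  ultimately have "greatest_potential n B \<sigma> X"
    using le b unfolding greatest_potential_def potential_def A_def by simp
  then show ?thesis by blast
qed

text \<open>Unlike in \<open>nonsingular\<close>, the optimum has to be finite;
  \<open>nonsingular_iff\<close> shows that both notions agree for the matrices of
  simplices.\<close>

definition unique_optimum :: "nat \<Rightarrow> (nat \<Rightarrow> nat \<Rightarrow> ereal) \<Rightarrow> bool" where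
  "unique_optimum n B \<longleftrightarrow> (\<exists>p. p permutes {..<n} \<and> perm_weight n B p \<noteq> -\<infinity> \<and>
     (\<forall>q. q permutes {..<n} \<longrightarrow> perm_weight n B p \<le> perm_weight n B q \<longrightarrow> q = p))"

text \<open>Acyclicity does not depend on the chosen matching and potential, so the program may test
  it at the greatest potential.\<close>

lemma unique_optimum_iff:
  assumes Binf: "\<And>i q. i < n \<Longrightarrow> q < n \<Longrightarrow> B i q \<noteq> \<infinity>"
    and \<sigma>: "\<sigma> permutes {..<n}" and pot: "potential n B \<sigma> X"
  shows "unique_optimum n B \<longleftrightarrow> acyclic_potential n B \<sigma> X"
proof
  assume "unique_optimum n B"
  then obtain p where p: "p permutes {..<n}"
    "\<And>q. q permutes {..<n} \<Longrightarrow> perm_weight n B p \<le> perm_weight n B q \<Longrightarrow> q = p"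
    unfolding unique_optimum_def by auto
  have "p = \<sigma>" using p(2)[OF \<sigma> perm_weight_le[of n B, OF Binf \<sigma> pot p(1)]] by simp
  then show "acyclic_potential n B \<sigma> X"
    using p(2) by (intro acyclic_if_unique[of n B, OF Binf \<sigma> pot]) simp_all
next
  assume ac: "acyclic_potential n B \<sigma> X"
  have "q = \<sigma>" if "q permutes {..<n}" "perm_weight n B \<sigma> \<le> perm_weight n B q" for q
    using unique_if_acyclic[of n B, OF Binf \<sigma> pot ac that(1)]
      perm_weight_le[of n B, OF Binf \<sigma> pot that(1)] that(2) by simp
  moreover have "perm_weight n B \<sigma> \<noteq> -\<infinity>"
    using perm_weight_finite_iff[of n B, OF Binf \<sigma>] pot by (simp add: potential_def)
  ultimately show "unique_optimum n B"
    using \<sigma> unfolding unique_optimum_def by blast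
qed

text \<open>The start value \<open>B i (\<sigma> i)\<close> is the bound imposed by row 0 and thus
  lies above every normalized potential. The subtraction is legal because an inequality with
  \<open>B k (\<sigma> i) = -\<infinity>\<close> is never violated.\<close>

definition bellman_ford :: com where
  "bellman_ford = Seq (For ''i'' (vr ''n'') (TCopy (ve ''z'' (vr ''i'')) (''B'', vr ''i'', NGet (ve ''s'' (vr ''i'')))))
    (For ''t'' (vr ''n'') (For ''i'' (vr ''n'') (For ''k'' (vr ''n'')
      (Seq (TAdd (sc ''t1'') (''B'', vr ''k'', NGet (ve ''s'' (vr ''i''))) (ve ''z'' (vr ''i'')))
      (Seq (TAdd (sc ''t2'') (''B'', vr ''i'', NGet (ve ''s'' (vr ''i''))) (ve ''z'' (vr ''k'')))
      (Ite (TLe (sc ''t1'') (sc ''t2'')) Skip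
        (TSub (ve ''z'' (vr ''i'')) (sc ''t2'') (''B'', vr ''k'', NGet (ve ''s'' (vr ''i''))))))))))"

text \<open>No shortest paths are traced. The values never drop below the greatest potential, and as
  long as some row is not correct, \<open>tight_edge_if_greatest\<close> yields a tight inequality
  from an incorrect row to a correct one, which makes the former correct within one round. Row 0 is
  correct from the start, so \<open>n\<close> rounds suffice; each inequality costs at most four
  operations.\<close>

lemma wp_bellman_ford:
  assumes n: "N (''n'', 0, 0) = n" "0 < n"
    and B: "\<And>i q. i < n \<Longrightarrow> q < n \<Longrightarrow> T (''B'', i, q) = B i q"
    and Binf: "\<And>i q. i < n \<Longrightarrow> q < n \<Longrightarrow> B i q \<noteq> \<infinity>" and B0: "\<And>q. q < n \<Longrightarrow> B 0 q = 0"
    and s: "\<And>i. i < n \<Longrightarrow> N (''s'', i, 0) = \<sigma> i" and \<sigma>: "\<sigma> permutes {..<n}"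
    and X: "greatest_potential n B \<sigma> X"
  shows "wp bellman_ford (\<lambda>N' T' k'. holds_reals T' ''z'' n X \<and> k' \<le> 4 * n ^ 3) N T 0"
proof -
  have \<sigma>n: "\<sigma> i < n" if "i < n" for i using permutes_in_image[OF \<sigma>, of i] that by simp
  have pot: "potential n B \<sigma> X" and X0: "X 0 = 0"
    and gr: "\<And>Y i. potential n B \<sigma> Y \<Longrightarrow> Y 0 = X 0 \<Longrightarrow> i < n \<Longrightarrow> Y i \<le> X i"
    using X by (auto simp: greatest_potential_def)
  define b where "b i = real_of_ereal (B i (\<sigma> i))" for i
  have b: "B i (\<sigma> i) = ereal (b i)" if "i < n" for i
    using pot that by (simp add: potential_def b_def ereal_real')
  have Xle: "B k (\<sigma> i) + ereal (X i) \<le> ereal (b i + X k)" if "i < n" "k < n" for i k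
    using pot that b[OF that(1)] by (force simp: potential_def)
  define ok where "ok F i Z \<longleftrightarrow> (\<forall>k\<in>F. B k (\<sigma> i) + ereal Z \<le> ereal (b i + X k))" for F i and Z :: real
  define correct where "correct Z = {i. i < n \<and> Z i = X i}" for Z :: "nat \<Rightarrow> real"
  show ?thesis
    unfolding bellman_ford_def wp_Seq
  proof (rule wp_For[where t = 0 and b = n and I = "\<lambda>m N' T'. holds_reals T' ''z'' m b"], goal_cases)
    case (4 m N1 T1)
    note [simp] = sameD[OF 4(4), simplified] sameD[OF 4(5), simplified]
    show ?case using 4(1-3) B b s \<sigma>n by (auto simp: holds_reals_def less_Suc_eq)
  next
    case (5 N1 T1 k1)
    note [simp] = sameD[OF 5(2), simplified] sameD[OF 5(3), simplified]
    show ?case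
    proof (rule wp_For[where t = "4 * n * n" and b = n and I = "\<lambda>m N' T'. \<exists>Z. holds_reals T' ''z'' n Z \<and>
        (\<forall>i<n. X i \<le> Z i) \<and> Z 0 = 0 \<and> (correct Z = {..<n} \<or> m < card (correct Z))"], goal_cases)
      case 3
      have "X i \<le> b i" if "i < n" for i using Xle[OF that n(2)] B0[OF \<sigma>n[OF that]] X0 by simp
      moreover have "b 0 = 0" using b[OF n(2)] B0[OF \<sigma>n[OF n(2)]] by simp
      moreover have "0 < card (correct b)"
        using \<open>b 0 = 0\<close> n X0 by (auto simp: card_gt_0_iff correct_def)
      ultimately show ?case using 5(1) by auto
    next
      case (4 m N2 T2)
      note [simp] = sameD[OF 4(4), simplified] sameD[OF 4(5), simplified]
      from 4(3) obtain Z0 where Z0: "holds_reals T2 ''z'' n Z0" "\<And>i. i < n \<Longrightarrow> X i \<le> Z0 i" "Z0 0 = 0"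
        "correct Z0 = {..<n} \<or> m < card (correct Z0)" by blast
      \<comment> \<open>The rows that are correct at the beginning of the round; they stay correct,
        since values only decrease and never fall below \<open>X\<close>.\<close>
      define F where "F = correct Z0"
      have F: "F \<subseteq> {..<n}" "0 \<in> F" using n X0 Z0 by (auto simp: F_def correct_def)
      show ?case
      proof (rule wp_For[where t = "4 * n" and b = n and I = "\<lambda>i N' T'. \<exists>Z. holds_reals T' ''z'' n Z \<and>
          (\<forall>l<n. X l \<le> Z l \<and> Z l \<le> Z0 l) \<and> (\<forall>l<i. ok F l (Z l))"], goal_cases)
        case 3
        show ?case using Z0 by auto
      next
        case (4 i N3 T3)
        note [simp] = sameD[OF 4(4), simplified] sameD[OF 4(5), simplified]
        note i = 4(1,2)
        show ?case
        proof (rule wp_For[where t = 4 and b = n and I = "\<lambda>k N' T'. \<exists>Z. holds_reals T' ''z'' n Z \<and>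
            (\<forall>l<n. X l \<le> Z l \<and> Z l \<le> Z0 l) \<and> (\<forall>l<i. ok F l (Z l)) \<and> ok (F \<inter> {..<k}) i (Z i)"], goal_cases)
          case 3
          show ?case using 4(3) by (auto simp: ok_def)
        next
          case (4 k N4 T4)
          note s4 [simp] = sameD[OF 4(4), simplified] sameD[OF 4(5), simplified]
          from 4(3) obtain Z where Z: "holds_reals T4 ''z'' n Z" "\<And>l. l < n \<Longrightarrow> X l \<le> Z l \<and> Z l \<le> Z0 l"
            "\<And>l. l < i \<Longrightarrow> ok F l (Z l)" "ok (F \<inter> {..<k}) i (Z i)" by blast
          have z: "T4 (''z'', l, 0) = ereal (Z l)" if "l < n" for l
            using Z(1) that by (simp add: holds_reals_def)
          have ev: "T (''B'', k, N (''s'', i, 0)) = B k (\<sigma> i)" "T (''B'', i, N (''s'', i, 0)) = ereal (b i)"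
            using B s i 4(1) \<sigma>n b by auto
          have FZ: "Z k = X k" if "k \<in> F"
            using Z(2)[OF 4(1)] that by (simp add: F_def correct_def)
          show ?case
          proof (cases "B k (\<sigma> i) + ereal (Z i) \<le> ereal (b i + Z k)")
            case True
            have "ok (F \<inter> {..<Suc k}) i (Z i)"
              using Z(4) True FZ by (auto simp: ok_def less_Suc_eq)
            then have "\<exists>Z. holds_reals T4 ''z'' n Z \<and>
              (\<forall>l<n. X l \<le> Z l \<and> Z l \<le> Z0 l) \<and> (\<forall>l<i. ok F l (Z l)) \<and> ok (F \<inter> {..<Suc k}) i (Z i)"
              using Z by blast
            then show ?thesis
              using True i 4(1,2) by (simp add: ev z holds_reals_def)
          next
            case False
            obtain c where c: "B k (\<sigma> i) = ereal c"
              using False Binf[OF 4(1) \<sigma>n[OF i(1)]] by (cases "B k (\<sigma> i)") auto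
            define Z' where "Z' = Z(i := b i + Z k - c)"
            have less: "Z' i < Z i" using False c by (simp add: Z'_def)
            have "X i \<le> Z' i"
              using Xle[OF i(1) 4(1)] c Z(2)[OF 4(1)] by (simp add: Z'_def)
            then have 1: "X l \<le> Z' l \<and> Z' l \<le> Z0 l" if "l < n" for l
              using Z(2)[OF that] less by (cases "l = i") (auto simp: Z'_def)
            have "B k' (\<sigma> i) + ereal (Z' i) \<le> ereal (b i + X k')" if "k' \<in> F" "k' < Suc k" for k'
            proof (cases "k' = k")
              case True
              then show ?thesis using c FZ that by (simp add: Z'_def)
            next
              case False
              then have "B k' (\<sigma> i) + ereal (Z i) \<le> ereal (b i + X k')"
                using Z(4) that by (simp add: ok_def)
              then show ?thesis using less by (cases "B k' (\<sigma> i)") auto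
            qed
            then have "ok (F \<inter> {..<Suc k}) i (Z' i)" by (auto simp: ok_def)
            moreover have "ok F l (Z' l)" if "l < i" for l
              using Z(3) that by (simp add: Z'_def)
            moreover have "holds_reals (T4((''t1'', 0, 0) := ereal (c + Z i), (''t2'', 0, 0) := ereal (b i + Z k),
                (''z'', i, 0) := ereal (b i + Z k - c))) ''z'' n Z'"
              using z by (simp add: holds_reals_def Z'_def)
            ultimately show ?thesis
              using False i 4(1,2) c 1 by (auto simp: ev z intro!: exI[of _ Z'])
          qed
        next
          case (5 N4 T4 k4)
          from 5(1) obtain Z where "holds_reals T4 ''z'' n Z" "\<forall>l<n. X l \<le> Z l \<and> Z l \<le> Z0 l"
            "\<forall>l<i. ok F l (Z l)" "ok (F \<inter> {..<n}) i (Z i)" by blast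
          moreover have "F \<inter> {..<n} = F" using F by auto
          ultimately have "\<exists>Z. holds_reals T4 ''z'' n Z \<and> (\<forall>l<n. X l \<le> Z l \<and> Z l \<le> Z0 l) \<and> (\<forall>l<Suc i. ok F l (Z l))"
            by (auto simp: less_Suc_eq)
          then show ?case using 5(4) by simp
        qed (use n in \<open>simp_all add: sameD\<close>)
      next
        case (5 N3 T3 k3)
        from 5(1) obtain Z where Z: "holds_reals T3 ''z'' n Z" "\<And>l. l < n \<Longrightarrow> X l \<le> Z l \<and> Z l \<le> Z0 l"
          "\<And>l. l < n \<Longrightarrow> ok F l (Z l)" by blast
        have sub: "F \<subseteq> correct Z"
          using Z(2) by (force simp: F_def correct_def)
        have "correct Z = {..<n} \<or> Suc m < card (correct Z)"
        proof (cases "F = {..<n}")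
          case True
          then show ?thesis using sub by (auto simp: correct_def)
        next
          case False
          then have "F \<subset> {..<n}" using F(1) by blast
          have "\<exists>i<n. i \<notin> F \<and> (\<exists>k\<in>F. B k (\<sigma> i) + ereal (X i) = B i (\<sigma> i) + ereal (X k))"
            by (rule tight_edge_if_greatest[where n = n]) (fact Binf \<sigma> pot gr F(2) \<open>F \<subset> {..<n}\<close>)+
          then obtain i k where ik: "i < n" "i \<notin> F" "k \<in> F"
            "B k (\<sigma> i) + ereal (X i) = B i (\<sigma> i) + ereal (X k)" by blast
          \<comment> \<open>The constraint towards \<open>k\<close> has been enforced with the final
            value of row \<open>k\<close> and is tight at \<open>X\<close>, so \<open>Z i\<close>
            cannot exceed \<open>X i\<close>.\<close>
          have "B k (\<sigma> i) + ereal (Z i) \<le> B k (\<sigma> i) + ereal (X i)"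
            using Z(3)[OF ik(1)] ik(3,4) b[OF ik(1)] by (auto simp: ok_def)
          then have "Z i \<le> X i"
            using ik(4) b[OF ik(1)] by (cases "B k (\<sigma> i)") auto
          then have "i \<in> correct Z" using Z(2)[OF ik(1)] ik(1) by (simp add: correct_def)
          then have "F \<subset> correct Z" using sub ik(2) by blast
          moreover have "finite (correct Z)" by (simp add: correct_def)
          ultimately have "card F < card (correct Z)" by (rule psubset_card_mono[rotated])
          then show ?thesis using Z0(4) False by (simp add: F_def)
        qed
        moreover have "Z 0 = 0" using sub F(2) X0 by (auto simp: correct_def)
        ultimately have "\<exists>Z. holds_reals T3 ''z'' n Z \<and> (\<forall>i<n. X i \<le> Z i) \<and> Z 0 = 0 \<and>
            (correct Z = {..<n} \<or> Suc m < card (correct Z))"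
          using Z(1,2) by blast
        then show ?case using 5(4) by (simp add: algebra_simps)
      qed (use n in \<open>simp_all add: sameD\<close>)
    next
      case (5 N2 T2 k2)
      from 5(1) obtain Z where Z: "holds_reals T2 ''z'' n Z" "correct Z = {..<n} \<or> n < card (correct Z)" by blast
      have "card (correct Z) \<le> card {..<n}" by (rule card_mono) (auto simp: correct_def)
      then have "correct Z = {..<n}" using Z(2) by simp
      then have "holds_reals T2 ''z'' n X" using Z(1) by (auto simp: holds_reals_def correct_def)
      then show ?case using 5(4) \<open>k1 \<le> _\<close> by (simp add: power3_eq_cube algebra_simps)
    qed (use n in \<open>simp_all add: sameD\<close>)
  qed (use n in \<open>simp_all add: sameD holds_reals_def\<close>)
qed

section \<open>Uniqueness test and evaluation of one simplex\<close>

text \<open>The array \<open>mk\<close> marks removed sinks, and a mark takes effect within the same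
  round. In an acyclic graph each round removes at least one sink as long as a row is left, so a row
  unmarked after \<open>n\<close> rounds reveals a cycle.\<close>

definition kahn :: com where
  "kahn = Seq (For ''i'' (vr ''n'') (NSet (ve ''mk'' (vr ''i'')) (NConst 0)))
    (Seq (For ''t'' (vr ''n'') (For ''i'' (vr ''n'')
      (Seq (NSet (sc ''bad'') (NConst 0))
      (Seq (For ''k'' (vr ''n'') (Ite (NEq (vr ''k'') (vr ''i'')) Skip
        (Ite (NEq (NGet (ve ''mk'' (vr ''k''))) (NConst 0))
          (Seq (TAdd (sc ''t1'') (''B'', vr ''k'', NGet (ve ''s'' (vr ''i''))) (ve ''z'' (vr ''i'')))
          (Seq (TAdd (sc ''t2'') (''B'', vr ''i'', NGet (ve ''s'' (vr ''i''))) (ve ''z'' (vr ''k'')))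
            (Ite (TLe (sc ''t2'') (sc ''t1'')) (NSet (sc ''bad'') (NConst 1)) Skip)))
          Skip)))
      (Ite (NEq (vr ''bad'') (NConst 0)) (NSet (ve ''mk'' (vr ''i'')) (NConst 1)) Skip)))))
    (Seq (NSet (sc ''a'') (NConst 1))
      (For ''i'' (vr ''n'') (Ite (NEq (NGet (ve ''mk'' (vr ''i''))) (NConst 0)) (NSet (sc ''a'') (NConst 0)) Skip))))"

text \<open>Soundness is kept in the form that every set of rows meeting the marked rows has a sink;
  a set that avoids the old marks but contains the newly marked row has that row as a sink. Once all
  rows are marked this is acyclicity. Testing a pair costs two additions and a comparison.\<close>

lemma wp_kahn:
  assumes n: "N (''n'', 0, 0) = n"
    and B: "\<And>i q. i < n \<Longrightarrow> q < n \<Longrightarrow> T (''B'', i, q) = B i q"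
    and s: "\<And>i. i < n \<Longrightarrow> N (''s'', i, 0) = \<sigma> i" and \<sigma>: "\<sigma> permutes {..<n}"
    and z: "holds_reals T ''z'' n X"
  shows "wp kahn (\<lambda>N' T' k'. (N' (''a'', 0, 0) = 1 \<longleftrightarrow> acyclic_potential n B \<sigma> X) \<and> k' \<le> 3 * n ^ 3) N T 0"
proof -
  have \<sigma>n: "\<sigma> i < n" if "i < n" for i using permutes_in_image[OF \<sigma>, of i] that by simp
  define sound where "sound F \<longleftrightarrow> (\<forall>V\<subseteq>{..<n}. V \<inter> F \<noteq> {} \<longrightarrow>
    (\<exists>i\<in>V. \<forall>k\<in>V. k \<noteq> i \<longrightarrow> strict_edge B \<sigma> X i k))" for F
  define free where "free F i \<longleftrightarrow> (\<forall>k<n. k \<noteq> i \<longrightarrow> k \<notin> F \<longrightarrow> strict_edge B \<sigma> X i k)" for F i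
  have sound_insert: "sound (insert i F)" if "sound F" "i < n" "free F i" for F i
    unfolding sound_def
  proof (intro allI impI)
    fix V assume V: "V \<subseteq> {..<n}" "V \<inter> insert i F \<noteq> {}"
    show "\<exists>i\<in>V. \<forall>k\<in>V. k \<noteq> i \<longrightarrow> strict_edge B \<sigma> X i k"
    proof (cases "V \<inter> F = {}")
      case True
      then have "i \<in> V" using V(2) by auto
      moreover have "strict_edge B \<sigma> X i k" if "k \<in> V" "k \<noteq> i" for k
        using \<open>free F i\<close> that V(1) True unfolding free_def by blast
      ultimately show ?thesis by blast
    next
      case False
      then show ?thesis using \<open>sound F\<close> V(1) unfolding sound_def by blast
    qed
  qed
  have z': "T (''z'', i, 0) = ereal (X i)" if "i < n" for i using z that by (simp add: holds_reals_def)
  show ?thesis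
    unfolding kahn_def wp_Seq
  proof (rule wp_For[where t = 0 and b = n and I = "\<lambda>m N' T'. \<forall>i<m. N' (''mk'', i, 0) = 0"], goal_cases)
    case (4 m N1 T1)
    then show ?case by (auto simp: less_Suc_eq)
  next
    case (5 N1 T1 k1)
    note [simp] = sameD[OF 5(2), simplified] sameD[OF 5(3), simplified]
    show ?case
    proof (rule wp_For[where t = "3 * n * n" and b = n and I = "\<lambda>m N' T'. sound (flags N' ''mk'' n) \<and>
        (acyclic_potential n B \<sigma> X \<longrightarrow> flags N' ''mk'' n = {..<n} \<or> m \<le> card (flags N' ''mk'' n))"], goal_cases)
      case 3
      have "flags (N1((''t'', 0, 0) := 0)) ''mk'' n = {}" using 5(1) by (simp add: flags_def)
      then show ?case by (simp add: sound_def)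
    next
      case (4 m N2 T2)
      note [simp] = sameD[OF 4(4), simplified] sameD[OF 4(5), simplified]
      define F where "F = flags N2 ''mk'' n"
      have F: "sound F" "acyclic_potential n B \<sigma> X \<longrightarrow> F = {..<n} \<or> m \<le> card F"
        using 4(3) by (simp_all add: F_def)
      show ?case
      proof (rule wp_For[where t = "3 * n" and b = n and I = "\<lambda>i N' T'. F \<subseteq> flags N' ''mk'' n \<and>
          sound (flags N' ''mk'' n) \<and> (\<forall>l<i. free F l \<longrightarrow> l \<in> flags N' ''mk'' n)"], goal_cases)
        case 3
        show ?case using F by (simp add: F_def flags_def)
      next
        case (4 i N3 T3)
        note [simp] = sameD[OF 4(4), simplified] sameD[OF 4(5), simplified]
        note i = 4(1,2)
        define F' where "F' = flags N3 ''mk'' n"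
        have F': "F \<subseteq> F'" "sound F'" "\<And>l. l < i \<Longrightarrow> free F l \<Longrightarrow> l \<in> F'"
          using 4(3) by (simp_all add: F'_def)
        show ?case
          unfolding wp_Seq wp_simps
        proof (rule wp_For[where t = 3 and b = n and I = "\<lambda>k N' T'. N' (''bad'', 0, 0) = 0 \<longleftrightarrow>
            (\<forall>l<k. l \<noteq> i \<longrightarrow> l \<notin> F' \<longrightarrow> strict_edge B \<sigma> X i l)"], goal_cases)
          case 3
          show ?case by simp
        next
          case (4 k N4 T4)
          note s4 [simp] = sameD[OF 4(4), simplified] sameD[OF 4(5), simplified]
          have ev: "T (''B'', k, N (''s'', i, 0)) = B k (\<sigma> i)" "T (''B'', i, N (''s'', i, 0)) = B i (\<sigma> i)"
            using B s i 4(1) \<sigma>n by auto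
          have mk: "k \<in> F' \<longleftrightarrow> N3 (''mk'', k, 0) \<noteq> 0" using 4(1) by (simp add: F'_def flags_def)
          have "strict_edge B \<sigma> X i k \<longleftrightarrow> \<not> B i (\<sigma> i) + ereal (X k) \<le> B k (\<sigma> i) + ereal (X i)"
            by (auto simp: strict_edge_def)
          then show ?case
            using 4(1-3) i mk by (auto simp: ev z' less_Suc_eq)
        next
          case (5 N4 T4 k4)
          note s4 [simp] = sameD[OF 5(2), simplified] sameD[OF 5(3), simplified]
          have free: "N4 (''bad'', 0, 0) = 0 \<longleftrightarrow> free F' i" using 5(1) by (simp add: free_def)
          have fl: "flags (N4((''i'', 0, 0) := y)) ''mk'' n = F'" for y
            by (simp add: F'_def flags_def)
          have fl': "flags (N4((''mk'', i, 0) := Suc 0, (''i'', 0, 0) := y)) ''mk'' n = insert i F'" for y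
            using i by (auto simp: F'_def flags_def)
          have mono: "free F l \<Longrightarrow> free F' l" for l using F'(1) by (auto simp: free_def)
          show ?case
          proof (cases "free F' i")
            case True
            then show ?thesis
              using free fl' sound_insert[OF F'(2) i(1) True] F'(1,3) i 5(4) by (auto simp: less_Suc_eq)
          next
            case False
            then show ?thesis
              using free fl F' i 5(4) mono by (auto simp: less_Suc_eq)
          qed
        qed (use n in \<open>simp_all add: sameD\<close>)
      next
        case (5 N3 T3 k3)
        define F' where "F' = flags N3 ''mk'' n"
        have F': "F \<subseteq> F'" "sound F'" "\<And>l. l < n \<Longrightarrow> free F l \<Longrightarrow> l \<in> F'"
          using 5(1) by (simp_all add: F'_def)
        have F'n: "F' \<subseteq> {..<n}" "F \<subseteq> {..<n}" by (auto simp: F'_def F_def flags_def)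
        \<comment> \<open>A sink among the rows unmarked at the start of the round is free, and
          marks set during the round cannot change that, so it is marked by the end.\<close>
        have "F' = {..<n} \<or> Suc m \<le> card F'" if ac: "acyclic_potential n B \<sigma> X"
        proof (cases "F = {..<n}")
          case False
          then have "{..<n} - F \<noteq> {}" using F'n by blast
          then obtain i where i: "i \<in> {..<n} - F"
            "\<And>k. k \<in> {..<n} - F \<Longrightarrow> k \<noteq> i \<Longrightarrow> strict_edge B \<sigma> X i k"
            using acyclic_potentialD[OF ac, of "{..<n} - F"] by (metis Diff_subset)
          have "free F i" using i(2) by (simp add: free_def)
          then have "F \<subset> F'" using F' i(1) by blast
          moreover have "finite F'" by (simp add: F'_def flags_def)
          ultimately have "card F < card F'" by (rule psubset_card_mono[rotated])
          then show ?thesis using F(2) ac False by auto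
        qed (use F'(1) F'n in blast)
        then show ?case
          using F'(2) 5(4) by (simp add: F'_def flags_def)
      qed (use n in \<open>simp_all add: sameD\<close>)
    next
      case (5 N2 T2 k2)
      note [simp] = sameD[OF 5(2), simplified] sameD[OF 5(3), simplified]
      define F where "F = flags N2 ''mk'' n"
      have F: "F \<subseteq> {..<n}" "finite F" by (auto simp: F_def flags_def)
      have all: "F = {..<n} \<longleftrightarrow> acyclic_potential n B \<sigma> X"
      proof
        assume "F = {..<n}"
        then show "acyclic_potential n B \<sigma> X"
          using 5(1) unfolding acyclic_potential_def sound_def F_def[symmetric] by blast
      next
        assume "acyclic_potential n B \<sigma> X"
        then have "F = {..<n} \<or> n \<le> card F" using 5(1) by (simp add: F_def)
        then show "F = {..<n}" using F(1) card_subset_eq[of "{..<n}" F] card_mono[OF _ F(1)] by auto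
      qed
      show ?case
        unfolding wp_simps
      proof (rule wp_For[where t = 0 and b = n and I = "\<lambda>m N' T'. N' (''a'', 0, 0) = 1 \<longleftrightarrow> {..<m} \<subseteq> F"], goal_cases)
        case (4 m N3 T3)
        note [simp] = sameD[OF 4(4), simplified] sameD[OF 4(5), simplified]
        have "m \<in> F \<longleftrightarrow> N2 (''mk'', m, 0) \<noteq> 0" using 4(1) by (simp add: F_def flags_def)
        then show ?case using 4(2,3) by (simp add: lessThan_Suc)
      next
        case (5 N3 T3 k3)
        have "{..<n} \<subseteq> F \<longleftrightarrow> F = {..<n}" using F by blast
        then show ?case
          using 5(1,4) all \<open>k2 \<le> _\<close> \<open>k1 \<le> _\<close> by (simp add: power3_eq_cube algebra_simps)
      qed (use n in \<open>simp_all add: sameD\<close>)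
    qed (use n in \<open>simp_all add: sameD\<close>)
  qed (use n in \<open>simp_all add: sameD\<close>)
qed

section \<open>Evaluation of a single simplex\<close>

definition load :: com where
  "load = For ''i'' (vr ''n'') (For ''q'' (vr ''n'') (Ite (NEq (vr ''i'') (NConst 0))
     (TZero (''B'', vr ''i'', vr ''q''))
     (TCopy (''B'', vr ''i'', vr ''q'') (''M'', vr ''i'', NGet (ve ''col'' (vr ''q''))))))"

definition accumulate :: com where
  "accumulate = Seq (TZero (sc ''acc''))
    (Seq (For ''i'' (vr ''n'') (TAdd (sc ''acc'') (sc ''acc'') (ve ''z'' (vr ''i''))))
    (Ite (TLe (sc ''out'') (sc ''acc'')) (TCopy (sc ''out'') (sc ''acc'')) Skip))"

definition simplex_step :: com where
  "simplex_step = Seq load (Seq hungarian (Ite (NEq (vr ''ok'') (NConst 1))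
     (Seq bellman_ford (Seq kahn (Ite (NEq (vr ''a'') (NConst 1)) accumulate Skip))) Skip))"

lemma mods_simplex_parts [simp]:
  "nmods bellman_ford = {''i'', ''t'', ''k''}" "tmods bellman_ford = {''z'', ''t1'', ''t2''}"
  "nmods kahn = {''i'', ''mk'', ''t'', ''bad'', ''k'', ''a''}" "tmods kahn = {''t1'', ''t2''}"
  "nmods load = {''i'', ''q''}" "tmods load = {''B''}"
  "nmods accumulate = {''i''}" "tmods accumulate = {''acc'', ''out''}"
  "nmods hungarian = {''ok'', ''i'', ''q'', ''r'', ''S'', ''U'', ''l'', ''mt'', ''done'', ''cur'', ''it'', ''way'', ''j'', ''v'', ''k'', ''s''}"
  "tmods hungarian = {''ninf'', ''x'', ''w'', ''g'', ''t'', ''dl''}"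
  by (auto simp: bellman_ford_def kahn_def load_def accumulate_def hungarian_def)

lemma wp_load:
  assumes n: "N (''n'', 0, 0) = n"
  shows "wp load (\<lambda>N' T' k'. (\<forall>i<n. \<forall>q<n. T' (''B'', i, q) =
    (if i = 0 then 0 else T (''M'', i, N (''col'', q, 0)))) \<and> k' = 0) N T 0"
  unfolding load_def
proof (rule wp_For[where t = 0 and b = n and I = "\<lambda>m N' T'. \<forall>i<m. \<forall>q<n. T' (''B'', i, q) =
    (if i = 0 then 0 else T (''M'', i, N (''col'', q, 0)))"], goal_cases)
  case (4 m N1 T1)
  note [simp] = sameD[OF 4(4), simplified] sameD[OF 4(5), simplified]
  show ?case
  proof (rule wp_For[where t = 0 and b = n and I = "\<lambda>p N' T'. (\<forall>i<m. \<forall>q<n. T' (''B'', i, q) =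
      (if i = 0 then 0 else T (''M'', i, N (''col'', q, 0)))) \<and>
      (\<forall>q<p. T' (''B'', m, q) = (if m = 0 then 0 else T (''M'', m, N (''col'', q, 0))))"], goal_cases)
    case 3
    show ?case using 4(3) by simp
  next
    case (4 p N2 T2)
    note [simp] = sameD[OF 4(4), simplified] sameD[OF 4(5), simplified]
    show ?case using 4(2,3) \<open>N1 (''i'', 0, 0) = m\<close> by (auto simp: less_Suc_eq)
  next
    case (5 N2 T2 k2)
    then show ?case by (auto simp: less_Suc_eq)
  qed (use n in \<open>simp_all add: sameD\<close>)
qed (use n in \<open>simp_all add: sameD\<close>)

lemma wp_accumulate:
  assumes n: "N (''n'', 0, 0) = n" and z: "holds_reals T ''z'' n X"
  shows "wp accumulate (\<lambda>N' T' k'. T' (''out'', 0, 0) = max (T (''out'', 0, 0)) (ereal (\<Sum>i<n. X i)) \<and> k' \<le> n + 1) N T 0"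
  unfolding accumulate_def wp_Seq wp_simps
proof (rule wp_For[where t = 1 and b = n and I = "\<lambda>m N' T'. T' (''acc'', 0, 0) = ereal (\<Sum>i<m. X i)
    \<and> T' (''out'', 0, 0) = T (''out'', 0, 0)"], goal_cases)
  case (4 m N1 T1)
  note [simp] = sameD[OF 4(4), simplified] sameD[OF 4(5), simplified]
  have "T (''z'', m, 0) = ereal (X m)" using z 4(1) by (simp add: holds_reals_def)
  then show ?case using 4(2,3) by simp
qed (use n in \<open>auto simp: sameD zero_ereal_def max_def\<close>)

text \<open>A relation, since the matching and its greatest potential are whatever the run produces;
  \<open>simplex_value_eq\<close> shows that the simplex determines the value.\<close>

definition simplex_value :: "nat \<Rightarrow> (nat \<Rightarrow> nat \<Rightarrow> ereal) \<Rightarrow> ereal \<Rightarrow> bool" where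
  "simplex_value n B v \<longleftrightarrow> unique_optimum n B \<and>
     (\<exists>\<sigma> X. \<sigma> permutes {..<n} \<and> greatest_potential n B \<sigma> X \<and> v = ereal (\<Sum>i<n. X i))"

text \<open>The constant 17 is \<open>8 + 4 + 3\<close> for the three phases, plus 2 because
  \<open>n + 1 \<le> 2 * n ^ 3\<close> bounds the accumulation.\<close>

lemma wp_simplex_step:
  assumes n: "N (''n'', 0, 0) = n" "0 < n"
    and Binf': "\<And>i q. i < n \<Longrightarrow> q < n \<Longrightarrow> B i q \<noteq> \<infinity>"
    and B: "\<And>i q. i < n \<Longrightarrow> q < n \<Longrightarrow> B i q = (if i = 0 then 0 else T (''M'', i, N (''col'', q, 0)))"
  shows "wp simplex_step (\<lambda>N' T' k'. (if unique_optimum n B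
      then \<exists>v. simplex_value n B v \<and> T' (''out'', 0, 0) = max (T (''out'', 0, 0)) v
      else T' (''out'', 0, 0) = T (''out'', 0, 0)) \<and> k' \<le> 17 * n ^ 3) N T 0"
  unfolding simplex_step_def wp_Seq
proof (rule wp_use[OF wp_load[of N n T, OF n(1)]], goal_cases)
  case (1 N1 T1 k1)
  note [simp] = sameD[OF 1(2), simplified] sameD[OF 1(3), simplified]
  have B1: "T1 (''B'', i, q) = B i q" if "i < n" "q < n" for i q using 1(1) that by (simp add: B)
  have n3: "n \<le> n ^ 3" "1 \<le> n ^ 3" using n(2) by (simp_all add: power3_eq_cube)
  show ?case
  proof (rule wp_use[OF wp_hungarian[of N1 n T1]], goal_cases)
    case (3 N2 T2 k2)
    note [simp] = sameD[OF 3(2), simplified] sameD[OF 3(3), simplified]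
    show ?case
    proof (cases "N2 (''ok'', 0, 0) = 1")
      case False
      then have "no_finite_perm n (\<lambda>i q. T1 (''B'', i, q))" using 3(1) by (auto simp: matching_inv_def)
      have "\<not> unique_optimum n B"
      proof
        assume "unique_optimum n B"
        then obtain p where p: "p permutes {..<n}" "perm_weight n B p \<noteq> -\<infinity>"
          unfolding unique_optimum_def by auto
        have fin: "\<forall>i<n. \<bar>B i (p i)\<bar> \<noteq> \<infinity>"
          using perm_weight_finite_iff[of n B, OF Binf' p(1)] p(2) by metis
        obtain i where i: "i < n" "T1 (''B'', i, p i) = -\<infinity>"
          using \<open>no_finite_perm _ _\<close> p(1) unfolding no_finite_perm_def by meson
        have "p i < n" using permutes_in_image[OF p(1), of i] i(1) by simp
        then have "B i (p i) = -\<infinity>" using B1[OF i(1)] i(2) by simp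
        then show False using fin[rule_format, OF i(1)] by simp
      qed
      then show ?thesis using False 1(1) 3(1) by simp
    next
      case True
      then obtain X0 W where XW: "feasible n (\<lambda>i q. T1 (''B'', i, q)) X0 W"
        "tight_matching n (\<lambda>i q. T1 (''B'', i, q)) X0 W n (\<lambda>l. N2 (''s'', l, 0))"
        using 3(1) by (auto simp: matching_inv_def)
      define \<sigma> where "\<sigma> i = (if i < n then N2 (''s'', i, 0) else i)" for i
      have "\<sigma> permutes {..<n}" "potential n (\<lambda>i q. T1 (''B'', i, q)) \<sigma> X0"
        using potential_if_tight_matching[OF XW] by (simp_all add: \<sigma>_def[abs_def])
      moreover have "\<sigma> i < n" if "i < n" for i
        using permutes_in_image[OF \<open>\<sigma> permutes {..<n}\<close>, of i] that by simp
      ultimately have \<sigma>: "\<sigma> permutes {..<n}" "potential n B \<sigma> X0"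
        using B1 by (auto simp: potential_def)
      obtain X where X: "greatest_potential n B \<sigma> X"
        using greatest_potential_exists[OF n(2) \<sigma>(1) _ \<sigma>(2)] using n(2) by (auto simp: B)
      have "wp bellman_ford (wp kahn (wp (Ite (NEq (vr ''a'') (NConst 1)) accumulate Skip)
        (\<lambda>N' T' k'. (if unique_optimum n B
          then \<exists>v. simplex_value n B v \<and> T' (''out'', 0, 0) = max (T (''out'', 0, 0)) v
          else T' (''out'', 0, 0) = T (''out'', 0, 0)) \<and> k' \<le> 17 * n ^ 3))) N2 T2 (0 + k1 + k2)"
      proof (rule wp_use[OF wp_bellman_ford[of N2 n T2 B \<sigma> X]], goal_cases)
        case (9 N3 T3 k3)
        note [simp] = sameD[OF 9(2), simplified] sameD[OF 9(3), simplified]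
        show ?case
        proof (rule wp_use[OF wp_kahn[of N3 n T3 B \<sigma> X]], goal_cases)
          case (6 N4 T4 k4)
          note [simp] = sameD[OF 6(2), simplified] sameD[OF 6(3), simplified]
          have iff: "unique_optimum n B \<longleftrightarrow> N4 (''a'', 0, 0) = 1"
            using unique_optimum_iff[of n B, OF Binf' \<sigma>(1)] X 6(1) by (auto simp: greatest_potential_def)
          have k: "0 + k1 + k2 + k3 + k4 \<le> 15 * n ^ 3" using 1(1) 3(1) 9(1) 6(1) by simp
          show ?case
          proof (cases "unique_optimum n B")
            case True
            then have v: "simplex_value n B (ereal (\<Sum>i<n. X i))"
              using \<sigma>(1) X unfolding simplex_value_def by blast
            have "holds_reals T4 ''z'' n X" using 9(1) by (simp add: holds_reals_def)
            have "wp accumulate (\<lambda>N' T' k'. (\<exists>v. simplex_value n B v \<and> T' (''out'', 0, 0) = max (T (''out'', 0, 0)) v)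
                \<and> k' \<le> 17 * n ^ 3) N4 T4 (0 + k1 + k2 + k3 + k4)"
              by (rule wp_use[OF wp_accumulate[of N4 n T4 X]])
                (use n v k n3 \<open>holds_reals T4 _ _ _\<close> in auto)
            then show ?thesis using True iff by simp
          next
            case False
            then show ?thesis using iff k by simp
          qed
        qed (use n B1 \<sigma> 9(1) in \<open>simp_all add: \<sigma>_def\<close>)
      qed (use n B B1 Binf' \<sigma> X in \<open>simp_all add: \<sigma>_def\<close>)
      then show ?thesis using True by simp
    qed
  qed (use n B1 Binf' in simp_all)
qed

section \<open>Enumeration of all simplices\<close>

text \<open>Bit \<open>l\<close> of the code \<open>c\<close> selects column \<open>l + 1\<close>.
  Expressions have no division, so half of \<open>y\<close> is found by trying all candidates
  \<open>e\<close>, which is free because it concerns natural numbers.\<close>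

definition decode :: com where
  "decode = Seq (NSet (sc ''y'') (vr ''c'')) (Seq (NSet (sc ''cnt'') (NConst 0))
    (For ''b'' (vr ''m'')
      (Seq (For ''e'' (NPlus (vr ''y'') (NConst 1))
        (Ite (NLess (vr ''y'') (NTimes (NConst 2) (vr ''e''))) Skip (NSet (sc ''h'') (vr ''e''))))
      (Seq (Ite (NLess (NTimes (NConst 2) (vr ''h'')) (vr ''y''))
        (Seq (NSet (ve ''col'' (vr ''cnt'')) (NPlus (vr ''b'') (NConst 1)))
          (NSet (sc ''cnt'') (NPlus (vr ''cnt'') (NConst 1)))) Skip)
      (NSet (sc ''y'') (vr ''h''))))))"

definition coded_columns :: "nat \<Rightarrow> nat \<Rightarrow> nat list" where
  "coded_columns c b = filter (\<lambda>l. l - 1 \<in> set_decode c) [1..<Suc b]"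

lemma mods_decode [simp]:
  "nmods decode = {''y'', ''cnt'', ''b'', ''e'', ''h'', ''col''}" "tmods decode = {}"
  by (auto simp: decode_def)

lemma wp_decode:
  assumes m: "N (''m'', 0, 0) = m" and c: "N (''c'', 0, 0) = c"
  shows "wp decode (\<lambda>N' T' k'. N' (''cnt'', 0, 0) = length (coded_columns c m) \<and>
    (\<forall>i<length (coded_columns c m). N' (''col'', i, 0) = coded_columns c m ! i) \<and> k' = 0) N T 0"
  unfolding decode_def wp_Seq wp_simps
proof (rule wp_For[where t = 0 and b = m and I = "\<lambda>b N' T'. N' (''y'', 0, 0) = c div 2 ^ b \<and>
    N' (''cnt'', 0, 0) = length (coded_columns c b) \<and>
    (\<forall>i<length (coded_columns c b). N' (''col'', i, 0) = coded_columns c b ! i)"], goal_cases)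
  case (4 b N1 T1)
  note [simp] = sameD[OF 4(4), simplified] sameD[OF 4(5), simplified]
  define y where "y = c div 2 ^ b"
  have y: "N1 (''y'', 0, 0) = y" using 4(3) by (simp add: y_def)
  show ?case
    unfolding wp_Seq
  \<comment> \<open>The disjunct \<open>j = 0\<close> covers the stale value of \<open>h\<close>
    left by the previous bit; the candidate \<open>e = 0\<close> overwrites it.\<close>
  proof (rule wp_For[where t = 0 and b = "y + 1" and I = "\<lambda>j N' T'. j = 0 \<or>
      (\<forall>e<j. 2 * e \<le> y \<longrightarrow> e \<le> N' (''h'', 0, 0)) \<and> 2 * N' (''h'', 0, 0) \<le> y"], goal_cases)
    case (4 j N2 T2)
    note [simp] = sameD[OF 4(4), simplified] sameD[OF 4(5), simplified]
    show ?case using 4(2,3) y by (auto simp: less_Suc_eq)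
  next
    case (5 N2 T2 k2)
    note [simp] = sameD[OF 5(2), simplified] sameD[OF 5(3), simplified]
    have "y div 2 < y + 1" "2 * (y div 2) \<le> y" by simp_all
    then have "y div 2 \<le> N2 (''h'', 0, 0)" using 5(1) by (metis Suc_eq_plus1 nat.distinct(1))
    moreover have "2 * N2 (''h'', 0, 0) \<le> y" using 5(1) by simp
    ultimately have h: "N2 (''h'', 0, 0) = y div 2" by linarith
    have y2: "y div 2 = c div (2 * 2 ^ b)" unfolding y_def div_mult2_eq[symmetric] by (simp only: mult.commute)
    have step: "coded_columns c (Suc b) = coded_columns c b @ (if odd y then [Suc b] else [])"
      by (simp add: coded_columns_def set_decode_def y_def)
    have old: "N1 (''cnt'', 0, 0) = length (coded_columns c b)"
      "\<And>i. i < length (coded_columns c b) \<Longrightarrow> N1 (''col'', i, 0) = coded_columns c b ! i"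
      using 4(3) by simp_all
    show ?case
    proof (cases "odd y")
      case True
      then show ?thesis
        using 4(2) 5(4) h y old odd_pos[OF True] by (auto simp: step nth_append less_Suc_eq simp flip: y2)
    next
      case False
      then show ?thesis
        using 4(2) 5(4) h y old by (auto simp: step simp flip: y2)
    qed
  qed (use y in \<open>simp_all add: sameD\<close>)
qed (use m c in \<open>simp_all add: sameD coded_columns_def\<close>)

definition all_simplices :: com where
  "all_simplices = Seq (NSet (sc ''n'') (NPlus (vr ''d'') (NConst 1))) (Seq (NSet (sc ''p'') (NConst 1))
    (Seq (For ''b'' (vr ''m'') (NSet (sc ''p'') (NPlus (vr ''p'') (vr ''p''))))
    (For ''c'' (vr ''p'') (Seq decode (Ite (NEq (vr ''cnt'') (vr ''n'')) simplex_step Skip)))))"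

definition coded_set :: "nat \<Rightarrow> nat set" where
  "coded_set c = Suc ` set_decode c"

lemma coded_set_bij: "bij_betw coded_set {..<2 ^ m} {J. J \<subseteq> {1..m}}"
proof (rule bij_betw_byWitness[where f' = "\<lambda>J. set_encode ((\<lambda>l. l - 1) ` J)"])
  have pred: "(\<lambda>l. l - 1) ` Suc ` A = A" for A by (auto simp: image_image)
  show "\<forall>c\<in>{..<2 ^ m}. set_encode ((\<lambda>l. l - 1) ` coded_set c) = c"
    unfolding coded_set_def pred by simp
  show "\<forall>J\<in>{J. J \<subseteq> {1..m}}. coded_set (set_encode ((\<lambda>l. l - 1) ` J)) = J"
  proof clarify
    fix J assume J: "J \<subseteq> {1..m}"
    then have "finite J" using finite_subset by blast
    then have "coded_set (set_encode ((\<lambda>l. l - 1) ` J)) = Suc ` (\<lambda>l. l - 1) ` J"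
      by (simp add: coded_set_def)
    also have "\<dots> = (\<lambda>l. l) ` J"
      unfolding image_image using J by (intro image_cong) auto
    finally show "coded_set (set_encode ((\<lambda>l. l - 1) ` J)) = J" by simp
  qed
  show "coded_set ` {..<2 ^ m} \<subseteq> {J. J \<subseteq> {1..m}}"
  proof clarify
    fix c j assume c: "c < (2::nat) ^ m" and "j \<in> coded_set c"
    then obtain i where i: "j = Suc i" "odd (c div 2 ^ i)" by (auto simp: coded_set_def set_decode_def)
    have "i < m"
    proof (rule ccontr)
      assume "\<not> i < m"
      then have "(2::nat) ^ m \<le> 2 ^ i" by simp
      then have "c < 2 ^ i" using c by linarith
      then show False using i(2) by simp
    qed
    then show "j \<in> {1..m}" using i by simp
  qed
  show "(\<lambda>J. set_encode ((\<lambda>l. l - 1) ` J)) ` {J. J \<subseteq> {1..m}} \<subseteq> {..<2 ^ m}"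
  proof (rule image_subsetI)
    fix J assume "J \<in> {J. J \<subseteq> {1..m}}"
    then have J: "J \<subseteq> {1..m}" by simp
    have "set_encode ((\<lambda>l. l - 1) ` J) \<le> (\<Sum>i<m. 2 ^ i)"
      unfolding set_encode_def using J by (intro sum_mono2) force+
    also have "\<dots> < 2 ^ m" by (simp add: lessThan_atLeast0 sum_power2)
    finally show "set_encode ((\<lambda>l. l - 1) ` J) \<in> {..<2 ^ m}" by simp
  qed
qed

lemma coded_columns_eq:
  assumes "c < 2 ^ m"
  shows "coded_columns c m = sorted_list_of_set (coded_set c)"
proof -
  have "coded_set c \<subseteq> {1..m}" using coded_set_bij[of m] assms by (auto simp: bij_betw_def)
  moreover have "l \<in> coded_set c \<longleftrightarrow> l - 1 \<in> set_decode c" if "1 \<le> l" for l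
    using that by (cases l) (auto simp: coded_set_def)
  ultimately have "set (coded_columns c m) = coded_set c"
    by (auto simp: coded_columns_def)
  moreover have "sorted (coded_columns c m)" "distinct (coded_columns c m)"
    by (simp_all add: coded_columns_def sorted_wrt_filter del: upt_Suc)
  ultimately show ?thesis
    by (metis sorted_list_of_set.idem_if_sorted_distinct)
qed

definition simplex_matrix :: "(nat \<Rightarrow> nat \<Rightarrow> ereal) \<Rightarrow> nat set \<Rightarrow> nat \<Rightarrow> nat \<Rightarrow> ereal" where
  "simplex_matrix M J = (\<lambda>i q. if i = 0 then 0 else M i (sorted_list_of_set J ! q))"

lemma mods_simplex_step [simp]:
  "nmods simplex_step = {''i'', ''q'', ''ok'', ''r'', ''S'', ''U'', ''l'', ''mt'', ''done'', ''cur'', ''it'',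
     ''way'', ''j'', ''v'', ''k'', ''s'', ''mk'', ''t'', ''bad'', ''a''}"
  "tmods simplex_step = {''B'', ''ninf'', ''x'', ''w'', ''g'', ''t'', ''dl'', ''z'', ''t1'', ''t2'', ''acc'', ''out''}"
  by (auto simp: simplex_step_def)

text \<open>The parameter \<open>val\<close> separates the program from the geometry. A code
  contributes to the time only if it has \<open>d + 1\<close> bits set, and
  \<open>coded_set_bij\<close> turns the sum over codes into a sum over subsets.\<close>

lemma wp_all_simplices:
  assumes N: "N (''d'', 0, 0) = d" "N (''m'', 0, 0) = m" and M: "tmatrix d m M"
    and T: "\<And>i j. i \<in> {1..d} \<Longrightarrow> j \<in> {1..m} \<Longrightarrow> T (''M'', i, j) = M i j" "T (''out'', 0, 0) = -\<infinity>"
    and val: "\<And>J v. J \<subseteq> {1..m} \<Longrightarrow> card J = d + 1 \<Longrightarrow> simplex_value (d + 1) (simplex_matrix M J) v \<Longrightarrow> v = val J"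
  defines "good J \<equiv> card J = d + 1 \<and> unique_optimum (d + 1) (simplex_matrix M J)"
  shows "wp all_simplices (\<lambda>N' T' k'. T' (''out'', 0, 0) = (SUP J\<in>{J. J \<subseteq> {1..m} \<and> good J}. val J) \<and>
    k' \<le> (m choose (d + 1)) * (17 * (d + 1) ^ 3)) N T 0"
  unfolding all_simplices_def wp_Seq wp_simps
proof (rule wp_For[where t = 0 and b = m and I = "\<lambda>b N' T'. N' (''p'', 0, 0) = 2 ^ b"], goal_cases)
  case (4 b N1 T1)
  then show ?case by simp
next
  case (5 N1 T1 k1)
  note [simp] = sameD[OF 5(2), simplified] sameD[OF 5(3), simplified]
  define K where "K = 17 * (d + 1) ^ 3"
  show ?case
  proof (rule wp_For_sum[where f = "\<lambda>c. if card (coded_set c) = d + 1 then K else 0" and b = "2 ^ m"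
      and I = "\<lambda>c N' T'. T' (''out'', 0, 0) = (SUP J\<in>{J \<in> coded_set ` {..<c}. good J}. val J)"], goal_cases)
    case (4 c N2 T2)
    note [simp] = sameD[OF 4(4), simplified] sameD[OF 4(5), simplified]
    define J where "J = coded_set c"
    have Jm: "J \<subseteq> {1..m}" using coded_set_bij[of m] 4(1) by (auto simp: J_def bij_betw_def)
    have L: "coded_columns c m = sorted_list_of_set J" using coded_columns_eq[OF 4(1)] by (simp add: J_def)
    have "finite J" using Jm finite_subset by blast
    have S: "{J \<in> coded_set ` {..<Suc c}. good J} =
        (if good J then insert J {J \<in> coded_set ` {..<c}. good J} else {J \<in> coded_set ` {..<c}. good J})"
      by (auto simp: J_def lessThan_Suc)
    show ?case
      unfolding wp_Seq
    proof (rule wp_use[OF wp_decode[of N2 m c T2]], goal_cases)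
      case (3 N3 T3 k3)
      note [simp] = sameD[OF 3(2), simplified] sameD[OF 3(3), simplified]
      have cnt: "N3 (''cnt'', 0, 0) = card J" using 3(1) L by simp
      show ?case
      proof (cases "card J = d + 1")
        case False
        then have "\<not> good J" by (simp add: good_def)
        then show ?thesis using False cnt 4(3) 3(1) by (simp add: S N flip: J_def)
      next
        case True
        have col: "N3 (''col'', q, 0) = sorted_list_of_set J ! q" if "q < d + 1" for q
          using 3(1) that True by (simp add: L)
        have colJ: "sorted_list_of_set J ! q \<in> {1..m}" if "q < d + 1" for q
          using that True Jm \<open>finite J\<close> nth_mem[of q "sorted_list_of_set J"] by auto
        have TM: "T (''M'', i, sorted_list_of_set J ! q) = M i (sorted_list_of_set J ! q)"
          if "i < d + 1" "i \<noteq> 0" "q < d + 1" for i q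
          using that T(1)[of i] colJ[of q] by simp
        have "wp simplex_step (\<lambda>N' T' k'. T' (''out'', 0, 0) =
            (SUP J\<in>{J \<in> coded_set ` {..<Suc c}. good J}. val J) \<and> k' \<le> K) N3 T3 (0 + k3)"
        proof (rule wp_use[OF wp_simplex_step[of N3 "d + 1" "simplex_matrix M J" T3]], goal_cases)
          case (3 i q)
          then show ?case
            using M colJ[of q] by (auto simp: tmatrix_def simplex_matrix_def)
        next
          case (5 N4 T4 k4)
          show ?case
          proof (cases "good J")
            case gd: True
            then obtain v where v: "simplex_value (d + 1) (simplex_matrix M J) v"
              "T4 (''out'', 0, 0) = max (T3 (''out'', 0, 0)) v"
              using 5(1) by (auto simp: good_def)
            have "v = val J" using val[OF Jm True v(1)] .
            then show ?thesis
              using v(2) 5(1) 4(3) 3(1) gd by (simp add: S K_def sup_max max.commute)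
          next
            case False
            then have "\<not> unique_optimum (d + 1) (simplex_matrix M J)" using True by (simp add: good_def)
            then show ?thesis
              using 5(1) 4(3) 3(1) False by (simp add: S K_def)
          qed
        qed (use N col TM in \<open>auto simp: simplex_matrix_def\<close>)
        then show ?thesis using True cnt by (simp add: N K_def flip: J_def)
      qed
    qed (use N 4 in simp_all)
  next
    case 3
    show ?case using T by (simp add: bot_ereal_def)
  next
    case (5 N2 T2 k2)
    have "coded_set ` {..<2 ^ m} = {J. J \<subseteq> {1..m}}"
      using coded_set_bij[of m] by (simp add: bij_betw_def)
    then have "{J \<in> coded_set ` {..<2 ^ m}. good J} = {J. J \<subseteq> {1..m} \<and> good J}" by auto
    moreover have "(\<Sum>c<2 ^ m. if card (coded_set c) = d + 1 then K else 0) = (m choose (d + 1)) * K"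
    proof -
      have "(\<Sum>c<2 ^ m. if card (coded_set c) = d + 1 then K else 0) =
          (\<Sum>J\<in>{J. J \<subseteq> {1..m}}. if card J = d + 1 then K else 0)"
        by (rule sum.reindex_bij_betw[OF coded_set_bij])
      also have "\<dots> = (\<Sum>J\<in>{J. J \<subseteq> {1..m} \<and> card J = d + 1}. K)"
        by (rule sum.mono_neutral_cong_right) (auto)
      also have "\<dots> = (m choose (d + 1)) * K"
        using n_subsets[of "{1..m}" "d + 1"] by simp
      finally show ?thesis .
    qed
    ultimately show ?case using 5(1,4) \<open>k1 \<le> _\<close> by (simp add: K_def)
  qed (use 5(1) in \<open>auto simp: sameD\<close>)
qed (use N in \<open>auto simp: sameD\<close>)

section \<open>Generators of tropical polytopes\<close>

definition covers :: "nat \<Rightarrow> (nat \<Rightarrow> ereal) set \<Rightarrow> (nat \<Rightarrow> ereal) \<Rightarrow> nat \<Rightarrow> bool" where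
  "covers d V x i \<longleftrightarrow> (\<exists>v\<in>V. \<exists>l. l \<noteq> \<infinity> \<and> l + v i = x i \<and> (\<forall>k\<le>d. l + v k \<le> x k))"

lemma tspaceD:
  assumes "x \<in> tspace d"
  shows "x 0 = 0" "x i \<noteq> \<infinity>" "d < i \<Longrightarrow> x i = 0"
proof -
  have *: "i \<in> {1..d} \<Longrightarrow> x i \<noteq> \<infinity>" "i \<notin> {1..d} \<Longrightarrow> x i = 0" for i
    using assms unfolding tspace_def by blast+
  show "x 0 = 0" "d < i \<Longrightarrow> x i = 0" using *(2) by simp_all
  show "x i \<noteq> \<infinity>" using *[of i] by (cases "i \<in> {1..d}") simp_all
qed

lemma finite_SUP_in:
  fixes f :: "'a \<Rightarrow> ereal"
  assumes "finite A" "A \<noteq> {}"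
  obtains a where "a \<in> A" "(SUP a\<in>A. f a) = f a"
proof -
  have "Max (f ` A) \<in> f ` A" using assms by simp
  moreover have "(SUP a\<in>A. f a) = Max (f ` A)" using assms by (simp add: Max_Sup)
  ultimately show ?thesis using that by auto
qed

text \<open>Membership becomes a condition on single coordinates, which can be compared with the
  covector inequalities. In a combination every coordinate is attained by some summand; conversely
  one scaled generator for each coordinate in \<open>0..d\<close> suffices.\<close>

lemma tconv_iff:
  assumes V: "V \<subseteq> tspace d"
  shows "x \<in> tconv V \<longleftrightarrow> x \<in> tspace d \<and> (\<forall>i\<le>d. covers d V x i)"
proof
  assume "x \<in> tconv V"
  then obtain n l v where lv: "\<forall>j\<in>{1..n::nat}. l j \<noteq> \<infinity> \<and> v j \<in> V" "(SUP j\<in>{1..n}. l j) = 0"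
    "x = (\<lambda>i. SUP j\<in>{1..n}. l j + v j i)"
    unfolding tconv_def by blast
  have n: "{1..n} \<noteq> {}"
  proof
    assume "{1..n} = {}"
    then show False using lv(2) by (simp add: bot_ereal_def)
  qed
  have att: "\<exists>j\<in>{1..n}. x i = l j + v j i" for i
  proof -
    obtain j where "j \<in> {1..n}" "(SUP j\<in>{1..n}. l j + v j i) = l j + v j i"
      by (rule finite_SUP_in[OF _ n]) simp
    then show ?thesis unfolding lv(3) by blast
  qed
  have ts: "x \<in> tspace d"
    unfolding tspace_def
  proof (safe)
    fix i assume "i \<in> {1..d}" "x i = \<infinity>"
    then obtain j where "j \<in> {1..n}" "l j + v j i = \<infinity>" using att[of i] by auto
    moreover from this have "l j \<noteq> \<infinity>" "v j \<in> tspace d" using lv(1) V by blast+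
    ultimately show False using tspaceD(2)[of "v j" d i] by simp
  next
    fix i assume i: "i \<notin> {1..d}"
    have "v j i = 0" if "j \<in> {1..n}" for j
      using that lv(1) V i unfolding tspace_def by blast
    then have "x i = (SUP j\<in>{1..n}. l j)" unfolding lv(3) by (intro SUP_cong) auto
    then show "x i = 0" using lv(2) by simp
  qed
  moreover have "covers d V x i" for i
  proof -
    obtain j where j: "j \<in> {1..n}" "x i = l j + v j i" using att[of i] by blast
    moreover have "l j + v j k \<le> x k" for k unfolding lv(3) using j(1) by (rule SUP_upper)
    ultimately show ?thesis unfolding covers_def using lv(1) by metis
  qed
  ultimately show "x \<in> tspace d \<and> (\<forall>i\<le>d. covers d V x i)" by blast
next
  assume x: "x \<in> tspace d \<and> (\<forall>i\<le>d. covers d V x i)"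
  then have "\<forall>i. \<exists>v l. i \<le> d \<longrightarrow> v \<in> V \<and> l \<noteq> \<infinity> \<and> l + v i = x i \<and> (\<forall>k\<le>d. l + v k \<le> x k)"
    unfolding covers_def by blast
  then obtain v l where vl: "\<And>i. i \<le> d \<Longrightarrow> v i \<in> V" "\<And>i. i \<le> d \<Longrightarrow> l i \<noteq> (\<infinity>::ereal)"
    "\<And>i. i \<le> d \<Longrightarrow> l i + v i i = x i" "\<And>i k. i \<le> d \<Longrightarrow> k \<le> d \<Longrightarrow> l i + v i k \<le> x k"
    by metis
  have vt: "v i \<in> tspace d" if "i \<le> d" for i using vl(1)[OF that] V by blast
  have x0: "x 0 = 0" using x tspaceD by blast
  \<comment> \<open>Coordinate 0, where all generators and \<open>x\<close> vanish, yields the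
    normalization: every coefficient is at most 0, and the one chosen for coordinate 0 equals
    0.\<close>
  have SUP: "(SUP j\<in>{1..Suc d}. l (j - 1)) = 0"
  proof (rule antisym)
    show "(SUP j\<in>{1..Suc d}. l (j - 1)) \<le> 0"
    proof (rule SUP_least)
      fix j assume "j \<in> {1..Suc d}"
      then have "j - 1 \<le> d" by auto
      then show "l (j - 1) \<le> 0" using vl(4)[of "j - 1" 0] tspaceD(1)[OF vt] x0 by simp
    qed
    have "l 0 = 0" using vl(3)[of 0] tspaceD(1)[OF vt] x0 by simp
    then show "0 \<le> (SUP j\<in>{1..Suc d}. l (j - 1))" by (intro SUP_upper2[of 1]) auto
  qed
  have "x i = (SUP j\<in>{1..Suc d}. l (j - 1) + v (j - 1) i)" for i
  proof (cases "i \<le> d")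
    case True
    show ?thesis
    proof (rule antisym)
      show "x i \<le> (SUP j\<in>{1..Suc d}. l (j - 1) + v (j - 1) i)"
        by (rule SUP_upper2[of "Suc i"]) (use True vl(3) in auto)
      show "(SUP j\<in>{1..Suc d}. l (j - 1) + v (j - 1) i) \<le> x i"
        by (rule SUP_least) (use True vl(4) in auto)
    qed
  next
    case False
    then have "(SUP j\<in>{1..Suc d}. l (j - 1) + v (j - 1) i) = (SUP j\<in>{1..Suc d}. l (j - 1))"
      by (intro SUP_cong refl) (use tspaceD(3)[OF vt] in auto)
    then show ?thesis using False SUP x tspaceD(3) by auto
  qed
  then have "x = (\<lambda>i. SUP j\<in>{1..Suc d}. l (j - 1) + v (j - 1) i)" by blast
  moreover have "\<forall>j\<in>{1..Suc d}. l (j - 1) \<noteq> \<infinity> \<and> v (j - 1) \<in> V" using vl by auto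
  ultimately show "x \<in> tconv V"
    unfolding tconv_def using SUP
    by (intro CollectI exI[of _ "Suc d"] exI[of _ "\<lambda>j. l (j - 1)"] exI[of _ "\<lambda>j. v (j - 1)"]) blast
qed

lemma subset_tconv: "V \<subseteq> tconv V"
proof
  fix v assume "v \<in> V"
  then show "v \<in> tconv V"
    unfolding tconv_def
    by (intro CollectI exI[of _ 1] exI[of _ "\<lambda>_. 0"] exI[of _ "\<lambda>_. v"]) auto
qed

lemma tconv_subset_tspace: "V \<subseteq> tspace d \<Longrightarrow> tconv V \<subseteq> tspace d"
  using tconv_iff by blast

lemma tconv_mono: "V \<subseteq> W \<Longrightarrow> tconv V \<subseteq> tconv W"
  unfolding tconv_def by fast

lemma covers_trans:
  assumes "covers d W x i" "W \<subseteq> tconv V" "V \<subseteq> tspace d" "i \<le> d"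
  shows "covers d V x i"
proof -
  obtain w l where w: "w \<in> W" "l \<noteq> \<infinity>" "l + w i = x i" "\<And>k. k \<le> d \<Longrightarrow> l + w k \<le> x k"
    using assms(1) unfolding covers_def by blast
  have "covers d V w i" using w(1) assms tconv_iff by blast
  then obtain v l' where v: "v \<in> V" "l' \<noteq> \<infinity>" "l' + v i = w i" "\<And>k. k \<le> d \<Longrightarrow> l' + v k \<le> w k"
    unfolding covers_def by blast
  have "l + l' + v k \<le> x k" if "k \<le> d" for k
    using add_left_mono[OF v(4)[OF that], of l] w(4)[OF that] by (simp add: add.assoc)
  moreover have "l + l' \<noteq> \<infinity>" "l + l' + v i = x i" using v w by (simp_all add: add.assoc)
  ultimately show ?thesis unfolding covers_def using v(1) by blast
qed

lemma tconv_subset: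
  assumes "W \<subseteq> tconv V" "V \<subseteq> tspace d"
  shows "tconv W \<subseteq> tconv V"
proof
  fix x assume x: "x \<in> tconv W"
  have "W \<subseteq> tspace d" using assms tconv_subset_tspace by blast
  then have "x \<in> tspace d" "\<And>i. i \<le> d \<Longrightarrow> covers d W x i" using x tconv_iff by blast+
  then show "x \<in> tconv V" using covers_trans[OF _ assms] tconv_iff[OF assms(2)] by blast
qed

text \<open>If other points of the polytope combined to \<open>w\<close>, they could be expressed by
  the generators. At a finite coordinate \<open>w\<close> itself can occur there only with total
  coefficient 0; both factors are then 0 and the intermediate point equals \<open>w\<close>, which
  was excluded. So \<open>W - {w}\<close> would generate the same polytope.\<close>

lemma extreme_if_minimal:
  assumes W: "W \<subseteq> tspace d" "\<And>W'. W' \<subset> W \<Longrightarrow> tconv W' \<noteq> tconv W" and w: "w \<in> W"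
  shows "w \<notin> tconv (tconv W - {w})"
proof
  assume "w \<in> tconv (tconv W - {w})"
  have wt: "w \<in> tspace d" using W w by blast
  have sub: "tconv W - {w} \<subseteq> tspace d" using tconv_subset_tspace[OF W(1)] by blast
  have cov: "\<exists>u\<in>W. \<exists>l. l \<noteq> \<infinity> \<and> l + u i = w i \<and> (\<forall>k\<le>d. l + u k \<le> w k) \<and> (u = w \<longrightarrow> w i = -\<infinity>)"
    if i: "i \<le> d" for i
  proof -
    have "covers d (tconv W - {w}) w i"
      using \<open>w \<in> tconv (tconv W - {w})\<close> tconv_iff[OF sub] i by blast
    then obtain p l where p: "p \<in> tconv W" "p \<noteq> w" "l \<noteq> \<infinity>" "l + p i = w i" "\<And>k. k \<le> d \<Longrightarrow> l + p k \<le> w k"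
      unfolding covers_def by blast
    have pt: "p \<in> tspace d" using p(1) tconv_subset_tspace[OF W(1)] by blast
    have "covers d W p i" using p(1) tconv_iff[OF W(1)] i by blast
    then obtain u l' where u: "u \<in> W" "l' \<noteq> \<infinity>" "l' + u i = p i" "\<And>k. k \<le> d \<Longrightarrow> l' + u k \<le> p k"
      unfolding covers_def by blast
    have ut: "u \<in> tspace d" using u(1) W(1) by blast
    have le: "l + l' + u k \<le> w k" if "k \<le> d" for k
      using add_left_mono[OF u(4)[OF that], of l] p(5)[OF that] by (simp add: add.assoc)
    have eq: "l + l' + u i = w i" using u p by (simp add: add.assoc)
    have "w i = -\<infinity>" if "u = w"
    proof (rule ccontr)
      assume fin: "w i \<noteq> -\<infinity>"
      have "l \<le> 0" "l' \<le> 0"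
        using p(5)[of 0] u(4)[of 0] tspaceD(1)[OF pt] tspaceD(1)[OF ut] tspaceD(1)[OF wt] by simp_all
      moreover have "l + l' = 0"
        using eq that fin tspaceD(2)[OF wt, of i] p(3) u(2)
        by (cases "w i"; cases l; cases l') auto
      ultimately have "l = 0" "l' = 0" using p(3) u(2) by (cases l; cases l'; auto)+
      have "p k = w k" for k
      proof (cases "k \<le> d")
        case True
        then show ?thesis using p(5)[of k] u(4)[of k] \<open>l = 0\<close> \<open>l' = 0\<close> that by (simp add: antisym)
      next
        case False
        then show ?thesis using tspaceD(3)[OF pt] tspaceD(3)[OF wt] by simp
      qed
      then show False using p(2) by blast
    qed
    moreover have "l + l' \<noteq> \<infinity>" using p(3) u(2) by simp
    ultimately show ?thesis using u(1) le eq by blast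
  qed
  have W': "W - {w} \<subseteq> tspace d" using W(1) by blast
  \<comment> \<open>Coordinate 0 of \<open>w\<close> is finite, so its covering generator differs
    from \<open>w\<close>; with coefficient \<open>-\<infinity>\<close> that generator covers the
    coordinates where \<open>w\<close> is \<open>-\<infinity>\<close>.\<close>
  obtain u0 where u0: "u0 \<in> W" "u0 \<noteq> w" using cov[of 0] tspaceD(1)[OF wt] by auto
  have "covers d (W - {w}) w i" if i: "i \<le> d" for i
  proof (cases "w i = -\<infinity>")
    case True
    have "(-\<infinity>) + u0 k \<le> w k" for k using tspaceD(2)[of u0 d k] u0(1) W(1) by (cases "u0 k") auto
    moreover have "(-\<infinity>) + u0 i = w i" using True tspaceD(2)[of u0 d i] u0(1) W(1) by (cases "u0 i") auto
    ultimately show ?thesis unfolding covers_def using u0 by (intro bexI[of _ u0] exI[of _ "-\<infinity>"]) auto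
  next
    case False
    then obtain u l where "u \<in> W" "l \<noteq> \<infinity>" "l + u i = w i" "\<forall>k\<le>d. l + u k \<le> w k" "u \<noteq> w"
      using cov[OF i] by blast
    then show ?thesis unfolding covers_def by blast
  qed
  then have "w \<in> tconv (W - {w})" using tconv_iff[OF W'] wt by blast
  with subset_tconv[of "W - {w}"] have "W \<subseteq> tconv (W - {w})" by auto
  then have "tconv W \<subseteq> tconv (W - {w})" by (rule tconv_subset[OF _ W'])
  moreover have "tconv (W - {w}) \<subseteq> tconv W" by (rule tconv_mono) blast
  ultimately show False using W(2)[of "W - {w}"] w by blast
qed

text \<open>Extreme generators belong to every generating set, so a smallest generating subset of
  \<open>V\<close> is contained in every competitor \<open>U\<close>, and the minimality of
  \<open>U\<close> gives equality. This justifies the definite description in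
  \<open>vertices\<close>.\<close>

lemma vertices_tconv:
  assumes V: "finite V" "V \<subseteq> tspace d"
  shows "vertices (tconv V) \<subseteq> V" "tconv (vertices (tconv V)) = tconv V"
proof -
  obtain W where W: "W \<subseteq> V \<and> tconv W = tconv V"
    and least: "\<And>W'. W' \<subseteq> V \<and> tconv W' = tconv V \<Longrightarrow> card W \<le> card W'"
    using ex_has_least_nat[of "\<lambda>W. W \<subseteq> V \<and> tconv W = tconv V" V card] by blast
  have Wt: "W \<subseteq> tspace d" using W V by blast
  have min: "tconv W' \<noteq> tconv W" if "W' \<subset> W" for W'
  proof
    assume "tconv W' = tconv W"
    then have "card W \<le> card W'" using least[of W'] W that by blast
    moreover have "card W' < card W" using that W V finite_subset psubset_card_mono by blast
    ultimately show False by simp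
  qed
  have "vertices (tconv V) = W"
    unfolding vertices_def
  proof (rule the_equality)
    show "tconv W = tconv V \<and> (\<forall>W'. W' \<subset> W \<longrightarrow> tconv W' \<noteq> tconv V)"
      using W min by simp
    fix U assume U: "tconv U = tconv V \<and> (\<forall>W'. W' \<subset> U \<longrightarrow> tconv W' \<noteq> tconv V)"
    have "W \<subseteq> U"
    proof (rule ccontr)
      assume "\<not> W \<subseteq> U"
      then obtain w where w: "w \<in> W" "w \<notin> U" by blast
      have "U \<subseteq> tconv W - {w}" using subset_tconv[of U] U W w by auto
      then have "tconv U \<subseteq> tconv (tconv W - {w})" by (rule tconv_mono)
      moreover have "w \<in> tconv U" using subset_tconv[of W] U W w(1) by auto
      ultimately show False using extreme_if_minimal[OF Wt min w(1)] by blast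
    qed
    then show "U = W" using U W by blast
  qed
  then show "vertices (tconv V) \<subseteq> V" "tconv (vertices (tconv V)) = tconv V" using W by simp_all
qed

section \<open>Full-dimensional cells\<close>

interpretation fun_space: vector_space scale_fun
  by (rule vector_space_scale_fun)

definition unit_fun :: "nat \<Rightarrow> nat \<Rightarrow> real" where
  "unit_fun i = (\<lambda>j. if j = i then 1 else 0)"

lemma sum_fun_apply: "(\<Sum>a\<in>A. f a) x = (\<Sum>a\<in>A. (f a x :: real))"
  by (induction A rule: infinite_finite_induct) auto

lemma inj_unit_fun: "inj unit_fun"
  by (rule injI) (metis unit_fun_def zero_neq_one)

lemma independent_unit_fun: "finite I \<Longrightarrow> \<not> fun_space.dependent (unit_fun ` I)"
proof
  assume I: "finite I" and "fun_space.dependent (unit_fun ` I)"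
  then obtain u where u: "\<exists>v\<in>unit_fun ` I. u v \<noteq> 0" "(\<Sum>v\<in>unit_fun ` I. scale_fun (u v) v) = 0"
    using fun_space.dependent_finite[of "unit_fun ` I"] by auto
  have "u (unit_fun i) = 0" if "i \<in> I" for i
  proof -
    have "0 = (\<Sum>v\<in>unit_fun ` I. scale_fun (u v) v) i" using u(2) by simp
    also have "\<dots> = (\<Sum>k\<in>I. scale_fun (u (unit_fun k)) (unit_fun k) i)"
      by (simp add: sum_fun_apply sum.reindex inj_on_subset[OF inj_unit_fun])
    also have "\<dots> = (\<Sum>k\<in>I. if k = i then u (unit_fun k) else 0)"
      by (intro sum.cong) (auto simp: scale_fun_def unit_fun_def)
    also have "\<dots> = u (unit_fun i)" using that I by simp
    finally show ?thesis by simp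
  qed
  then show False using u(1) by blast
qed

lemma in_span_unit_fun:
  assumes "finite I" "\<And>i. i \<notin> I \<Longrightarrow> z i = 0"
  shows "z \<in> fun_space.span (unit_fun ` I)"
proof -
  have "z = (\<Sum>i\<in>I. scale_fun (z i) (unit_fun i))"
  proof
    fix j
    have "(\<Sum>i\<in>I. scale_fun (z i) (unit_fun i)) j = (\<Sum>i\<in>I. if i = j then z i else 0)"
      unfolding sum_fun_apply by (intro sum.cong) (auto simp: scale_fun_def unit_fun_def)
    also have "\<dots> = z j" using assms by auto
    finally show "z j = (\<Sum>i\<in>I. scale_fun (z i) (unit_fun i)) j" by simp
  qed
  moreover have "(\<Sum>i\<in>I. scale_fun (z i) (unit_fun i)) \<in> fun_space.span (unit_fun ` I)"
    by (intro fun_space.span_sum fun_space.span_scale fun_space.span_base) auto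
  ultimately show ?thesis by metis
qed

text \<open>All of \<open>D\<close> lies in the coordinate space of \<open>I\<close>, so full
  dimension means that the unit vectors are spanned.\<close>

lemma dim_eq_card_iff:
  assumes I: "finite I" and D: "\<And>z i. z \<in> D \<Longrightarrow> i \<notin> I \<Longrightarrow> z i = 0"
  shows "fun_space.dim D = card I \<longleftrightarrow> unit_fun ` I \<subseteq> fun_space.span D"
proof -
  let ?U = "unit_fun ` I"
  have card: "card ?U = card I" by (intro card_image inj_on_subset[OF inj_unit_fun]) simp
  have DU: "D \<subseteq> fun_space.span ?U" using in_span_unit_fun[OF I] D by blast
  show ?thesis
  proof
    assume dim: "fun_space.dim D = card I"
    obtain B where B: "B \<subseteq> D" "\<not> fun_space.dependent B" "D \<subseteq> fun_space.span B" "card B = fun_space.dim D"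
      using fun_space.basis_exists by blast
    have BU: "B \<subseteq> fun_space.span ?U" using B(1) DU by blast
    have "u \<in> fun_space.span D" if u: "u \<in> ?U" for u
    proof (rule ccontr)
      assume "u \<notin> fun_space.span D"
      then have uB: "u \<notin> fun_space.span B" using fun_space.span_mono[OF B(1)] by blast
      then have "\<not> fun_space.dependent (insert u B)" using B(2) by (rule fun_space.independent_insertI)
      moreover have "insert u B \<subseteq> fun_space.span ?U" using BU u fun_space.span_base by blast
      ultimately have "finite (insert u B) \<and> card (insert u B) \<le> card ?U"
        by (intro fun_space.independent_span_bound) (use I in simp_all)
      moreover have "u \<notin> B" using uB fun_space.span_base by blast
      ultimately show False using B(4) dim card card_insert_disjoint[of B u] by auto
    qed
    then show "?U \<subseteq> fun_space.span D" by blast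
  next
    assume "?U \<subseteq> fun_space.span D"
    then have "fun_space.span ?U = fun_space.span D"
      using DU by (simp add: fun_space.span_eq)
    then show "fun_space.dim D = card I"
      using fun_space.dim_eq_card[OF _ independent_unit_fun[OF I]] card by metis
  qed
qed

text \<open>An interior point in logarithmic coordinates. It has to be real, since a cell may
  consist entirely of points having a coordinate \<open>-\<infinity>\<close>.\<close>

definition strict_at :: "nat \<Rightarrow> (nat \<times> (nat \<Rightarrow> ereal)) set \<Rightarrow> (nat \<Rightarrow> real) \<Rightarrow> bool" where
  "strict_at d G Y \<longleftrightarrow> Y 0 = 0 \<and> (\<forall>(i, v)\<in>G. \<forall>k\<le>d. k \<noteq> i \<longrightarrow> v k + ereal (Y i) < v i + ereal (Y k))"

lemma strict_atI:
  assumes "Y 0 = 0" "\<And>i v k. (i, v) \<in> G \<Longrightarrow> k \<le> d \<Longrightarrow> k \<noteq> i \<Longrightarrow> v k + ereal (Y i) < v i + ereal (Y k)"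
  shows "strict_at d G Y"
  using assms by (auto simp: strict_at_def)

lemma strict_atD:
  assumes "strict_at d G Y"
  shows "Y 0 = 0" "(i, v) \<in> G \<Longrightarrow> k \<le> d \<Longrightarrow> k \<noteq> i \<Longrightarrow> v k + ereal (Y i) < v i + ereal (Y k)"
  using assms by (auto simp: strict_at_def)

definition real_point :: "nat \<Rightarrow> (nat \<Rightarrow> real) \<Rightarrow> nat \<Rightarrow> ereal" where
  "real_point d Y = (\<lambda>i. if i \<in> {1..d} then ereal (Y i) else 0)"

lemma real_point_tspace: "real_point d Y \<in> tspace d"
  by (auto simp: real_point_def tspace_def)

lemma real_point_nth: "Y 0 = 0 \<Longrightarrow> i \<le> d \<Longrightarrow> real_point d Y i = ereal (Y i)"
  by (cases "i = 0") (auto simp: real_point_def zero_ereal_def)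

text \<open>Turns the cell inequality \<open>v k + x i \<le> v i + x k\<close> into a linear one in
  the exponentiated coordinates, with coefficients \<open>bpow b (v k)\<close> and
  \<open>bpow b (v i)\<close>.\<close>

definition bpow :: "real \<Rightarrow> ereal \<Rightarrow> real" where
  "bpow b r = (if r = -\<infinity> then 0 else b powr real_of_ereal r)"

lemma expo_eq_bpow: "expo b x i = bpow b (x i)"
  by (simp add: expo_def bpow_def)

lemma bpow_simps:
  assumes "1 < b"
  shows "bpow b 0 = 1" "0 \<le> bpow b r" "bpow b r = 0 \<longleftrightarrow> r = -\<infinity>" "bpow b (ereal t) = b powr t"
  using assms by (auto simp: bpow_def)

lemma bpow_add: "1 < b \<Longrightarrow> r \<noteq> \<infinity> \<Longrightarrow> s \<noteq> \<infinity> \<Longrightarrow> bpow b (r + s) = bpow b r * bpow b s"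
  by (cases r; cases s) (auto simp: bpow_def powr_add)

lemma bpow_le_iff: "1 < b \<Longrightarrow> r \<noteq> \<infinity> \<Longrightarrow> s \<noteq> \<infinity> \<Longrightarrow> bpow b r \<le> bpow b s \<longleftrightarrow> r \<le> s"
  by (cases r; cases s) (auto simp: bpow_def not_le)

lemma cell_ineq:
  assumes "x \<in> cell d G" "(i, v) \<in> G" "k \<le> d"
  shows "v k + x i \<le> v i + x k"
  using assms unfolding cell_def by auto

lemma real_point_in_cell:
  assumes "Y 0 = 0" "\<And>i v k. (i, v) \<in> G \<Longrightarrow> k \<le> d \<Longrightarrow> v k + ereal (Y i) \<le> v i + ereal (Y k)"
    and "fst ` G \<subseteq> {0..d}"
  shows "real_point d Y \<in> cell d G"
  unfolding cell_def
proof (intro CollectI conjI real_point_tspace ballI, clarify)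
  fix i v k assume *: "(i, v) \<in> G" "k \<in> {0..d}"
  then have "i \<le> d" using assms(3) by force
  then show "v k + real_point d Y i \<le> v i + real_point d Y k"
    using assms * by (simp add: real_point_nth)
qed

lemma strict_at_in_cell:
  assumes "strict_at d G Y" "fst ` G \<subseteq> {0..d}"
  shows "real_point d Y \<in> cell d G"
proof (rule real_point_in_cell)
  show "Y 0 = 0" using assms(1) by (simp add: strict_at_def)
  fix i v k assume "(i, v) \<in> G" "k \<le> d"
  then show "v k + ereal (Y i) \<le> v i + ereal (Y k)"
    using assms(1) unfolding strict_at_def by (cases "k = i") force+
qed (fact assms(2))

text \<open>The direction \<open>h\<close> decides the ties at \<open>X\<close>. This serves both to
  enter a cell from its greatest point and to move an interior point along an axis.\<close>

lemma eventually_strict_at: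
  assumes G: "finite G" and h: "h 0 = 0" and X: "X 0 = 0"
    and *: "\<And>i v k. (i, v) \<in> G \<Longrightarrow> k \<le> d \<Longrightarrow> k \<noteq> i \<Longrightarrow> \<bar>v i\<bar> \<noteq> \<infinity> \<and> v k \<noteq> \<infinity> \<and>
      (v k + ereal (X i) < v i + ereal (X k) \<or> v k + ereal (X i) = v i + ereal (X k) \<and> h i < h k)"
  shows "\<forall>\<^sub>F t in at_right 0. strict_at d G (\<lambda>i. X i + t * h i)"
proof -
  have "\<forall>\<^sub>F t in at_right 0. v k + ereal (X i + t * h i) < v i + ereal (X k + t * h k)"
    if iv: "(i, v) \<in> G" "k \<le> d" "k \<noteq> i" for i v k
  proof -
    obtain \<beta> where \<beta>: "v i = ereal \<beta>" using *[OF iv] by (cases "v i") auto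
    show ?thesis
    proof (cases "v k")
      case (real \<gamma>)
      have "\<forall>\<^sub>F t in at_right 0. (\<gamma> + X i) + t * h i < (\<beta> + X k) + t * h k"
        by (rule eventually_affine_less) (use *[OF iv] real \<beta> in auto)
      then show ?thesis by (simp add: real \<beta> add.assoc)
    qed (use *[OF iv] \<beta> in auto)
  qed
  then have "\<forall>\<^sub>F t in at_right 0. \<forall>p\<in>G. \<forall>k\<in>{0..d} - {fst p}.
      snd p k + ereal (X (fst p) + t * h (fst p)) < snd p (fst p) + ereal (X k + t * h k)"
    using G by (intro eventually_ball_finite ballI) auto
  then show ?thesis
  proof eventually_elim
    case (elim t)
    then show ?case using h X by (force simp: strict_at_def)
  qed
qed

text \<open>In exponentiated coordinates the cell is cut out by linear inequalities. If one of them
  were an equality on the whole image, its linear form would vanish on all differences and hence on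
  the unit vectors. So each is strict somewhere, and the average of the witnesses makes all of them
  strict. Conversely a strict point can be moved along each axis.\<close>

lemma affine_dim_cell_iff:
  assumes b: "1 < b" and G: "finite G" "fst ` G \<subseteq> {0..d}" "snd ` G \<subseteq> tspace d"
    and ne: "cell d G \<noteq> {}"
  shows "affine_dim (expo b ` cell d G) = d \<longleftrightarrow> (\<exists>Y. strict_at d G Y)"
proof -
  define E where "E = expo b ` cell d G"
  define D where "D = {x - y | x y. x \<in> E \<and> y \<in> E}"
  have vts: "v \<in> tspace d" "i \<le> d" if "(i, v) \<in> G" for i v
    using G that by force+
  have vv: "v 0 = 0" "v k \<noteq> \<infinity>" if "(i, v) \<in> G" for i v k
    using tspaceD[OF vts(1)[OF that]] by auto
  have E_ts: "\<exists>x\<in>tspace d. e = expo b x" if "e \<in> E" for e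
    using that unfolding E_def cell_def by blast
  have E0: "e i = 1" if "e \<in> E" "i \<notin> {1..d}" for e i
    using E_ts[OF that(1)] that(2) b by (auto simp: expo_eq_bpow tspace_def bpow_simps)
  have Enn: "0 \<le> e i" if "e \<in> E" for e i
    using E_ts[OF that] b by (auto simp: expo_eq_bpow bpow_simps)
  have Eineq: "bpow b (v k) * e i \<le> bpow b (v i) * e k" if e: "e \<in> E" and iv: "(i, v) \<in> G" "k \<le> d" for e i v k
  proof -
    obtain x where x: "x \<in> cell d G" "e = expo b x" using e unfolding E_def by blast
    then have xt: "x \<in> tspace d" by (simp add: cell_def)
    have "v k + x i \<le> v i + x k" using cell_ineq[OF x(1) iv] .
    then have "bpow b (v k + x i) \<le> bpow b (v i + x k)"
      using bpow_le_iff[OF b] vv(2)[OF iv(1)] tspaceD(2)[OF xt] by simp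
    then show ?thesis using bpow_add[OF b] vv(2)[OF iv(1)] tspaceD(2)[OF xt] x(2) by (simp add: expo_eq_bpow)
  qed
  have D0: "z i = 0" if "z \<in> D" "i \<notin> {1..d}" for z i
  proof -
    obtain x y where "z = x - y" "x \<in> E" "y \<in> E" using \<open>z \<in> D\<close> unfolding D_def by blast
    then show ?thesis using E0[of x i] E0[of y i] \<open>i \<notin> {1..d}\<close> by simp
  qed
  have "affine_dim E = d \<longleftrightarrow> unit_fun ` {1..d} \<subseteq> fun_space.span D"
    using dim_eq_card_iff[of "{1..d}" D] D0 by (simp add: affine_dim_def D_def)
  also have "\<dots> \<longleftrightarrow> (\<exists>Y. strict_at d G Y)"
  proof
    assume span: "unit_fun ` {1..d} \<subseteq> fun_space.span D"
    have lin: "f (unit_fun l) = 0"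
      if "\<And>z. z \<in> D \<Longrightarrow> f z = 0" "l \<in> {1..d}" "\<And>x y. f (x + y) = f x + f y" "\<And>c x. f (scale_fun c x) = c * f x"
      for f :: "(nat \<Rightarrow> real) \<Rightarrow> real" and l
    proof -
      have "unit_fun l \<in> fun_space.span D" using span that(2) by blast
      then show ?thesis
      proof (induction rule: fun_space.span_induct_alt)
        case base
        show ?case using that(4)[of 0 0] by (simp add: scale_fun_def)
      next
        case (step c x y)
        show ?case unfolding that(3,4) using step that(1)[of x] by simp
      qed
    qed
    have pos: "\<exists>e\<in>E. 0 < e l" if l: "l \<in> {1..d}" for l
    proof (rule ccontr)
      assume "\<not> ?thesis"
      then have z: "e l = 0" if "e \<in> E" for e using Enn[OF that, of l] that by (metis le_less)
      have "z l = 0" if "z \<in> D" for z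
      proof -
        obtain x y where "z = x - y" "x \<in> E" "y \<in> E" using \<open>z \<in> D\<close> unfolding D_def by blast
        then show ?thesis using z[of x] z[of y] by simp
      qed
      then have "unit_fun l l = 0"
        using lin[of "\<lambda>z. z l" l] l by (simp add: scale_fun_def)
      then show False by (simp add: unit_fun_def)
    qed
    have strict: "\<exists>e\<in>E. bpow b (v k) * e i < bpow b (v i) * e k" if iv: "(i, v) \<in> G" "k \<le> d" "k \<noteq> i" for i v k
    proof (rule ccontr)
      let ?\<alpha> = "bpow b (v k)" and ?\<beta> = "bpow b (v i)"
      assume "\<not> ?thesis"
      then have eq: "?\<alpha> * e i = ?\<beta> * e k" if "e \<in> E" for e
        using Eineq[OF that iv(1,2)] that by (metis le_less)
      have "?\<alpha> * z i - ?\<beta> * z k = 0" if "z \<in> D" for z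
      proof -
        obtain x y where "z = x - y" "x \<in> E" "y \<in> E" using \<open>z \<in> D\<close> unfolding D_def by blast
        then show ?thesis using eq[of x] eq[of y] by (simp add: right_diff_distrib)
      qed
      then have f: "?\<alpha> * unit_fun l i - ?\<beta> * unit_fun l k = 0" if "l \<in> {1..d}" for l
        using lin[of "\<lambda>z. ?\<alpha> * z i - ?\<beta> * z k" l] that by (simp add: scale_fun_def algebra_simps)
      have i: "i \<le> d" using vts(2)[OF iv(1)] .
      have 0: "?\<alpha> = 0" if "i \<noteq> 0" using f[of i] that i iv(3) by (simp add: unit_fun_def)
      have 1: "?\<beta> = 0" if "k \<noteq> 0" using f[of k] that iv by (simp add: unit_fun_def)
      have "i \<noteq> 0"
      proof
        assume "i = 0"
        then show False using 1 vv(1)[OF iv(1)] bpow_simps(1)[OF b] iv(3) by simp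
      qed
      then have "k \<noteq> 0" using 0 vv(1)[OF iv(1)] bpow_simps(1)[OF b] by (cases "k = 0") auto
      \<comment> \<open>Both coefficients may vanish, as \<open>bpow\<close> sends
        \<open>-\<infinity>\<close> to 0. The inequality against coordinate 0 then forces coordinate
        \<open>i\<close> to be 0 on the whole image, contrary to \<open>pos\<close>.\<close>
      then have "?\<beta> = 0" by (rule 1)
      obtain e where e: "e \<in> E" "0 < e i" using pos[of i] \<open>i \<noteq> 0\<close> i by auto
      then show False
        using Eineq[OF e(1) iv(1), of 0] vv(1)[OF iv(1)] bpow_simps(1)[OF b] \<open>?\<beta> = 0\<close> by simp
    qed
    define S where "S = (SIGMA p:G. {0..d} - {fst p})"
    obtain e0 where e0: "e0 \<in> E" using ne unfolding E_def by blast
    have "\<forall>s\<in>S. \<exists>e. e \<in> E \<and> bpow b (snd (fst s) (snd s)) * e (fst (fst s)) < bpow b (snd (fst s) (fst (fst s))) * e (snd s)"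
    proof
      fix s assume "s \<in> S"
      moreover obtain i v k where s: "s = ((i, v), k)" by (metis surj_pair)
      ultimately have "(i, v) \<in> G" "k \<le> d" "k \<noteq> i" by (simp_all add: S_def)
      then obtain e where "e \<in> E" "bpow b (v k) * e i < bpow b (v i) * e k" using strict by blast
      then show "\<exists>e. e \<in> E \<and> bpow b (snd (fst s) (snd s)) * e (fst (fst s)) < bpow b (snd (fst s) (fst (fst s))) * e (snd s)"
        using s by auto
    qed
    then obtain es where es: "\<And>s. s \<in> S \<Longrightarrow> es s \<in> E \<and>
        bpow b (snd (fst s) (snd s)) * es s (fst (fst s)) < bpow b (snd (fst s) (fst (fst s))) * es s (snd s)"
      by metis
    have "\<forall>l\<in>{1..d}. \<exists>e. e \<in> E \<and> 0 < e l" using pos by blast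
    then obtain el where el: "\<And>l. l \<in> {1..d} \<Longrightarrow> el l \<in> E \<and> 0 < el l l" by metis
    define Q where "Q = insert e0 (es ` S \<union> el ` {1..d})"
    have Q: "finite Q" "Q \<subseteq> E" using G(1) es el e0 by (auto simp: Q_def S_def)
    \<comment> \<open>Up to the factor \<open>m 0\<close>, which counts the witnesses because their
      coordinate 0 is 1, this is their average.\<close>
    define m where "m i = (\<Sum>e\<in>Q. e i)" for i
    have m_pos: "0 < m i" for i
    proof -
      have "\<exists>e\<in>Q. 0 < e i"
      proof (cases "i \<in> {1..d}")
        case True
        then show ?thesis using el[OF True] by (intro bexI[of _ "el i"]) (simp_all add: Q_def)
      next
        case False
        then show ?thesis using E0[OF e0 False] by (intro bexI[of _ e0]) (simp_all add: Q_def)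
      qed
      then obtain e where e: "e \<in> Q" "0 < e i" by blast
      show ?thesis
        unfolding m_def by (rule sum_pos2[of Q e "\<lambda>e. e i"]) (use Q e Enn in \<open>blast+\<close>)
    qed
    have m_strict: "bpow b (v k) * m i < bpow b (v i) * m k" if iv: "(i, v) \<in> G" "k \<le> d" "k \<noteq> i" for i v k
    proof -
      have "((i, v), k) \<in> S" using iv by (simp add: S_def)
      then have e: "es ((i, v), k) \<in> Q"
        "bpow b (v k) * es ((i, v), k) i < bpow b (v i) * es ((i, v), k) k"
        using es[of "((i, v), k)"] by (simp_all add: Q_def)
      show ?thesis
        unfolding m_def sum_distrib_left
      proof (rule sum_strict_mono_ex1[OF Q(1)])
        show "\<forall>e\<in>Q. bpow b (v k) * e i \<le> bpow b (v i) * e k"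
          using Eineq[OF _ iv(1,2)] Q(2) by blast
        show "\<exists>e\<in>Q. bpow b (v k) * e i < bpow b (v i) * e k" using e by blast
      qed
    qed
    define Y where "Y i = log b (m i / m 0)" for i
    have exY: "bpow b (ereal (Y i)) = m i / m 0" for i
      using b m_pos by (simp add: bpow_simps Y_def)
    have "strict_at d G Y"
    proof (rule strict_atI)
      show "Y 0 = 0" using m_pos[of 0] by (simp add: Y_def)
      fix i v k assume iv: "(i, v) \<in> G" "k \<le> d" "k \<noteq> i"
      have "bpow b (v k) * (m i / m 0) < bpow b (v i) * (m k / m 0)"
        using m_strict[OF iv] m_pos[of 0] by (simp add: divide_strict_right_mono)
      then have "bpow b (v k + ereal (Y i)) < bpow b (v i + ereal (Y k))"
        using bpow_add[OF b] vv(2)[OF iv(1)] by (simp add: exY)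
      then show "v k + ereal (Y i) < v i + ereal (Y k)"
        using bpow_le_iff[OF b, of "v i + ereal (Y k)" "v k + ereal (Y i)"] vv(2)[OF iv(1)]
        by (auto simp: not_le[symmetric])
    qed
    then show "\<exists>Y. strict_at d G Y" by blast
  next
    assume "\<exists>Y. strict_at d G Y"
    then obtain Y where Y: "strict_at d G Y" by blast
    have Y0: "Y 0 = 0" using Y by (simp add: strict_at_def)
    have "unit_fun l \<in> fun_space.span D" if l: "l \<in> {1..d}" for l
    proof -
      have ev: "\<forall>\<^sub>F t in at_right 0. strict_at d G (\<lambda>i. Y i + t * unit_fun l i)"
      proof (rule eventually_strict_at[OF G(1)])
        show "unit_fun l 0 = 0" using l by (simp add: unit_fun_def)
        fix i v k assume iv: "(i, v) \<in> G" "k \<le> d" "k \<noteq> i"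
        have "v k + ereal (Y i) < v i + ereal (Y k)" using strict_atD(2)[OF Y iv] .
        moreover from this have "v i \<noteq> -\<infinity>" by auto
        ultimately show "\<bar>v i\<bar> \<noteq> \<infinity> \<and> v k \<noteq> \<infinity> \<and> (v k + ereal (Y i) < v i + ereal (Y k) \<or>
            v k + ereal (Y i) = v i + ereal (Y k) \<and> unit_fun l i < unit_fun l k)"
          using vv(2)[OF iv(1), of i] vv(2)[OF iv(1), of k] by (cases "v i") simp_all
      qed (fact Y0)
      have "\<forall>\<^sub>F t in at_right 0. strict_at d G (\<lambda>i. Y i + t * unit_fun l i) \<and> 0 < t"
        using ev eventually_at_right_less[of "0::real"] by (rule eventually_conj)
      then obtain t where t: "strict_at d G (\<lambda>i. Y i + t * unit_fun l i)" "0 < (t::real)"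
        using eventually_happens'[OF trivial_limit_at_right_real] by blast
      define z where "z = expo b (real_point d (\<lambda>i. Y i + t * unit_fun l i)) - expo b (real_point d Y)"
      have "z \<in> D"
        using strict_at_in_cell[OF Y G(2)] strict_at_in_cell[OF t(1) G(2)]
        unfolding D_def E_def z_def by blast
      define c where "c = b powr (Y l + t) - b powr Y l"
      have "c \<noteq> 0" using b t(2) by (simp add: c_def powr_inj)
      have "z = scale_fun c (unit_fun l)"
        using l b by (auto simp: z_def fun_eq_iff expo_eq_bpow real_point_def bpow_simps scale_fun_def unit_fun_def c_def)
      then have "unit_fun l = scale_fun (1 / c) z"
        using \<open>c \<noteq> 0\<close> by (simp add: scale_fun_def fun_eq_iff)
      then show ?thesis using \<open>z \<in> D\<close> fun_space.span_scale fun_space.span_base by metis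
    qed
    then show "unit_fun ` {1..d} \<subseteq> fun_space.span D" by blast
  qed
  finally show ?thesis by (simp add: E_def)
qed

section \<open>The trunk of a simplex\<close>

lemma strict_at_finite:
  assumes "strict_at d G Y" "(i, v) \<in> G" "i \<le> d" "v \<in> tspace d"
  shows "\<bar>v i\<bar> \<noteq> \<infinity>"
proof -
  have "v i \<noteq> -\<infinity>"
  proof (cases "d = 0")
    case True
    then show ?thesis using assms(3) tspaceD(1)[OF assms(4)] by simp
  next
    case False
    define k where "k = (if i = 0 then 1 else 0 :: nat)"
    have "k \<le> d" "k \<noteq> i" using False by (auto simp: k_def)
    then show ?thesis using strict_atD(2)[OF assms(1,2)] by force
  qed
  then show ?thesis using tspaceD(2)[OF assms(4), of i] by (cases "v i") simp_all
qed

lemma strict_at_le: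
  assumes "strict_at d G Y" "(i, v) \<in> G" "k \<le> d"
  shows "v k + ereal (Y i) \<le> v i + ereal (Y k)"
  using strict_atD(2)[OF assms(1,2,3)] by (cases "k = i") simp_all

lemma strict_at_unique:
  assumes "strict_at d G Y" "(i, v) \<in> G" "(k, v) \<in> G" "i \<le> d" "k \<le> d"
  shows "i = k"
proof (rule ccontr)
  assume "i \<noteq> k"
  then have "v k + ereal (Y i) < v i + ereal (Y k)" "v i + ereal (Y k) < v k + ereal (Y i)"
    using strict_atD(2)[OF assms(1,2,5)] strict_atD(2)[OF assms(1,3,4)] by auto
  then show False by simp
qed

text \<open>A multiple of an attached vertex lying below a strict point can touch it only in the
  coordinate of attachment; this tells which vertices cover which coordinates.\<close>

lemma strict_at_covers:
  assumes "strict_at d G Y" "(i, v) \<in> G" "i \<le> d" "k \<le> d" "v \<in> tspace d"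
    and "l + v k = ereal (Y k)" "l + v i \<le> ereal (Y i)"
  shows "k = i"
proof (rule ccontr)
  assume "k \<noteq> i"
  then have "v k + ereal (Y i) < v i + ereal (Y k)" using strict_atD(2)[OF assms(1,2,4)] by simp
  then show False
    using assms(6,7) strict_at_finite[OF assms(1,2,3,5)] by (cases l; cases "v k"; cases "v i") auto
qed

lemma real_point_in_tconv:
  assumes "strict_at d G Y" "\<And>i. i \<le> d \<Longrightarrow> \<exists>v\<in>V. (i, v) \<in> G" "V \<subseteq> tspace d"
  shows "real_point d Y \<in> tconv V"
proof -
  have "covers d V (real_point d Y) i" if i: "i \<le> d" for i
  proof -
    obtain v where v: "v \<in> V" "(i, v) \<in> G" using assms(2)[OF i] by blast
    obtain \<beta> where \<beta>: "v i = ereal \<beta>"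
      using strict_at_finite[OF assms(1) v(2) i] v(1) assms(3) by (cases "v i") auto
    have "ereal (Y i - \<beta>) + v k \<le> ereal (Y k)" if "k \<le> d" for k
      using strict_at_le[OF assms(1) v(2) that] \<beta> by (cases "v k") auto
    then show ?thesis
      unfolding covers_def using v(1) i \<beta> strict_atD(1)[OF assms(1)]
      by (intro bexI[of _ v] exI[of _ "ereal (Y i - \<beta>)"]) (simp_all add: real_point_nth)
  qed
  then show ?thesis using tconv_iff[OF assms(3)] real_point_tspace by blast
qed

text \<open>A strict point replaces the dimension, and it makes the finiteness requirement on
  attached vertices automatic.\<close>

lemma trunk_iff:
  assumes b: "1 < b" and V: "finite V" "V \<subseteq> tspace d"
  shows "x \<in> trunk b d (tconv V) \<longleftrightarrow> (\<exists>G \<subseteq> {0..d} \<times> vertices (tconv V).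
    (\<forall>i\<le>d. \<exists>v. (i, v) \<in> G) \<and> (\<forall>v\<in>vertices (tconv V). \<exists>i. (i, v) \<in> G) \<and>
    (\<exists>Y. strict_at d G Y) \<and> x \<in> cell d G)"
proof -
  let ?V = "vertices (tconv V)"
  have VV: "finite ?V" "?V \<subseteq> tspace d"
    using vertices_tconv(1)[OF V] V finite_subset by blast+
  have dim: "affine_dim (expo b ` cell d G) = d \<longleftrightarrow> (\<exists>Y. strict_at d G Y)"
    if "G \<subseteq> {0..d} \<times> ?V" "cell d G \<noteq> {}" for G
  proof (rule affine_dim_cell_iff[OF b _ _ _ that(2)])
    show "finite G" by (rule finite_subset[OF that(1)]) (use VV(1) in simp)
    show "fst ` G \<subseteq> {0..d}" "snd ` G \<subseteq> tspace d" using that(1) VV(2) by auto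
  qed
  have fin: "v i \<noteq> -\<infinity>" if "G \<subseteq> {0..d} \<times> ?V" "strict_at d G Y" "(i, v) \<in> G" for G Y i v
  proof -
    have "i \<le> d" "v \<in> tspace d" using that(1,3) VV(2) by auto
    then show ?thesis using strict_at_finite[OF that(2,3)] by auto
  qed
  show ?thesis
  proof
    assume "x \<in> trunk b d (tconv V)"
    then obtain G where G: "x \<in> cell d G" "affine_dim (expo b ` cell d G) = d" "G \<subseteq> {0..d} \<times> ?V"
      "cell d G \<noteq> {}" "\<forall>i\<in>{0..d}. \<exists>v. (i, v) \<in> G" "\<forall>v\<in>?V. \<exists>i. (i, v) \<in> G \<and> v i \<noteq> -\<infinity>"
      unfolding trunk_def covector_cells_def by blast
    then have "\<exists>Y. strict_at d G Y" using dim by blast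
    with G show "\<exists>G \<subseteq> {0..d} \<times> ?V. (\<forall>i\<le>d. \<exists>v. (i, v) \<in> G) \<and> (\<forall>v\<in>?V. \<exists>i. (i, v) \<in> G) \<and>
      (\<exists>Y. strict_at d G Y) \<and> x \<in> cell d G"
      by (intro exI[of _ G]) auto
  next
    assume "\<exists>G \<subseteq> {0..d} \<times> ?V. (\<forall>i\<le>d. \<exists>v. (i, v) \<in> G) \<and> (\<forall>v\<in>?V. \<exists>i. (i, v) \<in> G) \<and>
      (\<exists>Y. strict_at d G Y) \<and> x \<in> cell d G"
    then obtain G Y where G: "G \<subseteq> {0..d} \<times> ?V" "\<forall>i\<le>d. \<exists>v. (i, v) \<in> G" "\<forall>v\<in>?V. \<exists>i. (i, v) \<in> G"
      "strict_at d G Y" "x \<in> cell d G" by blast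
    have "cell d G \<noteq> {}" using G(5) by blast
    moreover have "\<forall>v\<in>?V. \<exists>i. (i, v) \<in> G \<and> v i \<noteq> -\<infinity>" using G(3) fin[OF G(1,4)] by blast
    ultimately have "cell d G \<in> covector_cells d (tconv V)"
      unfolding covector_cells_def using G(1,2) by auto
    moreover have "affine_dim (expo b ` cell d G) = d" using dim[OF G(1)] G(4) \<open>cell d G \<noteq> {}\<close> by blast
    ultimately show "x \<in> trunk b d (tconv V)" unfolding trunk_def using G(5) by blast
  qed
qed

lemma exists_least:
  fixes f :: "'a \<Rightarrow> 'b :: linorder"
  assumes "finite A" "A \<noteq> {}"
  shows "\<exists>a\<in>A. \<forall>k\<in>A. f a \<le> f k"
proof (intro bexI ballI)
  show "arg_min_on f A \<in> A" using arg_min_if_finite(1)[OF assms] .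
  show "f (arg_min_on f A) \<le> f k" if "k \<in> A" for k using arg_min_least[OF assms that] .
qed

text \<open>The real points in the cell of these pairs are the normalized potentials of
  \<open>\<sigma>\<close> for the matrix with columns \<open>c q\<close>.\<close>

definition matched_pairs ::
  "nat \<Rightarrow> (nat \<Rightarrow> nat \<Rightarrow> ereal) \<Rightarrow> (nat \<Rightarrow> nat) \<Rightarrow> (nat \<times> (nat \<Rightarrow> ereal)) set" where
  "matched_pairs d c \<sigma> = (\<lambda>i. (i, c (\<sigma> i))) ` {..d}"

context
  fixes d :: nat and c :: "nat \<Rightarrow> nat \<Rightarrow> ereal" and B :: "nat \<Rightarrow> nat \<Rightarrow> ereal"
  assumes c: "\<And>q. q \<le> d \<Longrightarrow> c q \<in> tspace d" and cB: "\<And>i q. i \<le> d \<Longrightarrow> q \<le> d \<Longrightarrow> c q i = B i q"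
begin

lemma entry_ne_PInf: "i < Suc d \<Longrightarrow> q < Suc d \<Longrightarrow> B i q \<noteq> \<infinity>"
  using tspaceD(2)[OF c, of q i] cB[of i q] by simp

lemma perm_bound: "\<sigma> permutes {..<Suc d} \<Longrightarrow> i \<le> d \<Longrightarrow> \<sigma> i \<le> d"
  using permutes_in_image[of \<sigma> "{..<Suc d}" i] by simp

lemma matched_pairs_subset: "\<sigma> permutes {..<Suc d} \<Longrightarrow> matched_pairs d c \<sigma> \<subseteq> {0..d} \<times> c ` {..d}"
  using perm_bound by (auto simp: matched_pairs_def)

lemma strict_at_matched_pairs:
  assumes "\<sigma> permutes {..<Suc d}"
  shows "strict_at d (matched_pairs d c \<sigma>) Y \<longleftrightarrow>
    Y 0 = 0 \<and> (\<forall>i\<le>d. \<forall>k\<le>d. k \<noteq> i \<longrightarrow> strict_edge B \<sigma> Y i k)"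
  using perm_bound[OF assms] unfolding strict_at_def matched_pairs_def strict_edge_def
  by (auto simp: cB)

text \<open>At a strict point the graph of tight inequalities has no arcs between different
  rows.\<close>

lemma strict_potential:
  assumes \<sigma>: "\<sigma> permutes {..<Suc d}" and Y: "strict_at d (matched_pairs d c \<sigma>) Y"
  shows "potential (Suc d) B \<sigma> Y" "acyclic_potential (Suc d) B \<sigma> Y"
proof -
  have in_G: "(i, c (\<sigma> i)) \<in> matched_pairs d c \<sigma>" if "i \<le> d" for i
    using that by (auto simp: matched_pairs_def)
  show "potential (Suc d) B \<sigma> Y"
    unfolding potential_def
  proof (intro conjI allI impI)
    fix i assume "i < Suc d"
    then have i: "i \<le> d" by simp
    show "\<bar>B i (\<sigma> i)\<bar> \<noteq> \<infinity>"
      using strict_at_finite[OF Y in_G[OF i] i] c cB perm_bound[OF \<sigma> i] i by simp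
    fix k assume "k < Suc d"
    then show "B k (\<sigma> i) + ereal (Y i) \<le> B i (\<sigma> i) + ereal (Y k)"
      using strict_at_le[OF Y in_G[OF i], of k] cB perm_bound[OF \<sigma> i] i by simp
  qed
  show "acyclic_potential (Suc d) B \<sigma> Y"
    unfolding acyclic_potential_def
  proof (intro allI impI)
    fix V :: "nat set" assume V: "V \<subseteq> {..<Suc d}" "V \<noteq> {}"
    then obtain i where i: "i \<in> V" by blast
    have "strict_edge B \<sigma> Y i k" if "k \<in> V" "k \<noteq> i" for k
    proof -
      have "i \<le> d" "k \<le> d" using i that(1) V(1) by auto
      then show ?thesis using Y that(2) by (simp add: strict_at_matched_pairs[OF \<sigma>])
    qed
    then show "\<exists>i\<in>V. \<forall>k\<in>V. k \<noteq> i \<longrightarrow> strict_edge B \<sigma> Y i k" using i by blast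
  qed
qed

lemma strict_unique_optimum:
  assumes "\<sigma> permutes {..<Suc d}" "strict_at d (matched_pairs d c \<sigma>) Y"
  shows "unique_optimum (Suc d) B"
  using unique_optimum_iff[of "Suc d" B, OF entry_ne_PInf assms(1) strict_potential(1)[OF assms]]
    strict_potential(2)[OF assms] by simp

text \<open>A point of the cell with a coordinate \<open>-\<infinity>\<close> is no potential. Its
  maximum with \<open>X\<close> is real, and the cell inequalities are closed under maxima.\<close>

lemma cell_matched_pairs_le:
  assumes \<sigma>: "\<sigma> permutes {..<Suc d}" and X: "greatest_potential (Suc d) B \<sigma> X"
    and x: "x \<in> cell d (matched_pairs d c \<sigma>)"
  shows "x \<le> real_point d X"
proof -
  have xt: "x \<in> tspace d" using x by (simp add: cell_def)
  have pot: "potential (Suc d) B \<sigma> X" and X0: "X 0 = 0" using X by (simp_all add: greatest_potential_def)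
  define Z where "Z i = real_of_ereal (max (x i) (ereal (X i)))" for i
  have Z: "ereal (Z i) = max (x i) (ereal (X i))" for i
    using tspaceD(2)[OF xt, of i] by (cases "x i") (auto simp: Z_def max_def)
  have "potential (Suc d) B \<sigma> Z"
    unfolding potential_def
  proof (intro conjI allI impI)
    fix i assume "i < Suc d"
    then have i: "i \<le> d" by simp
    show "\<bar>B i (\<sigma> i)\<bar> \<noteq> \<infinity>" using pot i by (simp add: potential_def)
    fix k assume "k < Suc d"
    then have k: "k \<le> d" by simp
    have "(i, c (\<sigma> i)) \<in> matched_pairs d c \<sigma>" using i by (auto simp: matched_pairs_def)
    from cell_ineq[OF x this k] have 1: "B k (\<sigma> i) + x i \<le> B i (\<sigma> i) + x k"
      using cB perm_bound[OF \<sigma> i] i k by simp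
    have 2: "B k (\<sigma> i) + ereal (X i) \<le> B i (\<sigma> i) + ereal (X k)"
      using potentialD[OF pot] i k by simp
    have "B k (\<sigma> i) + ereal (Z i) \<le> max (B k (\<sigma> i) + x i) (B k (\<sigma> i) + ereal (X i))"
      unfolding Z by (cases "x i \<le> ereal (X i)") (simp_all add: max_absorb1 max_absorb2)
    also have "\<dots> \<le> B i (\<sigma> i) + ereal (Z k)"
      unfolding Z using 1 2 by (meson add_left_mono max.bounded_iff max.cobounded1 max.cobounded2 order_trans)
    finally show "B k (\<sigma> i) + ereal (Z i) \<le> B i (\<sigma> i) + ereal (Z k)" .
  qed
  moreover have "Z 0 = 0" using tspaceD(1)[OF xt] X0 by (simp add: Z_def max_def zero_ereal_def)
  ultimately have "Z i \<le> X i" if "i \<le> d" for i using X that by (simp add: greatest_potential_def)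
  then have "x i \<le> ereal (X i)" if "i \<le> d" for i
    using that Z by (metis ereal_less_eq(3) max.bounded_iff)
  then show ?thesis
    using xt by (auto simp: le_fun_def real_point_def tspace_def)
qed

lemma real_point_in_cell_matched_pairs:
  assumes \<sigma>: "\<sigma> permutes {..<Suc d}" and X: "potential (Suc d) B \<sigma> X" "X 0 = 0"
  shows "real_point d X \<in> cell d (matched_pairs d c \<sigma>)"
proof (rule real_point_in_cell)
  fix i v k assume "(i, v) \<in> matched_pairs d c \<sigma>" "k \<le> d"
  then show "v k + ereal (X i) \<le> v i + ereal (X k)"
    using potentialD[OF X(1), of i k] cB perm_bound[OF \<sigma>, of i] by (auto simp: matched_pairs_def)
qed (use X(2) in \<open>auto simp: matched_pairs_def\<close>)

text \<open>The topological heights, normalized at row 0, point from \<open>X\<close> into the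
  cell.\<close>

lemma generic_direction:
  assumes \<sigma>: "\<sigma> permutes {..<Suc d}" and X: "potential (Suc d) B \<sigma> X" "X 0 = 0"
    and ac: "acyclic_potential (Suc d) B \<sigma> X"
  obtains h where "h 0 = 0" "inj_on h {..d}"
    "\<forall>\<^sub>F t in at_right 0. strict_at d (matched_pairs d c \<sigma>) (\<lambda>i. X i + t * h i)"
proof -
  obtain g :: "nat \<Rightarrow> real" where g: "inj_on g {..<Suc d}"
    "\<And>i k. i < Suc d \<Longrightarrow> k < Suc d \<Longrightarrow> i \<noteq> k \<Longrightarrow> \<not> strict_edge B \<sigma> X i k \<Longrightarrow> g i < g k"
    using heights_if_acyclic[OF ac] by blast
  define h where "h i = g i - g 0" for i
  have "inj_on h {..d}" using g(1) by (auto simp: inj_on_def h_def)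
  moreover have "\<forall>\<^sub>F t in at_right 0. strict_at d (matched_pairs d c \<sigma>) (\<lambda>i. X i + t * h i)"
  proof (rule eventually_strict_at)
    fix i v k assume "(i, v) \<in> matched_pairs d c \<sigma>" and k: "k \<le> d" "k \<noteq> i"
    then have i: "i \<le> d" "v = c (\<sigma> i)" by (auto simp: matched_pairs_def)
    have v: "v l = B l (\<sigma> i)" if "l \<le> d" for l using cB[OF that] perm_bound[OF \<sigma> i(1)] i(2) by simp
    have "B k (\<sigma> i) + ereal (X i) \<le> B i (\<sigma> i) + ereal (X k)" using potentialD[OF X(1)] i k by simp
    then have "B k (\<sigma> i) + ereal (X i) < B i (\<sigma> i) + ereal (X k) \<or>
        B k (\<sigma> i) + ereal (X i) = B i (\<sigma> i) + ereal (X k) \<and> h i < h k"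
      using g(2)[of i k] i k by (auto simp: strict_edge_def h_def le_less)
    then show "\<bar>v i\<bar> \<noteq> \<infinity> \<and> v k \<noteq> \<infinity> \<and> (v k + ereal (X i) < v i + ereal (X k) \<or>
        v k + ereal (X i) = v i + ereal (X k) \<and> h i < h k)"
      using X(1) v[OF i(1)] v[OF k(1)] entry_ne_PInf[of k "\<sigma> i"] perm_bound[OF \<sigma> i(1)] i(1) k(1)
      by (simp add: potential_def)
  qed (simp_all add: matched_pairs_def h_def X(2))
  moreover have "h 0 = 0" by (simp add: h_def)
  ultimately show ?thesis using that by blast
qed

text \<open>
  The trunk of a simplex with a unique optimal permutation is a single cell, since a full-dimensional
  cell assigns the \<open>d + 1\<close> vertices bijectively to the \<open>d + 1\<close> coordinates.
\<close>

lemma trunk_simplex: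
  assumes b: "1 < b" and \<sigma>: "\<sigma> permutes {..<Suc d}" and uniq: "unique_optimum (Suc d) B"
    and X: "greatest_potential (Suc d) B \<sigma> X"
  shows "trunk b d (tconv (c ` {..d})) = cell d (matched_pairs d c \<sigma>)"
proof -
  let ?V0 = "c ` {..d}"
  define V where "V = vertices (tconv ?V0)"
  have V0: "finite ?V0" "?V0 \<subseteq> tspace d" using c by auto
  have V: "V \<subseteq> ?V0" "tconv V = tconv ?V0" using vertices_tconv[OF V0] by (simp_all add: V_def)
  have Vt: "V \<subseteq> tspace d" using V(1) V0(2) by blast
  have pot: "potential (Suc d) B \<sigma> X" "X 0 = 0" using X by (simp_all add: greatest_potential_def)
  have ac: "acyclic_potential (Suc d) B \<sigma> X"
    using unique_optimum_iff[of "Suc d" B, OF entry_ne_PInf \<sigma> pot(1)] uniq by simp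
  obtain h where "\<forall>\<^sub>F t in at_right 0. strict_at d (matched_pairs d c \<sigma>) (\<lambda>i. X i + t * h i)"
    using generic_direction[OF \<sigma> pot ac] by metis
  then obtain Y where Y: "strict_at d (matched_pairs d c \<sigma>) Y"
    using eventually_happens'[OF trivial_limit_at_right_real] by blast
  have in_G: "(i, c (\<sigma> i)) \<in> matched_pairs d c \<sigma>" if "i \<le> d" for i
    using that by (auto simp: matched_pairs_def)
  have col_in: "c (\<sigma> i) \<in> ?V0" if "i \<le> d" for i using perm_bound[OF \<sigma> that] by simp
  \<comment> \<open>Every column is a vertex: the strict point \<open>Y\<close> is covered by
    vertices in each coordinate \<open>i\<close>, and only the column \<open>c (\<sigma> i)\<close>
    can do this.\<close>
  have "real_point d Y \<in> tconv V"
    unfolding V(2)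
  proof (rule real_point_in_tconv[OF Y _ V0(2)])
    fix i assume "i \<le> d"
    then show "\<exists>v\<in>?V0. (i, v) \<in> matched_pairs d c \<sigma>" using in_G col_in by blast
  qed
  then have cov: "covers d V (real_point d Y) i" if "i \<le> d" for i
    using tconv_iff[OF Vt] that by blast
  have surj: "\<exists>i\<le>d. c q = c (\<sigma> i)" if "q \<le> d" for q
  proof -
    have "inv \<sigma> q \<le> d" using perm_bound[OF permutes_inv[OF \<sigma>] that] .
    then show ?thesis using permutes_inverses(1)[OF \<sigma>, of q] by metis
  qed
  have col_V: "c (\<sigma> i) \<in> V" if i: "i \<le> d" for i
  proof -
    obtain v l where v: "v \<in> V" "l + v i = ereal (Y i)" "\<And>k. k \<le> d \<Longrightarrow> l + v k \<le> ereal (Y k)"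
      using cov[OF i] strict_atD(1)[OF Y] i unfolding covers_def by (auto simp: real_point_nth)
    obtain i' where i': "i' \<le> d" "v = c (\<sigma> i')" using V(1) v(1) surj by blast
    then have "i = i'"
      using strict_at_covers[OF Y in_G[OF i'(1)] i'(1) i _ _ v(3)[OF i'(1), unfolded i'(2)]] v(1,2) Vt by blast
    then show ?thesis using v(1) i' by simp
  qed
  have VV: "V = ?V0"
  proof
    show "?V0 \<subseteq> V" using surj col_V by force
  qed (fact V(1))
  show ?thesis
  proof (intro set_eqI iffI)
    fix x assume "x \<in> cell d (matched_pairs d c \<sigma>)"
    moreover have "matched_pairs d c \<sigma> \<subseteq> {0..d} \<times> V" using matched_pairs_subset[OF \<sigma>] VV by simp
    moreover have "\<forall>v\<in>V. \<exists>i. (i, v) \<in> matched_pairs d c \<sigma>"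
    proof
      fix v assume "v \<in> V"
      then obtain i where "i \<le> d" "v = c (\<sigma> i)" using VV surj by blast
      then show "\<exists>i. (i, v) \<in> matched_pairs d c \<sigma>" using in_G by blast
    qed
    ultimately show "x \<in> trunk b d (tconv ?V0)"
      unfolding trunk_iff[OF b V0] V_def[symmetric] using in_G Y by blast
  next
    fix x assume "x \<in> trunk b d (tconv ?V0)"
    then obtain G Y' where G: "G \<subseteq> {0..d} \<times> V" "\<forall>i\<le>d. \<exists>v. (i, v) \<in> G" "strict_at d G Y'" "x \<in> cell d G"
      unfolding trunk_iff[OF b V0] V_def[symmetric] by blast
    have "\<forall>i. \<exists>q. i \<le> d \<longrightarrow> q \<le> d \<and> (i, c q) \<in> G"
    proof
      fix i
      show "\<exists>q. i \<le> d \<longrightarrow> q \<le> d \<and> (i, c q) \<in> G"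
        using G(1,2) VV by (cases "i \<le> d") fastforce+
    qed
    then obtain f where f: "\<And>i. i \<le> d \<Longrightarrow> f i \<le> d \<and> (i, c (f i)) \<in> G" by metis
    have "inj_on f {..d}"
    proof (rule inj_onI)
      fix i k assume ik: "i \<in> {..d}" "k \<in> {..d}" "f i = f k"
      then have "(i, c (f i)) \<in> G" "(k, c (f i)) \<in> G" using f[of i] f[of k] by auto
      then show "i = k" using strict_at_unique[OF G(3)] ik(1,2) by auto
    qed
    moreover have "f ` {..d} \<subseteq> {..d}" using f by auto
    ultimately have "bij_betw f {..d} {..d}" by (simp add: bij_betw_def endo_inj_surj)
    define \<pi> where "\<pi> i = (if i \<le> d then f i else i)" for i
    have "bij_betw \<pi> {..<Suc d} {..<Suc d}"
      using \<open>bij_betw f _ _\<close> bij_betw_cong[of "{..d}" \<pi> f "{..d}"] by (simp add: \<pi>_def lessThan_Suc_atMost)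
    then have \<pi>: "\<pi> permutes {..<Suc d}" by (rule bij_imp_permutes) (simp add: \<pi>_def)
    have sub: "matched_pairs d c \<pi> \<subseteq> G" using f by (auto simp: matched_pairs_def \<pi>_def)
    have st: "strict_at d (matched_pairs d c \<pi>) Y'"
      using G(3) sub by (auto intro!: strict_atI dest: strict_atD)
    note sp = strict_potential[OF \<pi> st]
    \<comment> \<open>Both permutations have a potential, so both are optimal and must
      coincide.\<close>
    have "perm_weight (Suc d) B \<sigma> = perm_weight (Suc d) B \<pi>"
      using perm_weight_le[of "Suc d" B, OF entry_ne_PInf \<pi> sp(1) \<sigma>] perm_weight_le[of "Suc d" B, OF entry_ne_PInf \<sigma> pot(1) \<pi>]
      by (rule antisym)
    then have "\<sigma> = \<pi>"
      by (intro unique_if_acyclic[of "Suc d" B \<pi> Y' \<sigma>] entry_ne_PInf \<pi> sp \<sigma>)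
    then have "matched_pairs d c \<sigma> \<subseteq> G" using sub by simp
    then show "x \<in> cell d (matched_pairs d c \<sigma>)" using G(4) unfolding cell_def by blast
  qed
qed

lemma bt_simplex:
  assumes "1 < b" "\<sigma> permutes {..<Suc d}" "unique_optimum (Suc d) B" "greatest_potential (Suc d) B \<sigma> X"
  shows "bt b d (tconv (c ` {..d})) = real_point d X"
  unfolding bt_def barycenter_def trunk_simplex[OF assms]
proof (rule Greatest_equality)
  show "real_point d X \<in> cell d (matched_pairs d c \<sigma>)"
    using real_point_in_cell_matched_pairs[OF assms(2)] assms(4) by (simp add: greatest_potential_def)
  show "x \<le> real_point d X" if "x \<in> cell d (matched_pairs d c \<sigma>)" for x
    using cell_matched_pairs_le[OF assms(2,4) that] .
qed

text \<open>
  Each vertex of the larger polytope is attached to one coordinate, chosen among those that are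
  optimal at the greatest point of the cell as the one that stays optimal when moving into the cell
  along a direction with pairwise distinct coordinates.
\<close>

lemma real_point_in_trunk:
  assumes b: "1 < b" and \<sigma>: "\<sigma> permutes {..<Suc d}" and uniq: "unique_optimum (Suc d) B"
    and X: "greatest_potential (Suc d) B \<sigma> X"
    and P: "finite P" "P \<subseteq> tspace d" "c ` {..d} \<subseteq> P"
  shows "real_point d X \<in> trunk b d (tconv P)"
proof -
  define V where "V = vertices (tconv P)"
  have V: "V \<subseteq> P" "tconv V = tconv P" using vertices_tconv[OF P(1,2)] by (simp_all add: V_def)
  have Vt: "V \<subseteq> tspace d" and finV: "finite V" using V(1) P finite_subset by blast+
  have pot: "potential (Suc d) B \<sigma> X" "X 0 = 0" using X by (simp_all add: greatest_potential_def)
  have ac: "acyclic_potential (Suc d) B \<sigma> X"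
    using unique_optimum_iff[of "Suc d" B, OF entry_ne_PInf \<sigma> pot(1)] uniq by simp
  obtain h where h: "h 0 = 0" "inj_on h {..d}"
    "\<forall>\<^sub>F t in at_right 0. strict_at d (matched_pairs d c \<sigma>) (\<lambda>i. X i + t * h i)"
    using generic_direction[OF \<sigma> pot ac] by metis
  define opt where "opt v = {i. i \<le> d \<and> (\<forall>k\<le>d. v k + ereal (X i) \<le> v i + ereal (X k))}" for v
  have "\<exists>i\<in>opt v. \<forall>k\<in>opt v. h i \<le> h k" if v: "v \<in> V" for v
  proof -
    have vt: "v \<in> tspace d" using v Vt by blast
    \<comment> \<open>Where \<open>v i\<close> is \<open>-\<infinity>\<close> the difference is
      \<open>\<infinity>\<close>; coordinate 0 contributes the finite value 0, so the minimum is
      attained at a finite entry.\<close>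
    obtain i where i: "i \<le> d" "\<And>k. k \<le> d \<Longrightarrow> ereal (X i) - v i \<le> ereal (X k) - v k"
      using exists_least[of "{..d}" "\<lambda>i. ereal (X i) - v i"] by auto
    have "ereal (X i) - v i \<le> 0" using i(2)[of 0] tspaceD(1)[OF vt] pot(2) by (simp add: zero_ereal_def)
    then have "v i \<noteq> -\<infinity>" by auto
    then have "v k + ereal (X i) \<le> v i + ereal (X k)" if "k \<le> d" for k
      using i(2)[OF that] tspaceD(2)[OF vt, of i] by (cases "v i"; cases "v k") auto
    then have "i \<in> opt v" using i(1) by (simp add: opt_def)
    moreover have "finite (opt v)" by (simp add: opt_def)
    ultimately show ?thesis using exists_least[of "opt v" h] by blast
  qed
  then obtain top where top: "\<And>v. v \<in> V \<Longrightarrow> top v \<in> opt v \<and> (\<forall>k\<in>opt v. h (top v) \<le> h k)"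
    by metis
  have top_le: "top v \<le> d" "\<And>k. k \<le> d \<Longrightarrow> v k + ereal (X (top v)) \<le> v (top v) + ereal (X k)" if "v \<in> V" for v
    using top[OF that] by (auto simp: opt_def)
  define G where "G = (\<lambda>v. (top v, v)) ` V"
  have G: "G \<subseteq> {0..d} \<times> V" using top_le(1) by (auto simp: G_def)
  have top_fin: "\<bar>v (top v)\<bar> \<noteq> \<infinity>" if v: "v \<in> V" for v
  proof -
    have vt: "v \<in> tspace d" using v Vt by blast
    have "v 0 + ereal (X (top v)) \<le> v (top v) + ereal (X 0)" using top_le(2)[OF v, of 0] by simp
    then show ?thesis
      using tspaceD(1)[OF vt] tspaceD(2)[OF vt, of "top v"] by (cases "v (top v)") auto
  qed
  have "\<forall>\<^sub>F t in at_right 0. strict_at d G (\<lambda>i. X i + t * h i)"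
  proof (rule eventually_strict_at)
    show "finite G" "h 0 = 0" "X 0 = 0" using finV h(1) pot(2) by (simp_all add: G_def)
    fix i v k assume iv: "(i, v) \<in> G" and k: "k \<le> d" "k \<noteq> i"
    then have v: "v \<in> V" "i = top v" by (auto simp: G_def)
    have vt: "v \<in> tspace d" using v Vt by blast
    have "h i < h k" if eq: "v k + ereal (X i) = v i + ereal (X k)"
    proof -
      obtain \<gamma> \<beta> where gb: "v k = ereal \<gamma>" "v i = ereal \<beta>"
        using eq top_fin[OF v(1)] v(2) by (cases "v k"; cases "v i") auto
      have "v l + ereal (X k) \<le> v k + ereal (X l)" if "l \<le> d" for l
        using top_le(2)[OF v(1) that] eq v(2) gb by (cases "v l") auto
      then have "k \<in> opt v" using k(1) by (simp add: opt_def)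
      then have "h i \<le> h k" using top[OF v(1)] v(2) by simp
      moreover have "h i \<noteq> h k" using inj_onD[OF h(2)] k top_le(1)[OF v(1)] v(2) by auto
      ultimately show ?thesis by simp
    qed
    moreover have "v k + ereal (X i) \<le> v i + ereal (X k)" using top_le(2)[OF v(1) k(1)] v(2) by simp
    ultimately show "\<bar>v i\<bar> \<noteq> \<infinity> \<and> v k \<noteq> \<infinity> \<and> (v k + ereal (X i) < v i + ereal (X k) \<or>
        v k + ereal (X i) = v i + ereal (X k) \<and> h i < h k)"
      using top_fin[OF v(1)] v(2) tspaceD(2)[OF vt, of k] by (auto simp: le_less)
  qed
  then have "\<forall>\<^sub>F t in at_right 0. strict_at d G (\<lambda>i. X i + t * h i) \<and>
      strict_at d (matched_pairs d c \<sigma>) (\<lambda>i. X i + t * h i)"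
    using h(3) by (rule eventually_conj)
  then obtain Y where Y: "strict_at d G Y" "strict_at d (matched_pairs d c \<sigma>) Y"
    using eventually_happens'[OF trivial_limit_at_right_real] by blast
  have "c ` {..d} \<subseteq> tspace d" using c by auto
  have "real_point d Y \<in> tconv (c ` {..d})"
  proof (rule real_point_in_tconv[OF Y(2) _ \<open>c ` {..d} \<subseteq> tspace d\<close>])
    fix i assume "i \<le> d"
    then show "\<exists>v\<in>c ` {..d}. (i, v) \<in> matched_pairs d c \<sigma>"
      using perm_bound[OF \<sigma>] by (intro bexI[of _ "c (\<sigma> i)"]) (auto simp: matched_pairs_def)
  qed
  then have "real_point d Y \<in> tconv V" using tconv_mono[OF P(3)] V(2) by blast
  then have cov: "covers d V (real_point d Y) i" if "i \<le> d" for i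
    using tconv_iff[OF Vt] that by blast
  \<comment> \<open>Every coordinate receives a vertex: \<open>Y\<close> lies in the simplex and
    hence in the polytope, and a vertex covering coordinate \<open>i\<close> of \<open>Y\<close>
    must be attached to \<open>i\<close>.\<close>
  have "\<exists>v. (i, v) \<in> G" if i: "i \<le> d" for i
  proof -
    obtain v l where v: "v \<in> V" "l + v i = ereal (Y i)" "\<And>k. k \<le> d \<Longrightarrow> l + v k \<le> ereal (Y k)"
      using cov[OF i] strict_atD(1)[OF Y(1)] i unfolding covers_def by (auto simp: real_point_nth)
    have tG: "(top v, v) \<in> G" using v(1) by (simp add: G_def)
    have "i = top v"
      using strict_at_covers[OF Y(1) tG top_le(1)[OF v(1)] i _ v(2) v(3)[OF top_le(1)[OF v(1)]]] v(1) Vt by blast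
    then show ?thesis using tG by blast
  qed
  moreover have "\<forall>v\<in>V. \<exists>i. (i, v) \<in> G" by (auto simp: G_def)
  moreover have "real_point d X \<in> cell d G"
    by (rule real_point_in_cell) (use pot(2) top_le G in \<open>auto simp: G_def\<close>)
  ultimately show ?thesis
    unfolding trunk_iff[OF b P(1,2)] V_def[symmetric] using G Y(1) by blast
qed

end

section \<open>The trunk of a polytope as a union of simplex trunks\<close>

lemma permutes_extend:
  fixes f :: "nat \<Rightarrow> nat"
  assumes "inj_on f {..<n}" "\<And>i. i < n \<Longrightarrow> f i < n"
  shows "(\<lambda>i. if i < n then f i else i) permutes {..<n}"
proof (rule bij_imp_permutes)
  have "f ` {..<n} \<subseteq> {..<n}" using assms(2) by auto
  then have "bij_betw f {..<n} {..<n}" using endo_inj_surj[of "{..<n}" f] assms(1) by (simp add: bij_betw_def)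
  then show "bij_betw (\<lambda>i. if i < n then f i else i) {..<n} {..<n}"
    using bij_betw_cong[of "{..<n}" "\<lambda>i. if i < n then f i else i" f "{..<n}"] by simp
qed simp

lemma tcolumn_tspace: "tmatrix d m M \<Longrightarrow> j \<in> {1..m} \<Longrightarrow> tcolumn d M j \<in> tspace d"
  unfolding tspace_def tcolumn_def tmatrix_def by auto

definition simplex_column :: "nat \<Rightarrow> (nat \<Rightarrow> nat \<Rightarrow> ereal) \<Rightarrow> nat set \<Rightarrow> nat \<Rightarrow> nat \<Rightarrow> ereal" where
  "simplex_column d M J q = tcolumn d M (sorted_list_of_set J ! q)"

lemma simplex_column_nth: "i \<le> d \<Longrightarrow> simplex_column d M J q i = simplex_matrix M J i q"
  by (auto simp: simplex_column_def tcolumn_def simplex_matrix_def)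

lemma sorted_nth_in:
  fixes J :: "nat set"
  assumes "J \<subseteq> {1..m}" "card J = Suc d" "q \<le> d"
  shows "sorted_list_of_set J ! q \<in> J"
proof -
  have "finite J" using finite_subset[OF assms(1)] by simp
  then show ?thesis using nth_mem[of q "sorted_list_of_set J"] assms(2,3) by simp
qed

lemma simplex_column_tspace:
  assumes "tmatrix d m M" "J \<subseteq> {1..m}" "card J = Suc d" "q \<le> d"
  shows "simplex_column d M J q \<in> tspace d"
  unfolding simplex_column_def using tcolumn_tspace[OF assms(1)] sorted_nth_in[OF assms(2-4)] assms(2) by blast

lemma tconv_mat_select_columns:
  "tconv_mat d (d + 1) (select_columns M J) = tconv (simplex_column d M J ` {..d})"
proof -
  have "tcolumn d (select_columns M J) (Suc q) = simplex_column d M J q" for q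
    by (auto simp: tcolumn_def select_columns_def simplex_column_def)
  moreover have "{1..d + 1} = Suc ` {..d}" by (simp add: image_Suc_atMost)
  ultimately have "tcolumn d (select_columns M J) ` {1..d + 1} = simplex_column d M J ` {..d}"
    by (simp only: image_image)
  then show ?thesis by (simp add: tconv_mat_def)
qed

text \<open>Strictness makes the columns chosen for different coordinates distinct, so there are
  \<open>d + 1\<close> of them; dropping all other pairs only enlarges the cell.\<close>

lemma trunk_in_simplex:
  assumes b: "1 < b" and M: "tmatrix d m M" and x: "x \<in> trunk b d (tconv_mat d m M)"
  obtains J \<sigma> Y where "J \<subseteq> {1..m}" "card J = Suc d" "\<sigma> permutes {..<Suc d}"
    "strict_at d (matched_pairs d (simplex_column d M J) \<sigma>) Y"
    "x \<in> cell d (matched_pairs d (simplex_column d M J) \<sigma>)"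
proof -
  let ?P = "tcolumn d M ` {1..m}"
  have P: "finite ?P" "?P \<subseteq> tspace d" using tcolumn_tspace[OF M] by auto
  obtain G Y where G: "G \<subseteq> {0..d} \<times> vertices (tconv ?P)" "\<forall>i\<le>d. \<exists>v. (i, v) \<in> G"
    "strict_at d G Y" "x \<in> cell d G"
    using x unfolding tconv_mat_def trunk_iff[OF b P] by blast
  have "\<exists>j. i \<le> d \<longrightarrow> j \<in> {1..m} \<and> (i, tcolumn d M j) \<in> G" for i
  proof (cases "i \<le> d")
    case True
    then obtain v where "(i, v) \<in> G" using G(2) by blast
    moreover from this have "v \<in> ?P" using G(1) vertices_tconv(1)[OF P] by blast
    ultimately show ?thesis by blast
  qed simp
  then obtain f where f: "\<And>i. i \<le> d \<Longrightarrow> f i \<in> {1..m} \<and> (i, tcolumn d M (f i)) \<in> G" by metis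
  have inj: "inj_on f {..d}"
  proof (rule inj_onI)
    fix i k assume ik: "i \<in> {..d}" "k \<in> {..d}" "f i = f k"
    then have "(i, tcolumn d M (f i)) \<in> G" "(k, tcolumn d M (f i)) \<in> G" using f[of i] f[of k] by auto
    then show "i = k" using strict_at_unique[OF G(3)] ik(1,2) by auto
  qed
  define J where "J = f ` {..d}"
  have J: "J \<subseteq> {1..m}" "card J = Suc d" "finite J"
    using f card_image[OF inj] by (auto simp: J_def)
  have "\<exists>q. i \<le> d \<longrightarrow> q < Suc d \<and> sorted_list_of_set J ! q = f i" for i
  proof (cases "i \<le> d")
    case True
    then have "f i \<in> set (sorted_list_of_set J)" using J(3) by (simp add: J_def)
    then obtain q where "q < length (sorted_list_of_set J)" "sorted_list_of_set J ! q = f i"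
      unfolding in_set_conv_nth by blast
    then show ?thesis using J(2,3) by auto
  qed simp
  then obtain g where g: "\<And>i. i \<le> d \<Longrightarrow> g i < Suc d \<and> sorted_list_of_set J ! g i = f i" by metis
  have "inj_on g {..<Suc d}"
  proof (rule inj_onI)
    fix i k assume ik: "i \<in> {..<Suc d}" "k \<in> {..<Suc d}" "g i = g k"
    then have "f i = f k" using g[of i] g[of k] by auto
    then show "i = k" using inj_onD[OF inj] ik by auto
  qed
  moreover have "g i < Suc d" if "i < Suc d" for i using g[of i] that by simp
  ultimately have \<sigma>: "(\<lambda>i. if i < Suc d then g i else i) permutes {..<Suc d}" by (rule permutes_extend)
  define \<sigma> where "\<sigma> = (\<lambda>i. if i < Suc d then g i else i)"
  have sub: "matched_pairs d (simplex_column d M J) \<sigma> \<subseteq> G"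
    unfolding matched_pairs_def using f g by (auto simp: \<sigma>_def simplex_column_def)
  show ?thesis
  proof (rule that[OF J(1,2)])
    show "\<sigma> permutes {..<Suc d}" using \<sigma> by (simp add: \<sigma>_def)
    show "strict_at d (matched_pairs d (simplex_column d M J) \<sigma>) Y"
      by (rule strict_atI) (use strict_atD[OF G(3)] sub in blast)+
    show "x \<in> cell d (matched_pairs d (simplex_column d M J) \<sigma>)"
      using G(4) sub unfolding cell_def by blast
  qed
qed

text \<open>The zero row has index \<open>d + 1\<close> in \<open>A\<close> and 0 in
  \<open>B\<close>, and columns are numbered from 1 or from 0; \<open>e\<close> and
  \<open>e'\<close> translate the rows. If the maximum were \<open>-\<infinity>\<close>, all
  permutations would attain it; uniqueness then leaves a single permutation, so
  \<open>d = 0\<close>, where the zero row gives weight 0.\<close>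

lemma nonsingular_iff:
  fixes M :: "nat \<Rightarrow> nat \<Rightarrow> ereal" and J :: "nat set" and d :: nat
  defines "A \<equiv> append_zero_row d (select_columns M J)" and "B \<equiv> simplex_matrix M J"
  shows "nonsingular (d + 1) A \<longleftrightarrow> unique_optimum (Suc d) B"
proof -
  define n where "n = Suc d"
  define e where "e l = (if l = n then 0 else l)" for l :: nat
  define e' where "e' i = (if i = 0 then n else i)" for i :: nat
  define \<Psi> where "\<Psi> q l = (if l \<in> {1..n} then Suc (q (e l)) else l)" for q :: "nat \<Rightarrow> nat" and l
  define \<Phi> where "\<Phi> p i = (if i < n then p (e' i) - 1 else i)" for p :: "nat \<Rightarrow> nat" and i
  define Q where "Q = {q. q permutes {..<n}}"
  define P where "P = {p. p permutes {1..n}}"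
  define W where "W p = (\<Sum>l=1..n. A l (p l))" for p
  have e: "e l < n" "e' (e l) = l" if "l \<in> {1..n}" for l using that by (auto simp: e_def e'_def)
  have e': "e' i \<in> {1..n}" "e (e' i) = i" if "i < n" for i using that by (auto simp: e_def e'_def)
  have q_less: "q i < n" if "q \<in> Q" "i < n" for q i
    using permutes_in_image[of q "{..<n}" i] that by (simp add: Q_def)
  have p_in: "p l \<in> {1..n}" if "p \<in> P" "l \<in> {1..n}" for p l
    using permutes_in_image[of p "{1..n}" l] that by (simp add: P_def)
  have \<Psi>P: "\<Psi> q \<in> P" if q: "q \<in> Q" for q
  proof -
    have "inj_on (\<Psi> q) {1..n}"
    proof (rule inj_onI)
      fix a c assume ac: "a \<in> {1..n}" "c \<in> {1..n}" "\<Psi> q a = \<Psi> q c"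
      then have "q (e a) = q (e c)" by (simp add: \<Psi>_def)
      then have "e a = e c" using permutes_inj[of q "{..<n}"] q by (simp add: Q_def inj_eq)
      then show "a = c" using e(2)[OF ac(1)] e(2)[OF ac(2)] by metis
    qed
    moreover have "\<Psi> q ` {1..n} \<subseteq> {1..n}" using q_less[OF q] e(1) by (auto simp: \<Psi>_def Suc_le_eq)
    ultimately have "bij_betw (\<Psi> q) {1..n} {1..n}"
      using endo_inj_surj[of "{1..n}" "\<Psi> q"] by (simp add: bij_betw_def)
    then have "\<Psi> q permutes {1..n}" by (rule bij_imp_permutes) (auto simp: \<Psi>_def)
    then show ?thesis by (simp add: P_def)
  qed
  have \<Phi>Q: "\<Phi> p \<in> Q" if p: "p \<in> P" for p
  proof -
    have ge: "1 \<le> p (e' i)" "p (e' i) \<le> n" if "i < n" for i using p_in[OF p e'(1)[OF that]] by auto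
    have "inj_on (\<lambda>i. p (e' i) - 1) {..<n}"
    proof (rule inj_onI)
      fix a c assume ac: "a \<in> {..<n}" "c \<in> {..<n}" "p (e' a) - 1 = p (e' c) - 1"
      then have "p (e' a) = p (e' c)" using ge[of a] ge[of c] by auto
      then have "e' a = e' c" using permutes_inj[of p "{1..n}"] p by (simp add: P_def inj_eq)
      then have "e (e' a) = e (e' c)" by (rule arg_cong)
      moreover have "e (e' a) = a" "e (e' c) = c" using e'(2) ac(1,2) by blast+
      ultimately show "a = c" by (simp only:)
    qed
    moreover have "p (e' i) - 1 < n" if "i < n" for i using ge[OF that] by simp
    ultimately have "(\<lambda>i. if i < n then p (e' i) - 1 else i) permutes {..<n}" by (rule permutes_extend)
    then show ?thesis by (simp add: Q_def \<Phi>_def[abs_def])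
  qed
  have \<Psi>\<Phi>: "\<Psi> (\<Phi> p) = p" if p: "p \<in> P" for p
  proof
    fix l
    show "\<Psi> (\<Phi> p) l = p l"
    proof (cases "l \<in> {1..n}")
      case True
      then have "\<Psi> (\<Phi> p) l = Suc (p l - 1)" using e[OF True] by (simp add: \<Psi>_def \<Phi>_def)
      then show ?thesis using p_in[OF p True] by simp
    next
      case False
      then show ?thesis using permutes_not_in[of p "{1..n}" l] p by (auto simp: \<Psi>_def P_def)
    qed
  qed
  have W: "W (\<Psi> q) = perm_weight n B q" if q: "q \<in> Q" for q
    unfolding W_def perm_weight_def
  proof (rule sum.reindex_bij_witness[of _ e' e])
    fix l assume l: "l \<in> {1..n}"
    show "B (e l) (q (e l)) = A l (\<Psi> q l)"
      using l by (auto simp: A_def B_def append_zero_row_def select_columns_def simplex_matrix_def \<Psi>_def e_def n_def)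
  qed (use e e' in auto)
  have tdet: "tdet (d + 1) A = Max (W ` P)" by (simp add: tdet_def W_def P_def n_def)
  have finP: "finite P" "P \<noteq> {}"
    unfolding P_def using finite_permutations[of "{1..n}"] permutes_id[of "{1..n}"] by (simp, blast)
  have cardP: "card P = fact n" unfolding P_def by (rule card_permutations) auto
  have ns: "nonsingular (d + 1) A \<longleftrightarrow> (\<exists>\<^sub>\<le>\<^sub>1p. p \<in> P \<and> W p = Max (W ` P))"
    unfolding nonsingular_def tdet by (simp add: W_def P_def n_def)
  have uo: "unique_optimum n B \<longleftrightarrow> (\<exists>q0\<in>Q. W (\<Psi> q0) \<noteq> -\<infinity> \<and> (\<forall>q\<in>Q. W (\<Psi> q0) \<le> W (\<Psi> q) \<longrightarrow> q = q0))"
    unfolding unique_optimum_def using W by (auto simp: Q_def)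
  have le_Max: "W p \<le> Max (W ` P)" if "p \<in> P" for p using finP that by simp
  have "nonsingular (d + 1) A \<longleftrightarrow> unique_optimum n B"
  proof
    assume "nonsingular (d + 1) A"
    then have u: "p = p'" if "p \<in> P" "p' \<in> P" "W p = Max (W ` P)" "W p' = Max (W ` P)" for p p'
      using that unfolding ns Uniq_def by blast
    have "Max (W ` P) \<in> W ` P" using finP by (intro Max_in) auto
    then obtain p0 where p0: "p0 \<in> P" "W p0 = Max (W ` P)" by auto
    have fin: "W p0 \<noteq> -\<infinity>"
    proof
      assume *: "W p0 = -\<infinity>"
      have "P \<subseteq> {p0}"
      proof
        fix p assume p: "p \<in> P"
        then have "W p = -\<infinity>" using le_Max[OF p] unfolding p0(2)[symmetric] * by simp
        then have "W p = Max (W ` P)" using p0(2) * by metis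
        then show "p \<in> {p0}" using u[OF p p0(1) _ p0(2)] by simp
      qed
      then have "card P \<le> 1" using card_mono[of "{p0}" P] by simp
      then have "d = 0" using cardP fact_ge_self[of n] by (simp add: n_def)
      then have "perm_weight n B (\<Phi> p0) = 0" by (simp add: perm_weight_def n_def B_def simplex_matrix_def)
      then show False using W[OF \<Phi>Q[OF p0(1)]] \<Psi>\<Phi>[OF p0(1)] * by simp
    qed
    have uniq: "q = \<Phi> p0" if q: "q \<in> Q" "W p0 \<le> W (\<Psi> q)" for q
    proof -
      have "W (\<Psi> q) = Max (W ` P)"
        using le_Max[OF \<Psi>P[OF q(1)]] q(2) unfolding p0(2) by (rule antisym)
      then have "\<Psi> q = p0" using u[OF \<Psi>P[OF q(1)] p0(1) _ p0(2)] by simp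
      then have "\<Psi> q = \<Psi> (\<Phi> p0)" using \<Psi>\<Phi>[OF p0(1)] by simp
      have "q i = \<Phi> p0 i" for i
      proof (cases "i < n")
        case True
        then show ?thesis
          using fun_cong[OF \<open>\<Psi> q = \<Psi> (\<Phi> p0)\<close>, of "e' i"] e'[OF True] by (simp add: \<Psi>_def)
      next
        case False
        then show ?thesis using permutes_not_in[of q "{..<n}" i] q(1) by (simp add: Q_def \<Phi>_def)
      qed
      then show ?thesis by blast
    qed
    show "unique_optimum n B"
      unfolding uo
    proof (intro bexI[of _ "\<Phi> p0"] conjI ballI impI)
      show "W (\<Psi> (\<Phi> p0)) \<noteq> -\<infinity>" unfolding \<Psi>\<Phi>[OF p0(1)] by (rule fin)
      fix q assume "q \<in> Q" "W (\<Psi> (\<Phi> p0)) \<le> W (\<Psi> q)"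
      then show "q = \<Phi> p0" unfolding \<Psi>\<Phi>[OF p0(1)] by (rule uniq)
    qed (rule \<Phi>Q[OF p0(1)])
  next
    assume "unique_optimum n B"
    then obtain q0 where q0: "q0 \<in> Q" "\<And>q. q \<in> Q \<Longrightarrow> W (\<Psi> q0) \<le> W (\<Psi> q) \<Longrightarrow> q = q0"
      unfolding uo by blast
    have "p = \<Psi> q0" if p: "p \<in> P" "W p = Max (W ` P)" for p
    proof -
      have "W (\<Psi> q0) \<le> W (\<Psi> (\<Phi> p))"
        unfolding \<Psi>\<Phi>[OF p(1)] p(2) by (rule le_Max[OF \<Psi>P[OF q0(1)]])
      then have "\<Phi> p = q0" by (rule q0(2)[OF \<Phi>Q[OF p(1)]])
      with \<Psi>\<Phi>[OF p(1)] show ?thesis by (simp only:)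
    qed
    then show "nonsingular (d + 1) A" unfolding ns Uniq_def by metis
  qed
  then show ?thesis by (simp add: n_def)
qed

section \<open>The maximum over all simplices\<close>

lemma tmax_eqI: "s \<in> S \<Longrightarrow> (\<And>y. y \<in> S \<Longrightarrow> y \<le> s) \<Longrightarrow> tmax S = s"
  unfolding tmax_def by (auto intro: Greatest_equality)

lemma tmax_image_finite: "finite A \<Longrightarrow> tmax (f ` A) = (SUP a\<in>A. f a)"
proof (cases "A = {}")
  case False
  assume A: "finite A"
  obtain a where a: "a \<in> A" "(SUP a\<in>A. f a) = f a" using finite_SUP_in[OF A False] .
  show ?thesis
  proof (rule tmax_eqI)
    show "(SUP a\<in>A. f a) \<in> f ` A" unfolding a(2) using a(1) by (rule imageI)
    show "y \<le> (SUP a\<in>A. f a)" if "y \<in> f ` A" for y using that by (rule Sup_upper)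
  qed
qed (simp add: tmax_def bot_ereal_def)

definition simplex_volume :: "real \<Rightarrow> nat \<Rightarrow> (nat \<Rightarrow> nat \<Rightarrow> ereal) \<Rightarrow> nat set \<Rightarrow> ereal" where
  "simplex_volume b d M J = (\<Sum>i=1..d. bt b d (tconv_mat d (d + 1) (select_columns M J)) i)"

lemma sum_real_point:
  assumes "X 0 = 0"
  shows "(\<Sum>i=1..d. real_point d X i) = ereal (\<Sum>i<Suc d. X i)"
proof -
  have "(\<Sum>i<Suc d. X i) = (\<Sum>i=1..d. X i)"
    unfolding lessThan_Suc_atMost atMost_atLeast0 using assms by (simp add: sum.atLeast_Suc_atMost)
  moreover have "(\<Sum>i=1..d. real_point d X i) = (\<Sum>i=1..d. ereal (X i))"
    by (intro sum.cong) (auto simp: real_point_def)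
  ultimately show ?thesis by simp
qed

context
  fixes b :: real and d m :: nat and M :: "nat \<Rightarrow> nat \<Rightarrow> ereal" and J :: "nat set"
  assumes b: "1 < b" and M: "tmatrix d m M" and J: "J \<subseteq> {1..m}" "card J = Suc d"
begin

lemma simplex_matrix_finite: "i < Suc d \<Longrightarrow> q < Suc d \<Longrightarrow> simplex_matrix M J i q \<noteq> \<infinity>"
  using entry_ne_PInf[of d "simplex_column d M J" "simplex_matrix M J" i q] simplex_column_tspace[OF M J]
    simplex_column_nth by simp

text \<open>The barycenter does not mention \<open>\<sigma>\<close> or \<open>X\<close>, so the
  computed value depends on the simplex alone.\<close>

lemma simplex_value_eq:
  assumes "simplex_value (Suc d) (simplex_matrix M J) v"
  shows "v = simplex_volume b d M J"
proof -
  obtain \<sigma> X where \<sigma>: "\<sigma> permutes {..<Suc d}" and X: "greatest_potential (Suc d) (simplex_matrix M J) \<sigma> X"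
    and v: "v = ereal (\<Sum>i<Suc d. X i)" and u: "unique_optimum (Suc d) (simplex_matrix M J)"
    using assms unfolding simplex_value_def by blast
  have "bt b d (tconv (simplex_column d M J ` {..d})) = real_point d X"
    by (rule bt_simplex[OF _ _ b \<sigma> u X]) (simp_all add: simplex_column_tspace[OF M J] simplex_column_nth)
  moreover have "X 0 = 0" using X by (simp add: greatest_potential_def)
  ultimately show ?thesis
    unfolding simplex_volume_def tconv_mat_select_columns v by (simp only: sum_real_point)
qed

lemma sum_greatest_potential:
  assumes "unique_optimum (Suc d) (simplex_matrix M J)" "\<sigma> permutes {..<Suc d}"
    and X: "greatest_potential (Suc d) (simplex_matrix M J) \<sigma> X"
  shows "(\<Sum>i=1..d. real_point d X i) = simplex_volume b d M J"
proof -
  have "simplex_value (Suc d) (simplex_matrix M J) (ereal (\<Sum>i<Suc d. X i))"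
    unfolding simplex_value_def using assms by blast
  moreover have "X 0 = 0" using X by (simp add: greatest_potential_def)
  ultimately show ?thesis using simplex_value_eq by (simp only: sum_real_point)
qed

lemma unique_optimum_greatest_potential:
  assumes u: "unique_optimum (Suc d) (simplex_matrix M J)"
  obtains \<sigma> X where "\<sigma> permutes {..<Suc d}" "greatest_potential (Suc d) (simplex_matrix M J) \<sigma> X"
proof -
  obtain p where p: "p permutes {..<Suc d}" "perm_weight (Suc d) (simplex_matrix M J) p \<noteq> -\<infinity>"
    using u unfolding unique_optimum_def by blast
  have "\<forall>i<Suc d. \<bar>simplex_matrix M J i (p i)\<bar> \<noteq> \<infinity>"
    using perm_weight_finite_iff[of "Suc d" "simplex_matrix M J", OF simplex_matrix_finite p(1)] p(2) by simp
  then have "\<not> no_finite_perm (Suc d) (simplex_matrix M J)"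
    using p(1) unfolding no_finite_perm_def by force
  then obtain \<sigma> Z where \<sigma>: "\<sigma> permutes {..<Suc d}" "potential (Suc d) (simplex_matrix M J) \<sigma> Z"
    using potential_exists[of "Suc d" "simplex_matrix M J", OF simplex_matrix_finite] by blast
  have "\<exists>X. greatest_potential (Suc d) (simplex_matrix M J) \<sigma> X"
    by (rule greatest_potential_exists[OF _ \<sigma>(1) _ \<sigma>(2)]) (simp_all add: simplex_matrix_def)
  then obtain X where X: "greatest_potential (Suc d) (simplex_matrix M J) \<sigma> X" ..
  show ?thesis using \<sigma>(1) X by (rule that)
qed

text \<open>The lower bound for the volume: the barycenter of the simplex lies in the trunk of the
  whole polytope.\<close>

lemma simplex_volume_attained:
  assumes u: "unique_optimum (Suc d) (simplex_matrix M J)"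
  shows "\<exists>x\<in>trunk b d (tconv_mat d m M). (\<Sum>i=1..d. x i) = simplex_volume b d M J"
proof -
  obtain \<sigma> X where X: "\<sigma> permutes {..<Suc d}" "greatest_potential (Suc d) (simplex_matrix M J) \<sigma> X"
    using unique_optimum_greatest_potential[OF u] .
  have mem: "real_point d X \<in> trunk b d (tconv (tcolumn d M ` {1..m}))"
  proof (rule real_point_in_trunk[OF _ _ b X(1) u X(2)])
    show "tcolumn d M ` {1..m} \<subseteq> tspace d" using tcolumn_tspace[OF M] by auto
    show "simplex_column d M J ` {..d} \<subseteq> tcolumn d M ` {1..m}"
      using sorted_nth_in[OF J] J(1) unfolding simplex_column_def by blast
  qed (simp_all add: simplex_column_tspace[OF M J] simplex_column_nth)
  have eq: "(\<Sum>i=1..d. real_point d X i) = simplex_volume b d M J"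
    by (rule sum_greatest_potential[OF u X])
  show ?thesis
    unfolding tconv_mat_def by (rule bexI[of _ "real_point d X"]) (fact eq mem)+
qed

text \<open>The upper bound: every point of the cell lies below its greatest point, the barycenter
  of the simplex.\<close>

lemma cell_sum_le:
  assumes \<sigma>: "\<sigma> permutes {..<Suc d}" and Y: "strict_at d (matched_pairs d (simplex_column d M J) \<sigma>) Y"
    and x: "x \<in> cell d (matched_pairs d (simplex_column d M J) \<sigma>)"
  shows "unique_optimum (Suc d) (simplex_matrix M J)" "(\<Sum>i=1..d. x i) \<le> simplex_volume b d M J"
proof -
  show u: "unique_optimum (Suc d) (simplex_matrix M J)"
    by (rule strict_unique_optimum[OF _ _ \<sigma> Y]) (simp_all add: simplex_column_tspace[OF M J] simplex_column_nth)
  have pot: "potential (Suc d) (simplex_matrix M J) \<sigma> Y"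
    by (rule strict_potential(1)[OF _ _ \<sigma> Y]) (simp_all add: simplex_column_tspace[OF M J] simplex_column_nth)
  have "\<exists>X. greatest_potential (Suc d) (simplex_matrix M J) \<sigma> X"
    by (rule greatest_potential_exists[OF _ \<sigma> _ pot]) (simp_all add: simplex_matrix_def)
  then obtain X where X: "greatest_potential (Suc d) (simplex_matrix M J) \<sigma> X" by blast
  have "x \<le> real_point d X"
    by (rule cell_matched_pairs_le[OF _ _ \<sigma> X x]) (simp_all add: simplex_column_tspace[OF M J] simplex_column_nth)
  then have "(\<Sum>i=1..d. x i) \<le> (\<Sum>i=1..d. real_point d X i)" by (intro sum_mono) (simp add: le_fun_def)
  also have "\<dots> = simplex_volume b d M J"
    by (rule sum_greatest_potential[OF u \<sigma> X])
  finally show "(\<Sum>i=1..d. x i) \<le> simplex_volume b d M J" .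
qed

end

lemma tbvol_eq_SUP:
  assumes b: "1 < b" and M: "tmatrix d m M"
  defines "good J \<equiv> card J = d + 1 \<and> unique_optimum (d + 1) (simplex_matrix M J)"
  shows "tbvol b d (tconv_mat d m M) = (SUP J\<in>{J. J \<subseteq> {1..m} \<and> good J}. simplex_volume b d M J)"
proof -
  let ?\<J> = "{J. J \<subseteq> {1..m} \<and> good J}" and ?P = "tconv_mat d m M"
  have upper: "\<exists>J\<in>?\<J>. (\<Sum>i=1..d. x i) \<le> simplex_volume b d M J" if x: "x \<in> trunk b d ?P" for x
  proof -
    obtain J \<sigma> Y where J: "J \<subseteq> {1..m}" "card J = Suc d" and *: "\<sigma> permutes {..<Suc d}"
      "strict_at d (matched_pairs d (simplex_column d M J) \<sigma>) Y"
      "x \<in> cell d (matched_pairs d (simplex_column d M J) \<sigma>)"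
      using trunk_in_simplex[OF b M x] .
    show ?thesis
      using cell_sum_le[OF b M J *] J by (intro bexI[of _ J]) (simp_all add: good_def)
  qed
  show ?thesis
  proof (cases "?\<J> = {}")
    case True
    then have "trunk b d ?P = {}" using upper by blast
    then show ?thesis unfolding tbvol_def True by (simp add: tmax_def bot_ereal_def)
  next
    case False
    have fin: "finite ?\<J>" by (rule finite_subset[of _ "Pow {1..m}"]) auto
    obtain J where J: "J \<in> ?\<J>" "(SUP J\<in>?\<J>. simplex_volume b d M J) = simplex_volume b d M J"
      by (rule finite_SUP_in[OF fin False, of "simplex_volume b d M"])
    have J': "J \<subseteq> {1..m}" "card J = Suc d" "unique_optimum (Suc d) (simplex_matrix M J)"
      using J(1) by (simp_all add: good_def)
    from simplex_volume_attained[OF b M J']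
    obtain x where x: "x \<in> trunk b d ?P" "(\<Sum>i=1..d. x i) = simplex_volume b d M J" ..
    show ?thesis
      unfolding tbvol_def J(2)
    proof (rule tmax_eqI)
      show "simplex_volume b d M J \<in> (\<lambda>x. \<Sum>i=1..d. x i) ` trunk b d ?P"
        unfolding x(2)[symmetric] using x(1) by (rule imageI)
      fix y assume "y \<in> (\<lambda>x. \<Sum>i=1..d. x i) ` trunk b d ?P"
      then obtain x' where x': "x' \<in> trunk b d ?P" "y = (\<Sum>i=1..d. x' i)" by (rule imageE)
      obtain K where K: "K \<in> ?\<J>" "(\<Sum>i=1..d. x' i) \<le> simplex_volume b d M K"
        using upper[OF x'(1)] by (rule bexE)
      have "simplex_volume b d M K \<le> (SUP J\<in>?\<J>. simplex_volume b d M J)"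
        using K(1) by (rule SUP_upper)
      with K(2) show "y \<le> simplex_volume b d M J"
        unfolding x'(2) J(2) by (rule order_trans)
    qed
  qed
qed

text \<open>For \<open>d = 0\<close> the admissible time is 0, so the answer is written without
  tropical arithmetic: 0 if there is a column, and otherwise \<open>-\<infinity>\<close>, the
  initial value of \<open>out\<close>.\<close>

definition tbvol_program :: com where
  "tbvol_program = Ite (NEq (vr ''d'') (NConst 0))
    (Ite (NEq (vr ''m'') (NConst 0)) Skip (TZero (sc ''out''))) all_simplices"

lemma unique_optimum_single: "unique_optimum (Suc 0) (simplex_matrix M J)"
proof -
  have id: "p = id" if p: "p permutes {..<Suc 0}" for p :: "nat \<Rightarrow> nat"
  proof
    fix i
    show "p i = id i"
      using permutes_in_image[OF p, of 0] permutes_not_in[OF p, of i] by (cases "i = 0") auto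
  qed
  have "perm_weight (Suc 0) (simplex_matrix M J) id = 0"
    by (simp add: perm_weight_def simplex_matrix_def)
  then show ?thesis
    unfolding unique_optimum_def by (intro exI[of _ id]) (simp add: permutes_id id)
qed

lemma exec_tbvol_program:
  assumes b: "1 < b" and M: "tmatrix d m M"
  shows "\<exists>t s. exec tbvol_program (input_state d m M) t s \<and> output_value s = tbvol b d (tconv_mat d m M) \<and>
    t \<le> 136 * ((m choose (d + 1)) * d ^ 3)"
proof -
  obtain N T where NT: "input_state d m M = (N, T)" by (cases "input_state d m M")
  have N: "N (''d'', 0, 0) = d" "N (''m'', 0, 0) = m"
    using NT by (auto simp: input_state_def)
  have T: "T (''M'', i, j) = M i j" if "i \<in> {1..d}" "j \<in> {1..m}" for i j
    using NT that by (auto simp: input_state_def)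
  have out: "T (''out'', 0, 0) = -\<infinity>" using NT by (auto simp: input_state_def)
  have "wp tbvol_program (\<lambda>N' T' k'. T' (''out'', 0, 0) = tbvol b d (tconv_mat d m M) \<and>
      k' \<le> 136 * ((m choose (d + 1)) * d ^ 3)) N T 0"
  proof (cases "d = 0")
    case True
    have vol: "simplex_volume b d M J = 0" for J using True by (simp add: simplex_volume_def)
    have "tbvol b d (tconv_mat d m M) = (if m = 0 then -\<infinity> else 0)"
    proof (cases "m = 0")
      case m: True
      have empty: "{J. J \<subseteq> {1..m} \<and> card J = d + 1 \<and> unique_optimum (d + 1) (simplex_matrix M J)} = {}"
        using m by auto
      show ?thesis unfolding tbvol_eq_SUP[OF b M] empty using m by (simp add: bot_ereal_def)
    next
      case False
      then have "{1} \<in> {J. J \<subseteq> {1..m} \<and> card J = d + 1 \<and> unique_optimum (d + 1) (simplex_matrix M J)}"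
        using True unique_optimum_single by simp
      then have ne: "{J. J \<subseteq> {1..m} \<and> card J = d + 1 \<and> unique_optimum (d + 1) (simplex_matrix M J)} \<noteq> {}"
        by blast
      show ?thesis
        unfolding tbvol_eq_SUP[OF b M] vol using False by (simp only: SUP_const[OF ne] if_False)
    qed
    then show ?thesis using True N out by (simp add: tbvol_program_def)
  next
    case False
    \<comment> \<open>From \<open>d + 1 \<le> 2 * d\<close> comes the factor 8, and
      \<open>8 * 17 = 136\<close>.\<close>
    have "(d + 1) ^ 3 \<le> (2 * d) ^ 3" using False by (intro power_mono) auto
    then have "17 * (d + 1) ^ 3 \<le> 136 * d ^ 3" by (simp add: power_mult_distrib)
    then have bound: "(m choose (d + 1)) * (17 * (d + 1) ^ 3) \<le> 136 * ((m choose (d + 1)) * d ^ 3)"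
      using mult_le_mono2[of "17 * (d + 1) ^ 3" "136 * d ^ 3" "m choose (d + 1)"] by (simp add: ac_simps)
    have "wp all_simplices (\<lambda>N' T' k'. T' (''out'', 0, 0) =
        (SUP J\<in>{J. J \<subseteq> {1..m} \<and> card J = d + 1 \<and> unique_optimum (d + 1) (simplex_matrix M J)}. simplex_volume b d M J) \<and>
        k' \<le> (m choose (d + 1)) * (17 * (d + 1) ^ 3)) N T 0"
    proof (rule wp_all_simplices[OF N M])
      show "T (''M'', i, j) = M i j" if "i \<in> {1..d}" "j \<in> {1..m}" for i j using T[OF that] .
      show "v = simplex_volume b d M J"
        if "J \<subseteq> {1..m}" "card J = d + 1" "simplex_value (d + 1) (simplex_matrix M J) v" for J v
        using simplex_value_eq[OF b M] that by simp
    qed (fact out)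
    then have "wp all_simplices (\<lambda>N' T' k'. T' (''out'', 0, 0) = tbvol b d (tconv_mat d m M) \<and>
        k' \<le> 136 * ((m choose (d + 1)) * d ^ 3)) N T 0"
      unfolding tbvol_eq_SUP[OF b M] by (rule wp_mono) (use bound in linarith)
    then show ?thesis using False N by (simp add: tbvol_program_def)
  qed
  then obtain t N' T' where "exec tbvol_program (N, T) t (N', T')"
    "T' (''out'', 0, 0) = tbvol b d (tconv_mat d m M)" "t \<le> 136 * ((m choose (d + 1)) * d ^ 3)"
    unfolding wp_def by auto
  then show ?thesis unfolding NT output_value_def by (intro exI[of _ t] exI[of _ "(N', T')"]) simp
qed

theorem proposition6p5:
  shows "(\<forall>(b::real) (d::nat) (m::nat) (M :: nat \<Rightarrow> nat \<Rightarrow> ereal).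
            1 < b \<longrightarrow> tmatrix d m M \<longrightarrow>
            tbvol b d (tconv_mat d m M) =
              tmax {(\<Sum>i=1..d. bt b d (tconv_mat d (d + 1) (select_columns M J)) i) | J.
                      J \<subseteq> {1..m} \<and> card J = d + 1 \<and>
                      nonsingular (d + 1) (append_zero_row d (select_columns M J))}) \<and>
         (\<exists>(prog::com) (C::nat). \<forall>(b::real) (d::nat) (m::nat) (M :: nat \<Rightarrow> nat \<Rightarrow> ereal).
            1 < b \<longrightarrow> tmatrix d m M \<longrightarrow>
            (\<exists>t s. exec prog (input_state d m M) t s \<and>
                   output_value s = tbvol b d (tconv_mat d m M) \<and>
                   t \<le> C * ((m choose (d + 1)) * d ^ 3)))"
proof (intro conjI allI impI)
  fix b :: real and d m :: nat and M :: "nat \<Rightarrow> nat \<Rightarrow> ereal"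
  assume bM: "1 < b" "tmatrix d m M"
  let ?\<J> = "{J. J \<subseteq> {1..m} \<and> card J = d + 1 \<and> unique_optimum (d + 1) (simplex_matrix M J)}"
  have "{(\<Sum>i=1..d. bt b d (tconv_mat d (d + 1) (select_columns M J)) i) | J.
      J \<subseteq> {1..m} \<and> card J = d + 1 \<and>
      nonsingular (d + 1) (append_zero_row d (select_columns M J))} = simplex_volume b d M ` ?\<J>"
    unfolding nonsingular_iff simplex_volume_def by auto
  moreover have "finite ?\<J>" by (rule finite_subset[of _ "Pow {1..m}"]) auto
  ultimately show "tbvol b d (tconv_mat d m M) =
      tmax {(\<Sum>i=1..d. bt b d (tconv_mat d (d + 1) (select_columns M J)) i) | J.
        J \<subseteq> {1..m} \<and> card J = d + 1 \<and>
        nonsingular (d + 1) (append_zero_row d (select_columns M J))}"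
    by (simp only: tbvol_eq_SUP[OF bM] tmax_image_finite)
next
  show "\<exists>(prog::com) (C::nat). \<forall>(b::real) (d::nat) (m::nat) (M :: nat \<Rightarrow> nat \<Rightarrow> ereal).
      1 < b \<longrightarrow> tmatrix d m M \<longrightarrow>
      (\<exists>t s. exec prog (input_state d m M) t s \<and>
             output_value s = tbvol b d (tconv_mat d m M) \<and>
             t \<le> C * ((m choose (d + 1)) * d ^ 3))"
    using exec_tbvol_program by blast
qed

end
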